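(* For integers $n\ge 2$ and $t\ge 0$ let $$h_n(t)=\operatorname*{CT}_{x_2,\dots,x_n}\ \frac{(1-x_n)\prod_{i=2}^{n-1}x_i^{n-1}\prod_{i=2}^{n-1}(x_i-x_n)}{x_n^{t}\prod_{i=2}^{n}(1-x_i)^{3}\prod_{2\le i<j\le n}(x_i-x_j)^{2}},$$ and for integers $m\ge 0$ and $k_1,k_2,k_3\ge 0$ let $$M(m;k_1,k_2,k_3)=\frac{1}{\prod_{i=1}^{m}x_i^{k_1-1}\prod_{i=1}^{m}(1-x_i)^{k_2}\prod_{1\le i<j\le m}(x_i-x_j)^{k_3}},\qquad M(0;k_1,k_2,k_3)=1 .$$ Then for every $n\ge 2$: (1) $h_n(t)$ is a polynomial in $t$ of degree $(n-1)^2$ with leading coefficient $\frac{1}{((n-1)^2)!}\operatorname*{CT}_{\boldsymbol{x}}M(n-1;1,1,2)$. (2) $h_n(t)=(-1)^{n-1}h_n(-t-n)$ (as polynomials in $t$). (3) Let $N=\left\lfloor\frac{(n-1)^2}{4}\right\rfloor$. Then $h_n(t)=P_n(t)\prod_{i=-N-n+1}^{N-1}(t-i)$, where $P_n(t)$ is a polynomial in $t$ of degree $(n-1)(n-2)-2N$. (4) With $N=\left\lfloor\frac{(n-1)^2}{4}\right\rfloor$, $$h_n(N)=\Big(\operatorname*{CT}_{\boldsymbol{x}}M\Big(\Big\lfloor\frac{n-1}{2}\Big\rfloor;\,2+\chi(n\text{ is even}),\,1,\,2\Big)\Big)^2 .$$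
   Context: $\operatorname*{CT}_{\boldsymbol{x}} f$ denotes the constant term of the Laurent series $f$ with respect to all the variables $x_i$ appearing in it. Rational functions are expanded as Laurent series according to the order $1>x_1>x_2>\cdots>x_n>0$ (a variable that does not occur is omitted): that is, $\frac1{1-x_i}=\sum_{k\ge0}x_i^k$ and, for $i<j$, $\frac1{x_i-x_j}=x_i^{-1}\sum_{k\ge 0}(x_j/x_i)^k$. $\chi(\text{true})=1$ and $\chi(\text{false})=0$. Part (1) asserts that $h_n$, defined on nonnegative integers $t$, agrees with a polynomial; in the other parts $h_n(t)$ denotes this polynomial, so it is defined for all $t$. *)

theory Defs
  imports "HOL-Library.Poly_Mapping" "HOL-Computational_Algebra.Polynomial"
begin

section \<open>Exponent vectors\<close>

text \<open>The exponent vector \<open>a\<close> encodes the monomial \<open>\<Prod>i. x\<^sub>i ^ a\<^sub>i\<close>; only finitely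
  many variables occur in a monomial.\<close>

type_synonym monomial = "nat \<Rightarrow>\<^sub>0 int"

definition tail :: "nat \<Rightarrow> monomial \<Rightarrow> int" where
  "tail i a = (\<Sum>j | j \<in> Poly_Mapping.keys a \<and> i \<le> j. Poly_Mapping.lookup a j)"

text \<open>Summation by parts gives
  \<open>\<Prod>i. x\<^sub>i ^ a\<^sub>i = x\<^sub>0 ^ tail 0 a * (\<Prod>i. (x\<^bsub>i+1\<^esub> / x\<^sub>i) ^ tail (i + 1) a)\<close>, so the following
  set consists of the monomials in \<open>x\<^sub>0\<close> and the ratios \<open>x\<^bsub>i+1\<^esub> / x\<^sub>i\<close> with nonnegative
  exponents.  These are the monomials that are 1 or less than 1 on account of
  \<open>1 > x\<^sub>0 > x\<^sub>1 > \<dots> > 0\<close> alone.\<close>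

definition small_monomials :: "monomial set" where
  "small_monomials = {a. \<forall>i. 0 \<le> tail i a}"

lemma tail_superset:
  assumes "finite A" "Poly_Mapping.keys a \<subseteq> A"
  shows "tail i a = (\<Sum>j | j \<in> A \<and> i \<le> j. Poly_Mapping.lookup a j)"
  unfolding tail_def
  by (rule sum.mono_neutral_left) (use assms in \<open>auto simp: in_keys_iff\<close>)

lemma tail_0 [simp]: "tail i 0 = 0"
  by (simp add: tail_def)

lemma tail_add: "tail i (a + b) = tail i a + tail i b"
proof -
  let ?A = "Poly_Mapping.keys a \<union> Poly_Mapping.keys b \<union> Poly_Mapping.keys (a + b)"
  have "tail i c = (\<Sum>j | j \<in> ?A \<and> i \<le> j. Poly_Mapping.lookup c j)" if "c \<in> {a, b, a + b}" for c
    by (rule tail_superset) (use that in auto)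
  thus ?thesis
    by (simp add: lookup_add sum.distrib)
qed

lemma tail_uminus: "tail i (- a) = - tail i a"
  using tail_add[of i a "- a"] by simp

lemma tail_diff: "tail i (a - b) = tail i a - tail i b"
  using tail_add[of i "a - b" b] by simp

lemma tail_single: "tail i (Poly_Mapping.single j c) = (if i \<le> j then c else 0)"
  by (subst tail_superset[of "{j}"]) (auto simp: conj_commute cong: conj_cong intro: sum.neutral)

lemma lookup_eq_tail: "Poly_Mapping.lookup a i = tail i a - tail (Suc i) a"
proof -
  let ?A = "insert i (Poly_Mapping.keys a)"
  have "{j. j \<in> ?A \<and> i \<le> j} = insert i {j. j \<in> ?A \<and> Suc i \<le> j}"
    by (auto simp: not_less_eq_eq)
  moreover have "i \<notin> {j. j \<in> ?A \<and> Suc i \<le> j}"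
    by auto
  moreover have "tail k a = (\<Sum>j | j \<in> ?A \<and> k \<le> j. Poly_Mapping.lookup a j)" for k
    by (rule tail_superset) auto
  ultimately show ?thesis
    by (simp only:) simp
qed

lemma tail_eq_0_cofinite: "\<exists>K. \<forall>i\<ge>K. tail i a = 0"
proof -
  obtain K where K: "\<forall>j\<in>Poly_Mapping.keys a. j < K"
    using finite_nat_set_iff_bounded[of "Poly_Mapping.keys a"] by auto
  have "tail i a = 0" if "K \<le> i" for i
    unfolding tail_def by (rule sum.neutral) (use K that in fastforce)
  thus ?thesis by blast
qed

lemma small_0 [simp]: "0 \<in> small_monomials"
  by (simp add: small_monomials_def)

lemma small_add: "a \<in> small_monomials \<Longrightarrow> b \<in> small_monomials \<Longrightarrow> a + b \<in> small_monomials"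
  by (simp add: small_monomials_def tail_add)

lemma small_directed:
  obtains m where "m1 - m \<in> small_monomials" "m2 - m \<in> small_monomials"
proof -
  define m :: monomial where
    "m = Abs_poly_mapping
      (\<lambda>i. min (Poly_Mapping.lookup m1 i) (Poly_Mapping.lookup m2 i))"
  have "finite {i. min (Poly_Mapping.lookup m1 i) (Poly_Mapping.lookup m2 i) \<noteq> 0}"
    by (rule finite_subset[of _ "Poly_Mapping.keys m1 \<union> Poly_Mapping.keys m2"])
      (auto simp: in_keys_iff min_def split: if_splits)
  hence m: "Poly_Mapping.lookup m i = min (Poly_Mapping.lookup m1 i) (Poly_Mapping.lookup m2 i)" for i
    unfolding m_def by (subst lookup_Abs_poly_mapping) auto
  show thesis
    by (rule that[of m])
      (auto simp: small_monomials_def tail_def lookup_minus m intro!: sum_nonneg)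
qed

lemma finite_small_box: "finite {a. a \<in> small_monomials \<and> c - a \<in> small_monomials}"
proof -
  obtain K where K: "\<And>i. i \<ge> K \<Longrightarrow> tail i c = 0"
    using tail_eq_0_cofinite by blast
  define T where "T = (\<Sum>i<K. \<bar>tail i c\<bar>)"
  have T: "tail i c \<le> T" for i
  proof (cases "i < K")
    case True
    hence "\<bar>tail i c\<bar> \<le> T"
      unfolding T_def by (intro member_le_sum) auto
    thus ?thesis by simp
  next
    case False
    thus ?thesis using K[of i] by (simp add: T_def sum_nonneg)
  qed
  let ?S = "{a. a \<in> small_monomials \<and> c - a \<in> small_monomials}"
  let ?F = "{f. \<forall>i. (i \<in> {..<K} \<longrightarrow> f i \<in> {-T..T}) \<and> (i \<notin> {..<K} \<longrightarrow> f i = 0)}"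
  have bd: "0 \<le> tail i a" "tail i a \<le> tail i c" if "a \<in> ?S" for a i
    using that by (auto simp: small_monomials_def tail_diff)
  have "Poly_Mapping.lookup a \<in> ?F" if a: "a \<in> ?S" for a
  proof -
    have "Poly_Mapping.lookup a i \<in> {-T..T}" for i
      using bd[OF a, of i] bd[OF a, of "Suc i"] T[of i] T[of "Suc i"]
      by (simp add: lookup_eq_tail)
    moreover have "Poly_Mapping.lookup a i = 0" if "i \<ge> K" for i
      using bd[OF a, of i] bd[OF a, of "Suc i"] K[of i] K[of "Suc i"] that
      by (simp add: lookup_eq_tail)
    ultimately show ?thesis by auto
  qed
  hence "Poly_Mapping.lookup ` ?S \<subseteq> ?F" by blast
  moreover have "finite ?F"
    by (rule finite_set_of_finite_funs) auto
  ultimately have "finite (Poly_Mapping.lookup ` ?S)"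
    using finite_subset by blast
  thus ?thesis
    by (rule finite_imageD) (simp add: inj_on_def lookup_inject)
qed


section \<open>Laurent series in \<open>1 > x\<^sub>0 > x\<^sub>1 > x\<^sub>2 > \<dots> > 0\<close>\<close>

text \<open>A Laurent series is a monomial times a power series in \<open>x\<^sub>0\<close> and the ratios
  \<open>x\<^bsub>i+1\<^esub> / x\<^sub>i\<close>.  This makes products well-defined and selects, for the reciprocals of
  \<open>1 - x\<^sub>i\<close> and of \<open>x\<^sub>i - x\<^sub>j\<close>, the expansion that belongs to the order (see
  \<open>mls_coeff_inverse_one_minus_X\<close> and \<open>mls_coeff_inverse_X_diff\<close> below).\<close>

typedef (overloaded) 'a mls =
  "{f :: monomial \<Rightarrow> 'a::zero. \<exists>m. \<forall>a. f a \<noteq> 0 \<longrightarrow> a - m \<in> small_monomials}"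
  morphisms mls_coeff Abs_mls
  by (rule exI[of _ "\<lambda>_. 0"]) auto

lifting_forget poly_mapping.lifting
setup_lifting type_definition_mls

lemma mls_eqI: "(\<And>a. mls_coeff f a = mls_coeff g a) \<Longrightarrow> f = g"
  by (simp add: mls_coeff_inject[symmetric] fun_eq_iff)

lemma mls_shift: "\<exists>m. \<forall>a. mls_coeff f a \<noteq> 0 \<longrightarrow> a - m \<in> small_monomials"
  using mls_coeff[of f] by auto

definition conv_support :: "(monomial \<Rightarrow> 'a::zero) \<Rightarrow> (monomial \<Rightarrow> 'a) \<Rightarrow> monomial \<Rightarrow> monomial set" where
  "conv_support f g c = {a. f a \<noteq> 0 \<and> g (c - a) \<noteq> 0}"

lemma finite_conv_support:
  assumes "\<And>a. f a \<noteq> 0 \<Longrightarrow> a - m \<in> small_monomials" "\<And>a. g a \<noteq> 0 \<Longrightarrow> a - k \<in> small_monomials"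
  shows "finite (conv_support f g c)"
proof -
  let ?S = "{a. a \<in> small_monomials \<and> (c - m - k) - a \<in> small_monomials}"
  have "a \<in> (\<lambda>a. a + m) ` ?S" if "a \<in> conv_support f g c" for a
  proof -
    have "(c - m - k) - (a - m) = (c - a) - k" by simp
    hence "a - m \<in> ?S"
      using that assms(1)[of a] assms(2)[of "c - a"] unfolding conv_support_def by (auto simp only: mem_Collect_eq)
    thus ?thesis by (rule rev_image_eqI) simp
  qed
  hence "conv_support f g c \<subseteq> (\<lambda>a. a + m) ` ?S" by blast
  thus ?thesis
    using finite_small_box finite_subset by blast
qed

lemma finite_conv_support_mls: "finite (conv_support (mls_coeff f) (mls_coeff g) c)"
proof -
  obtain m where m: "\<And>a. mls_coeff f a \<noteq> 0 \<Longrightarrow> a - m \<in> small_monomials"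
    using mls_shift by blast
  obtain k where k: "\<And>a. mls_coeff g a \<noteq> 0 \<Longrightarrow> a - k \<in> small_monomials"
    using mls_shift by blast
  show ?thesis by (rule finite_conv_support[OF m k])
qed

instantiation mls :: (zero) zero
begin
lift_definition zero_mls :: "'a mls" is "\<lambda>_. 0" by auto
instance ..
end

instantiation mls :: (comm_monoid_add) plus
begin
lift_definition plus_mls :: "'a mls \<Rightarrow> 'a mls \<Rightarrow> 'a mls" is "\<lambda>f g a. f a + g a"
proof -
  fix f g :: "monomial \<Rightarrow> 'a"
  assume "\<exists>m. \<forall>a. f a \<noteq> 0 \<longrightarrow> a - m \<in> small_monomials"
    and "\<exists>m. \<forall>a. g a \<noteq> 0 \<longrightarrow> a - m \<in> small_monomials"
  then obtain m1 m2 where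
    *: "\<And>a. f a \<noteq> 0 \<Longrightarrow> a - m1 \<in> small_monomials" "\<And>a. g a \<noteq> 0 \<Longrightarrow> a - m2 \<in> small_monomials"
    by blast
  obtain m where m: "m1 - m \<in> small_monomials" "m2 - m \<in> small_monomials"
    using small_directed .
  have "a - m \<in> small_monomials" if "f a + g a \<noteq> 0" for a
  proof (cases "f a = 0")
    case True
    hence "(a - m2) + (m2 - m) \<in> small_monomials" using that *(2) m(2) by (intro small_add) auto
    thus ?thesis by simp
  next
    case False
    hence "(a - m1) + (m1 - m) \<in> small_monomials" using that *(1) m(1) by (intro small_add) auto
    thus ?thesis by simp
  qed
  thus "\<exists>m. \<forall>a. f a + g a \<noteq> 0 \<longrightarrow> a - m \<in> small_monomials" by blast
qed
instance ..
end

instantiation mls :: (ab_group_add) uminus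
begin
lift_definition uminus_mls :: "'a mls \<Rightarrow> 'a mls" is "\<lambda>f a. - f a" by simp
instance ..
end

instantiation mls :: (ab_group_add) minus
begin
definition minus_mls :: "'a mls \<Rightarrow> 'a mls \<Rightarrow> 'a mls" where "minus_mls f g = f + (- g)"
instance ..
end

lift_definition mls_monom :: "monomial \<Rightarrow> 'a::zero_neq_one mls" is
  "\<lambda>u a. if a = u then 1 else 0"
  by (metis diff_self small_0)

instantiation mls :: (zero_neq_one) one
begin
definition one_mls :: "'a mls" where "one_mls = mls_monom 0"
instance ..
end

text \<open>In the product, the set \<open>conv_support f g c\<close> is finite by
  \<open>finite_conv_support_mls\<close>.\<close>

instantiation mls :: (comm_semiring_0) times
begin
lift_definition times_mls :: "'a mls \<Rightarrow> 'a mls \<Rightarrow> 'a mls" is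
  "\<lambda>f g c. \<Sum>a\<in>conv_support f g c. f a * g (c - a)"
proof -
  fix f g :: "monomial \<Rightarrow> 'a"
  assume "\<exists>m. \<forall>a. f a \<noteq> 0 \<longrightarrow> a - m \<in> small_monomials"
    and "\<exists>m. \<forall>a. g a \<noteq> 0 \<longrightarrow> a - m \<in> small_monomials"
  then obtain m k where
    *: "\<And>a. f a \<noteq> 0 \<Longrightarrow> a - m \<in> small_monomials" "\<And>a. g a \<noteq> 0 \<Longrightarrow> a - k \<in> small_monomials"
    by blast
  have "c - (m + k) \<in> small_monomials"
    if "(\<Sum>a\<in>conv_support f g c. f a * g (c - a)) \<noteq> 0" for c
  proof -
    from that obtain a where "a \<in> conv_support f g c"
      by (meson sum.not_neutral_contains_not_neutral)
    hence "(a - m) + ((c - a) - k) \<in> small_monomials"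
      by (intro small_add *) (auto simp: conv_support_def)
    thus ?thesis by (simp add: algebra_simps)
  qed
  thus "\<exists>m. \<forall>c. (\<Sum>a\<in>conv_support f g c. f a * g (c - a)) \<noteq> 0 \<longrightarrow> c - m \<in> small_monomials"
    by blast
qed
instance ..
end

lemma mls_coeff_0 [simp]: "mls_coeff 0 a = 0"
  by transfer simp

lemma mls_coeff_add [simp]: "mls_coeff (f + g) a = mls_coeff f a + mls_coeff g a"
  by transfer simp

lemma mls_coeff_uminus [simp]: "mls_coeff (- f) a = - mls_coeff f a"
  by transfer simp

lemma mls_coeff_diff [simp]: "mls_coeff (f - g) a = mls_coeff f a - mls_coeff g a"
  by (simp add: minus_mls_def)

lemma mls_coeff_monom: "mls_coeff (mls_monom u) a = (if a = u then 1 else 0)"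
  by transfer simp

lemma mls_coeff_1: "mls_coeff 1 a = (if a = 0 then 1 else 0)"
  by (simp add: one_mls_def mls_coeff_monom)

lemma mls_coeff_mult:
  "mls_coeff (f * g) c =
    (\<Sum>a | mls_coeff f a \<noteq> 0 \<and> mls_coeff g (c - a) \<noteq> 0. mls_coeff f a * mls_coeff g (c - a))"
  by transfer (simp add: conv_support_def)

lemma mls_coeff_mult_superset:
  assumes "finite A" "\<And>a. mls_coeff f a \<noteq> 0 \<Longrightarrow> mls_coeff g (c - a) \<noteq> 0 \<Longrightarrow> a \<in> A"
  shows "mls_coeff (f * g) c = (\<Sum>a\<in>A. mls_coeff f a * mls_coeff g (c - a))"
  unfolding mls_coeff_mult
  by (rule sum.mono_neutral_left) (use assms in auto)

lemma mls_coeff_monom_mult: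
  "mls_coeff (mls_monom u * f) c = mls_coeff (f :: 'a::comm_semiring_1 mls) (c - u)"
  by (subst mls_coeff_mult_superset[of "{u}"]) (auto simp: mls_coeff_monom split: if_splits)

lemma mls_mult_commute: "f * g = g * (f :: 'a::comm_semiring_0 mls)"
proof (rule mls_eqI)
  fix c
  show "mls_coeff (f * g) c = mls_coeff (g * f) c"
    unfolding mls_coeff_mult
    by (rule sum.reindex_bij_witness[of _ "\<lambda>a. c - a" "\<lambda>a. c - a"]) (auto simp: mult.commute)
qed

lemma mls_mult_assoc: "(f * g) * h = f * (g * (h :: 'a::comm_semiring_0 mls))"
proof (rule mls_eqI)
  fix d
  obtain m1 where m1: "\<And>a. mls_coeff f a \<noteq> 0 \<Longrightarrow> a - m1 \<in> small_monomials" using mls_shift by blast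
  obtain m2 where m2: "\<And>a. mls_coeff g a \<noteq> 0 \<Longrightarrow> a - m2 \<in> small_monomials" using mls_shift by blast
  obtain m3 where m3: "\<And>a. mls_coeff h a \<noteq> 0 \<Longrightarrow> a - m3 \<in> small_monomials" using mls_shift by blast
  define B where "B = {a. a \<in> small_monomials \<and> (d - m1 - m2 - m3) - a \<in> small_monomials}"
  define A where "A = (\<lambda>a. a + m1) ` B"
  define E where "E = (\<lambda>a. a + (m1 + m2)) ` B"
  have fin: "finite A" "finite E"
    unfolding A_def E_def B_def by (auto intro: finite_small_box)
  have AE: "a \<in> A \<and> a + b \<in> E"
    if "mls_coeff f a \<noteq> 0" "mls_coeff g b \<noteq> 0" "mls_coeff h (d - a - b) \<noteq> 0" for a b
  proof -
    note s = m1[OF that(1)] m2[OF that(2)] m3[OF that(3)]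
    have "(d - m1 - m2 - m3) - (a - m1) = (b - m2) + ((d - a - b) - m3)"
      "(d - m1 - m2 - m3) - ((a - m1) + (b - m2)) = (d - a - b) - m3"
      by (simp_all add: algebra_simps)
    hence "a - m1 \<in> B" "(a - m1) + (b - m2) \<in> B"
      unfolding B_def mem_Collect_eq using s by (simp_all only: small_add simp_thms)
    moreover have "a = (a - m1) + m1" "a + b = ((a - m1) + (b - m2)) + (m1 + m2)"
      by (simp_all add: algebra_simps)
    ultimately show ?thesis
      unfolding A_def E_def by (metis imageI)
  qed
  have AE': "e \<in> E" if "mls_coeff (f * g) e \<noteq> 0" "mls_coeff h (d - e) \<noteq> 0" for e
  proof -
    from that(1) obtain a where "mls_coeff f a \<noteq> 0" "mls_coeff g (e - a) \<noteq> 0"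
      unfolding mls_coeff_mult by (auto elim: sum.not_neutral_contains_not_neutral)
    thus ?thesis using AE[of a "e - a"] that(2) by simp
  qed
  have AE'': "a \<in> A" if "mls_coeff f a \<noteq> 0" "mls_coeff (g * h) (d - a) \<noteq> 0" for a
  proof -
    from that(2) obtain b where "mls_coeff g b \<noteq> 0" "mls_coeff h (d - a - b) \<noteq> 0"
      unfolding mls_coeff_mult by (auto elim: sum.not_neutral_contains_not_neutral)
    thus ?thesis using AE[of a b] that(1) by simp
  qed
  have 1: "mls_coeff (f * g) e * mls_coeff h (d - e) =
      (\<Sum>a\<in>A. mls_coeff f a * mls_coeff g (e - a) * mls_coeff h (d - e))" for e
  proof (cases "mls_coeff h (d - e) = 0")
    case False
    have "mls_coeff (f * g) e = (\<Sum>a\<in>A. mls_coeff f a * mls_coeff g (e - a))"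
    proof (rule mls_coeff_mult_superset[OF fin(1)])
      fix a assume "mls_coeff f a \<noteq> 0" "mls_coeff g (e - a) \<noteq> 0"
      thus "a \<in> A" using AE[of a "e - a"] False by simp
    qed
    thus ?thesis by (simp add: sum_distrib_right)
  qed simp
  have 2: "mls_coeff f a * mls_coeff (g * h) (d - a) =
      (\<Sum>e\<in>E. mls_coeff f a * mls_coeff g (e - a) * mls_coeff h (d - e))" for a
  proof (cases "mls_coeff f a = 0")
    case False
    have "mls_coeff (g * h) (d - a) =
        (\<Sum>b\<in>(\<lambda>e. e - a) ` E. mls_coeff g b * mls_coeff h (d - a - b))"
    proof (rule mls_coeff_mult_superset)
      fix b assume "mls_coeff g b \<noteq> 0" "mls_coeff h (d - a - b) \<noteq> 0"
      hence "a + b \<in> E" using AE False by blast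
      thus "b \<in> (\<lambda>e. e - a) ` E" by (rule rev_image_eqI) simp
    qed (use fin in simp)
    also have "\<dots> = (\<Sum>e\<in>E. mls_coeff g (e - a) * mls_coeff h (d - e))"
      by (subst sum.reindex) (simp_all add: inj_on_def diff_diff_eq2)
    finally show ?thesis by (simp add: sum_distrib_left mult.assoc)
  qed simp
  have "mls_coeff (f * g * h) d = (\<Sum>e\<in>E. mls_coeff (f * g) e * mls_coeff h (d - e))"
    by (rule mls_coeff_mult_superset[OF fin(2)]) (rule AE')
  also have "\<dots> = (\<Sum>a\<in>A. mls_coeff f a * mls_coeff (g * h) (d - a))"
    unfolding 1 2 by (rule sum.swap)
  also have "\<dots> = mls_coeff (f * (g * h)) d"
    by (rule mls_coeff_mult_superset[OF fin(1), symmetric]) (rule AE'')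
  finally show "mls_coeff (f * g * h) d = mls_coeff (f * (g * h)) d" .
qed

lemma mls_distrib_right: "(f + g) * h = f * h + g * (h :: 'a::comm_semiring_0 mls)"
proof (rule mls_eqI)
  fix c
  let ?A = "conv_support (mls_coeff f) (mls_coeff h) c \<union> conv_support (mls_coeff g) (mls_coeff h) c"
  have fin: "finite ?A" using finite_conv_support_mls by blast
  have "mls_coeff (k * h) c = (\<Sum>a\<in>?A. mls_coeff k a * mls_coeff h (c - a))"
    if "k \<in> {f, g, f + g}" for k
    by (rule mls_coeff_mult_superset[OF fin]) (use that in \<open>auto simp: conv_support_def\<close>)
  thus "mls_coeff ((f + g) * h) c = mls_coeff (f * h + g * h) c"
    by (simp add: distrib_right sum.distrib)
qed

instance mls :: (comm_ring_1) comm_ring_1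
proof
  fix f g h :: "'a mls"
  show "f + g + h = f + (g + h)" by (rule mls_eqI) (simp add: add.assoc)
  show "f + g = g + f" by (rule mls_eqI) (simp add: add.commute)
  show "0 + f = f" "- f + f = 0" "f - g = f + - g" by (rule mls_eqI, simp)+
  show "f * g * h = f * (g * h)" by (rule mls_mult_assoc)
  show "f * g = g * f" by (rule mls_mult_commute)
  show "(f + g) * h = f * h + g * h" by (rule mls_distrib_right)
  show "1 * f = f" by (rule mls_eqI) (simp add: one_mls_def mls_coeff_monom_mult)
  have "mls_coeff (0 :: 'a mls) 0 \<noteq> mls_coeff 1 0" by (simp add: mls_coeff_1)
  thus "(0 :: 'a mls) \<noteq> 1" by metis
qed

text \<open>Inverses are unique in a commutative ring.  As usual in HOL, the inverse of an element
  that has none is 0; all denominators used below are invertible.\<close>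

instantiation mls :: (comm_ring_1) inverse
begin
definition inverse_mls :: "'a mls \<Rightarrow> 'a mls" where
  "inverse_mls f = (if \<exists>g. f * g = 1 then THE g. f * g = 1 else 0)"
definition divide_mls :: "'a mls \<Rightarrow> 'a mls \<Rightarrow> 'a mls" where
  "divide_mls f g = f * inverse g"
instance ..
end

lemma inverse_mls_eqI:
  assumes "f * g = 1"
  shows "inverse f = (g :: 'a::comm_ring_1 mls)"
proof -
  have "k = g" if "f * k = 1" for k
    using assms that by (metis mult.assoc mult.commute mult_1)
  hence "(THE g. f * g = 1) = g"
    using assms by blast
  thus ?thesis using assms by (auto simp: inverse_mls_def)
qed

lemma mls_monom_mult: "mls_monom u * mls_monom v = (mls_monom (u + v) :: 'a::comm_ring_1 mls)"
  by (rule mls_eqI) (auto simp: mls_coeff_monom_mult mls_coeff_monom algebra_simps)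

definition X :: "nat \<Rightarrow> 'a::comm_ring_1 mls" where
  "X i = mls_monom (Poly_Mapping.single i 1)"

definition CT :: "'a::zero mls \<Rightarrow> 'a" where
  "CT f = mls_coeff f 0"


section \<open>The expansions of the reciprocals\<close>

text \<open>The geometric series of a small monomial other than 1.\<close>

lift_definition mls_geometric :: "monomial \<Rightarrow> 'a::comm_ring_1 mls" is
  "\<lambda>u a. if u \<in> small_monomials \<and> (\<exists>k. a = ((+) u ^^ k) 0) then 1 else 0"
proof -
  fix u :: monomial
  have "((+) u ^^ k) 0 \<in> small_monomials" if "u \<in> small_monomials" for k
    by (induction k) (auto intro: small_add that)
  thus "\<exists>m. \<forall>a. (if u \<in> small_monomials \<and> (\<exists>k. a = ((+) u ^^ k) 0) then 1 else 0::'a) \<noteq> 0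
      \<longrightarrow> a - m \<in> small_monomials"
    by (intro exI[of _ 0]) auto
qed

lemma funpow_add_monomial:
  "Poly_Mapping.lookup (((+) u ^^ k) (0 :: monomial)) i = int k * Poly_Mapping.lookup u i"
  by (induction k) (auto simp: lookup_add algebra_simps)

lemma mls_geometric_inverse:
  assumes "u \<in> small_monomials" "u \<noteq> 0"
  shows "(1 - mls_monom u) * (mls_geometric u :: 'a::comm_ring_1 mls) = 1"
proof (rule mls_eqI)
  fix a
  have coeff: "mls_coeff (mls_geometric u :: 'a mls) b = (if \<exists>k. b = ((+) u ^^ k) 0 then 1 else 0)" for b
    using assms(1) by transfer simp
  obtain i where i: "Poly_Mapping.lookup u i \<noteq> 0"
    using assms(2) by (metis poly_mapping_eqI lookup_zero)
  have not0: "((+) u ^^ Suc k) 0 \<noteq> (0 :: monomial)" for k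
  proof
    assume "((+) u ^^ Suc k) 0 = (0 :: monomial)"
    hence "int (Suc k) * Poly_Mapping.lookup u i = 0"
      by (metis funpow_add_monomial lookup_zero)
    thus False using i by simp
  qed
  have step: "(\<exists>k. a - u = ((+) u ^^ k) 0) \<longleftrightarrow> (\<exists>k. a = ((+) u ^^ Suc k) 0)"
    by (simp add: algebra_simps)
  have split: "(\<exists>k. a = ((+) u ^^ k) 0) \<longleftrightarrow> a = 0 \<or> (\<exists>k. a = ((+) u ^^ Suc k) 0)"
    by (metis funpow_0 not0_implies_Suc)
  have "mls_coeff ((1 - mls_monom u) * mls_geometric u :: 'a mls) a =
      mls_coeff (mls_geometric u :: 'a mls) a - mls_coeff (mls_geometric u :: 'a mls) (a - u)"
    by (simp add: left_diff_distrib mls_coeff_monom_mult)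
  also have "\<dots> = mls_coeff 1 a"
    unfolding coeff step split using not0 by (auto simp: mls_coeff_1 simp del: funpow.simps)
  finally show "mls_coeff ((1 - mls_monom u) * mls_geometric u :: 'a mls) a = mls_coeff 1 a" .
qed

lemma mls_coeff_inverse_one_minus_X:
  "mls_coeff (inverse (1 - X i) :: 'a::comm_ring_1 mls) a =
    (if \<exists>k. a = Poly_Mapping.single i (int k) then 1 else 0)"
proof -
  let ?u = "Poly_Mapping.single i 1 :: monomial"
  have u: "?u \<in> small_monomials" "?u \<noteq> 0"
    by (auto simp: small_monomials_def tail_single)
  have "((+) ?u ^^ k) 0 = Poly_Mapping.single i (int k)" for k
    by (rule poly_mapping_eqI) (simp add: funpow_add_monomial lookup_single when_def)
  moreover have "inverse (1 - X i) = (mls_geometric ?u :: 'a mls)"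
    unfolding X_def by (rule inverse_mls_eqI[OF mls_geometric_inverse[OF u]])
  ultimately show ?thesis
    using u(1) by (simp add: mls_geometric.rep_eq)
qed

lemma mls_coeff_inverse_X_diff:
  assumes "i < j"
  shows "mls_coeff (inverse (X i - X j) :: 'a::comm_ring_1 mls) a =
    (if \<exists>k. a = Poly_Mapping.single j (int k) - Poly_Mapping.single i (int k + 1) then 1 else 0)"
proof -
  let ?e = "\<lambda>i. Poly_Mapping.single i 1 :: monomial"
  let ?u = "?e j - ?e i"
  have "tail i' ?u \<ge> 0" for i'
    using assms by (simp add: tail_diff tail_single)
  moreover have "?u \<noteq> 0"
  proof
    assume "?u = 0"
    hence "Poly_Mapping.lookup ?u j = 0" by simp
    thus False using assms by (simp add: lookup_minus lookup_single when_def)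
  qed
  ultimately have u: "?u \<in> small_monomials" "?u \<noteq> 0"
    by (simp_all add: small_monomials_def)
  have pow: "((+) ?u ^^ k) 0 - ?e i = Poly_Mapping.single j (int k) - Poly_Mapping.single i (int k + 1)" for k
    by (rule poly_mapping_eqI)
      (simp add: funpow_add_monomial lookup_minus lookup_single when_def algebra_simps)
  have "X i - X j = (mls_monom (?e i) * (1 - mls_monom ?u) :: 'a mls)"
    by (simp add: X_def right_diff_distrib mls_monom_mult)
  moreover have "mls_monom (?e i) * (1 - mls_monom ?u) * (mls_monom (- ?e i) * mls_geometric ?u)
      = (1 :: 'a mls)"
  proof -
    have "mls_monom (?e i) * (1 - mls_monom ?u) * (mls_monom (- ?e i) * mls_geometric ?u)
      = (mls_monom (?e i) * mls_monom (- ?e i)) * ((1 - mls_monom ?u) * (mls_geometric ?u :: 'a mls))"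
      by (simp only: mult_ac)
    also have "\<dots> = 1"
      by (simp only: mls_geometric_inverse[OF u] mls_monom_mult add.right_inverse
          one_mls_def[symmetric] mult_1_left)
    finally show ?thesis .
  qed
  ultimately have "inverse (X i - X j) = (mls_monom (- ?e i) * mls_geometric ?u :: 'a mls)"
    by (intro inverse_mls_eqI) simp
  hence "mls_coeff (inverse (X i - X j) :: 'a mls) a = mls_coeff (mls_geometric ?u :: 'a mls) (a + ?e i)"
    by (simp add: mls_coeff_monom_mult)
  moreover have "a + ?e i = ((+) ?u ^^ k) 0 \<longleftrightarrow>
      a = Poly_Mapping.single j (int k) - Poly_Mapping.single i (int k + 1)" for k
    using pow[of k] by (metis add_diff_cancel_right' diff_add_cancel)
  ultimately show ?thesis
    using u(1) by (simp add: mls_geometric.rep_eq)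
qed


section \<open>The constant terms of the theorem\<close>

text \<open>The products over \<open>i < j\<close> are written as nested products.\<close>

definition h :: "nat \<Rightarrow> nat \<Rightarrow> rat" where
  "h n t = CT (
     ((1 - X n) * (\<Prod>i=2..n-1. X i ^ (n - 1)) * (\<Prod>i=2..n-1. (X i - X n))) /
     (X n ^ t * (\<Prod>i=2..n. (1 - X i) ^ 3) * (\<Prod>i=2..n. \<Prod>j=i+1..n. (X i - X j) ^ 2)))"

definition M :: "nat \<Rightarrow> nat \<Rightarrow> nat \<Rightarrow> nat \<Rightarrow> rat mls" where
  "M m k1 k2 k3 = 1 /
     ((\<Prod>i=1..m. X i powi (int k1 - 1)) * (\<Prod>i=1..m. (1 - X i) ^ k2) *
      (\<Prod>i=1..m. \<Prod>j=i+1..m. (X i - X j) ^ k3))"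

lemma M_0: "M 0 k1 k2 k3 = 1"
  by (simp add: M_def divide_mls_def inverse_mls_eqI)

end

theory Submission
  imports Defs "HOL-Computational_Algebra.Polynomial_FPS"
begin

unbundle fps_syntax

text \<open>Put \<open>k = n - 2\<close>, \<open>z = x\<^sub>n\<close>, and let \<open>L f\<close> be the constant term of
  \<open>\<Prod>f(y\<^sub>i) \<cdot> \<Prod>(y\<^sub>i - y\<^sub>j)\<^bsup>-2\<^esup>\<close> in \<open>k\<close> variables.  The kernel is annihilated by the vector
  fields \<open>\<Sum>\<partial>\<^sub>i\<close>, and up to a multiplier by \<open>\<Sum>y\<^sub>i \<partial>\<^sub>i\<close> and \<open>\<Sum>y\<^sub>i\<^sup>2 \<partial>\<^sub>i\<close>, so constant terms are
  invariant under projective substitutions.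

  In the variables \<open>y\<^sub>i = x\<^bsub>i+1\<^esub>\<close> the integrand defining \<open>h\<close> has a simple pole at \<open>z\<close>, a triple
  pole at 1 and zeros of order \<open>k\<close> at 0 and at infinity.  Translating the simple pole to 0 and
  rescaling by \<open>1 - z\<close> gives
  \<open>\<Sum>h(t) z\<^sup>t = W(z) / (1 - z)\<^bsup>(n-1)\<^sup>2+1\<^esup>\<close> with \<open>W(z) = L ((z + (1 - z) y)\<^sup>k (1 - y)\<^bsup>-3\<^esup>)\<close>; sending
  the triple pole to infinity gives \<open>W(z) = z\<^sup>k L ((1 + y)\<^sup>k (1 + z y)\<^sup>k)\<close>, which is visibly
  palindromic.  Its lowest coefficient is a product of two constant terms, each of which a
  projective substitution turns into the Morris constant term of part (4).\<close>


text \<open>The ring \<open>mls\<close> is tied to one order of the variables, so a projective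
  substitution is not at hand as a map on it; each kind gets a substitute. Translation becomes
  integration by parts against the field \<Sum>d/dx_i. Moving a pole to infinity becomes a family
  whose coefficients are polynomials in a parameter s, and the constant term has s-derivative 0.
  Inversion reverses the order, so it becomes a monomial map that borrows two spare neighbouring
  variables. Moving the pole is possible only if the weights balance: with an additional factor
  y^(-e) per variable they must add up to 2k - 3 + e. Two zeros of order k and one triple pole give
  exactly 2k - 3. The exponent (n-1)^2 + 1 is k(k-1) from the homogeneity of the kernel, plus 3k
  from the triple poles, plus 2 from a remaining (1-z)^(-2). With d = (n-1)^2 and W = \<Sum>w_j z^j,
  h is the combination of the polynomials binomial(t - j + d, d) with weights w_j. Only N \<le> j
  \<le> k^2 + k - N occurs, and all these polynomials vanish on the interval in (3). At t = N only j
  = N survives, which gives (4).\<close>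

section \<open>Inverses of units\<close>

lemma mls_mult_inverse:
  assumes "f * g = 1"
  shows "f * inverse f = (1 :: 'a::comm_ring_1 mls)"
  using assms inverse_mls_eqI[OF assms] by simp

text \<open>Because \<open>inverse\<close> is 0 on non-units, invertibility is carried along in the
  form \<open>f * inverse f = 1\<close>; the second conclusion passes it on to the product.\<close>

lemma mls_inverse_mult:
  assumes "f * inverse f = 1" "g * inverse g = 1"
  shows "inverse (f * g) = inverse f * inverse (g :: 'a::comm_ring_1 mls)"
    and "(f * g) * inverse (f * g) = 1"
proof -
  have "(f * g) * (inverse f * inverse g) = (f * inverse f) * (g * inverse g)"
    by (simp only: mult_ac)
  hence 1: "(f * g) * (inverse f * inverse g) = 1"
    using assms by simp
  thus "inverse (f * g) = inverse f * inverse g"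
    by (rule inverse_mls_eqI)
  show "(f * g) * inverse (f * g) = 1"
    using 1 by (rule mls_mult_inverse)
qed

lemma mls_inverse_1 [simp]: "inverse (1 :: 'a::comm_ring_1 mls) = 1"
  by (rule inverse_mls_eqI) simp

lemma mls_inverse_prod:
  fixes f :: "'b \<Rightarrow> 'a::comm_ring_1 mls"
  assumes "\<And>i. i \<in> A \<Longrightarrow> f i * inverse (f i) = 1"
  shows "inverse (prod f A) = (\<Prod>i\<in>A. inverse (f i))"
    and "prod f A * inverse (prod f A) = 1"
proof -
  have "inverse (prod f A) = (\<Prod>i\<in>A. inverse (f i)) \<and> prod f A * inverse (prod f A) = 1"
    using assms
  proof (induction A rule: infinite_finite_induct)
    case (insert x F)
    hence "inverse (prod f F) = (\<Prod>i\<in>F. inverse (f i))" "prod f F * inverse (prod f F) = 1"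
      "f x * inverse (f x) = 1"
      by auto
    thus ?case
      using mls_inverse_mult[of "f x" "prod f F"] insert.hyps by simp
  qed simp_all
  thus "inverse (prod f A) = (\<Prod>i\<in>A. inverse (f i))" "prod f A * inverse (prod f A) = 1"
    by auto
qed

lemma mls_inverse_power:
  fixes f :: "'a::comm_ring_1 mls"
  assumes "f * inverse f = 1"
  shows "inverse (f ^ m) = inverse f ^ m" and "f ^ m * inverse (f ^ m) = 1"
  using mls_inverse_prod[of "{..<m}" "\<lambda>_. f"] assms by simp_all

lemma mls_monom_0 [simp]: "mls_monom 0 = (1 :: 'a::comm_ring_1 mls)"
  by (simp add: one_mls_def)

lemma mls_monom_prod:
  "(\<Prod>i\<in>A. mls_monom (u i)) = (mls_monom (\<Sum>i\<in>A. u i) :: 'a::comm_ring_1 mls)"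
  by (induction A rule: infinite_finite_induct) (simp_all add: mls_monom_mult)

lemma inverse_mls_monom: "inverse (mls_monom u) = (mls_monom (- u) :: 'a::comm_ring_1 mls)"
  by (rule inverse_mls_eqI) (simp add: mls_monom_mult)

lemma mls_monom_unit: "mls_monom u * inverse (mls_monom u) = (1 :: 'a::comm_ring_1 mls)"
  by (simp add: inverse_mls_monom mls_monom_mult)

lemma X_unit: "X i * inverse (X i) = (1 :: 'a::comm_ring_1 mls)"
  by (simp add: X_def mls_monom_unit)

lemma X_power: "X i ^ m = (mls_monom (Poly_Mapping.single i (int m)) :: 'a::comm_ring_1 mls)"
  by (induction m) (simp_all add: X_def mls_monom_mult single_add)

lemma one_minus_X_unit: "(1 - X i) * inverse (1 - X i) = (1 :: 'a::comm_ring_1 mls)"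
proof (rule mls_mult_inverse)
  show "(1 - X i) * mls_geometric (Poly_Mapping.single i 1) = (1 :: 'a mls)"
    unfolding X_def
    by (rule mls_geometric_inverse) (auto simp: small_monomials_def tail_single)
qed

lemma X_diff_unit:
  assumes "i < j"
  shows "(X i - X j) * inverse (X i - X j) = (1 :: 'a::comm_ring_1 mls)"
proof -
  let ?e = "\<lambda>i. Poly_Mapping.single i 1 :: monomial"
  let ?u = "?e j - ?e i"
  have "?u \<noteq> 0"
  proof
    assume "?u = 0"
    hence "Poly_Mapping.lookup ?u j = 0" by simp
    thus False using assms by (simp add: lookup_minus lookup_single when_def)
  qed
  hence "(1 - mls_monom ?u) * mls_geometric ?u = (1 :: 'a mls)"
    using assms by (intro mls_geometric_inverse) (auto simp: small_monomials_def tail_diff tail_single)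
  hence 1: "(1 - mls_monom ?u) * inverse (1 - mls_monom ?u) = (1 :: 'a mls)"
    by (rule mls_mult_inverse)
  have "X i - X j = (mls_monom (?e i) * (1 - mls_monom ?u) :: 'a mls)"
    by (simp add: X_def right_diff_distrib mls_monom_mult)
  thus ?thesis
    using mls_inverse_mult(2)[OF mls_monom_unit 1] by metis
qed

subsection \<open>Derivations\<close>

text \<open>The Euler operator x_i d/dx_i. It is diagonal on monomials, hence respects supports, and
  its values have constant term 0, which is the source of every integration by parts.\<close>

lift_definition mls_theta :: "nat \<Rightarrow> 'a::comm_ring_1 mls \<Rightarrow> 'a mls" is
  "\<lambda>i f a. of_int (Poly_Mapping.lookup a i) * f a"
  by (metis mult_zero_right)

lemma mls_coeff_theta [simp]:
  "mls_coeff (mls_theta i f) a = of_int (Poly_Mapping.lookup a i) * mls_coeff f a"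
  by transfer simp

lemma mls_theta_mult: "mls_theta i (f * g) = mls_theta i f * g + f * mls_theta i (g :: 'a::comm_ring_1 mls)"
proof (rule mls_eqI)
  fix c
  let ?A = "conv_support (mls_coeff f) (mls_coeff g) c"
  have fin: "finite ?A" by (rule finite_conv_support_mls)
  have 1: "mls_coeff (f * g) c = (\<Sum>a\<in>?A. mls_coeff f a * mls_coeff g (c - a))"
    by (rule mls_coeff_mult_superset[OF fin]) (auto simp: conv_support_def)
  have 2: "mls_coeff (mls_theta i f * g) c = (\<Sum>a\<in>?A. mls_coeff (mls_theta i f) a * mls_coeff g (c - a))"
    by (rule mls_coeff_mult_superset[OF fin]) (auto simp: conv_support_def)
  have 3: "mls_coeff (f * mls_theta i g) c = (\<Sum>a\<in>?A. mls_coeff f a * mls_coeff (mls_theta i g) (c - a))"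
    by (rule mls_coeff_mult_superset[OF fin]) (auto simp: conv_support_def)
  have "of_int (Poly_Mapping.lookup c i) * (mls_coeff f a * mls_coeff g (c - a)) =
     mls_coeff (mls_theta i f) a * mls_coeff g (c - a) + mls_coeff f a * mls_coeff (mls_theta i g) (c - a)" for a
    by (simp add: lookup_minus algebra_simps)
  thus "mls_coeff (mls_theta i (f * g)) c = mls_coeff (mls_theta i f * g + f * mls_theta i g) c"
    by (simp only: mls_coeff_theta mls_coeff_add 1 2 3 sum_distrib_left sum.distrib[symmetric])
qed

definition derivation :: "('a::comm_ring_1 mls \<Rightarrow> 'a mls) \<Rightarrow> bool" where
  "derivation d \<longleftrightarrow> (\<forall>f g. d (f + g) = d f + d g) \<and> (\<forall>f g. d (f * g) = d f * g + f * d g)"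

lemma derivationD:
  assumes "derivation d"
  shows "d (f + g) = d f + d g" "d (f * g) = d f * g + f * d g"
  using assms by (auto simp: derivation_def)

lemma derivation_0: "derivation d \<Longrightarrow> d 0 = 0"
  using derivationD(1)[of d 0 0] by simp

lemma derivation_1: "derivation d \<Longrightarrow> d 1 = 0"
  using derivationD(2)[of d 1 1] by simp

lemma derivation_uminus: "derivation d \<Longrightarrow> d (- f) = - d f"
  using derivationD(1)[of d f "- f"] derivation_0[of d] by (simp add: eq_neg_iff_add_eq_0 add.commute)

lemma derivation_diff: "derivation d \<Longrightarrow> d (f - g) = d f - d g"
  using derivationD(1)[of d f "- g"] derivation_uminus[of d g] by simp

lemma derivation_theta: "derivation (mls_theta i)"
  unfolding derivation_def
  by (auto intro!: mls_eqI simp: algebra_simps mls_theta_mult)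

lemma derivation_scale: "derivation d \<Longrightarrow> derivation (\<lambda>f. c * d f)"
  by (simp add: derivation_def algebra_simps)

lemma derivation_add: "derivation d \<Longrightarrow> derivation e \<Longrightarrow> derivation (\<lambda>f. d f + e f)"
  by (simp add: derivation_def algebra_simps)

lemma derivation_zero: "derivation (\<lambda>f. 0)"
  by (simp add: derivation_def)

lemma derivation_sum: "(\<And>i. i \<in> A \<Longrightarrow> derivation (d i)) \<Longrightarrow> derivation (\<lambda>f. \<Sum>i\<in>A. d i f)"
  by (induction A rule: infinite_finite_induct) (auto intro: derivation_add derivation_zero)

text \<open>Derivatives are recorded logarithmically, as \<open>d f = l * f\<close>: inverses negate
  \<open>l\<close> and products add it, so the kernel can be treated factor by factor.\<close>

lemma derivation_inverse:
  assumes "derivation d" "f * inverse f = 1" "d f = l * f"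
  shows "d (inverse f) = - l * inverse f"
proof -
  have "d f * inverse f + f * d (inverse f) = 0"
    using derivationD(2)[OF assms(1), of f "inverse f"] assms(2) derivation_1[OF assms(1)] by simp
  hence "l * (f * inverse f) + f * d (inverse f) = 0"
    by (simp add: assms(3) mult.assoc)
  hence "f * d (inverse f) = - l"
    using assms(2) by (simp add: eq_neg_iff_add_eq_0 add.commute)
  hence "inverse f * (f * d (inverse f)) = - l * inverse f"
    by simp
  thus ?thesis using assms(2) by (metis mult.assoc mult.commute mult_1)
qed

lemma derivation_mult_log:
  assumes "derivation d" "d f = l * f" "d g = m * g"
  shows "d (f * g) = (l + m) * (f * g)"
  by (simp add: derivationD[OF assms(1)] assms(2,3) algebra_simps)

lemma derivation_prod_log:
  assumes "derivation d" "\<And>i. i \<in> A \<Longrightarrow> d (f i) = l i * f i"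
  shows "d (prod f A) = (\<Sum>i\<in>A. l i) * prod f A"
  using assms(2)
proof (induction A rule: infinite_finite_induct)
  case (insert x F)
  thus ?case using derivation_mult_log[OF assms(1)] by simp
qed (simp_all add: derivation_1[OF assms(1)])

text \<open>This is \<Sum>x_i^(u+1) d/dx_i. The values u = -1, 0, 1 give the infinitesimal
  translation, dilation and special projective map.\<close>

definition vector_field :: "int \<Rightarrow> nat set \<Rightarrow> 'a::comm_ring_1 mls \<Rightarrow> 'a mls" where
  "vector_field u A f = (\<Sum>i\<in>A. mls_monom (Poly_Mapping.single i u) * mls_theta i f)"

lemma derivation_vector_field: "derivation (vector_field u A)"
  unfolding vector_field_def by (intro derivation_sum derivation_scale derivation_theta)

lemma mls_coeff_of_int_mult: "mls_coeff (of_int c * f) b = of_int c * mls_coeff (f :: 'a::comm_ring_1 mls) b"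
proof (induction c rule: int_induct[where k = 0])
  case (step1 i) thus ?case by (simp add: algebra_simps)
next
  case (step2 i) thus ?case by (simp add: algebra_simps)
qed simp

lemma mls_theta_monom: "mls_theta i (mls_monom u) = of_int (Poly_Mapping.lookup u i) * mls_monom u"
  by (rule mls_eqI) (simp add: mls_coeff_of_int_mult mls_coeff_monom)

lemma mls_theta_X: "mls_theta i (X j) = (if i = j then X i else 0)"
  by (simp add: X_def mls_theta_monom lookup_single when_def)

lemma vector_field_X:
  assumes "finite A"
  shows "vector_field u A (X j :: 'a::comm_ring_1 mls)
    = (if j \<in> A then mls_monom (Poly_Mapping.single j (u + 1)) else 0)"
proof -
  have "vector_field u A (X j :: 'a mls)
     = (\<Sum>i\<in>A. if i = j then mls_monom (Poly_Mapping.single j u) * X j else 0)"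
    unfolding vector_field_def by (intro sum.cong) (auto simp: mls_theta_X)
  thus ?thesis using assms by (simp add: sum.delta X_def mls_monom_mult single_add)
qed

text \<open>A summand drops out as soon as the exponent of x_i in \<open>c\<close> equals
  \<open>u\<close>; this is integration by parts at the level of coefficients.\<close>

lemma mls_coeff_vector_field:
  "mls_coeff (vector_field u A f) c = (\<Sum>i\<in>A. of_int (Poly_Mapping.lookup c i - u) *
     mls_coeff f (c - Poly_Mapping.single i u))"
proof -
  have sum: "mls_coeff (\<Sum>i\<in>A. g i) c = (\<Sum>i\<in>A. mls_coeff (g i) c)" for g :: "nat \<Rightarrow> 'a mls"
    by (induction A rule: infinite_finite_induct) simp_all
  show ?thesis
    by (simp add: vector_field_def sum mls_coeff_monom_mult lookup_minus)
qed


subsection \<open>Supports and faces\<close>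

lemma mls_mult_nonzeroE:
  assumes "mls_coeff (f * g) c \<noteq> 0"
  obtains a where "mls_coeff f a \<noteq> 0" "mls_coeff g (c - a) \<noteq> 0"
  using assms unfolding mls_coeff_mult by (auto elim: sum.not_neutral_contains_not_neutral)

definition mls_in :: "nat set \<Rightarrow> 'a::comm_ring_1 mls \<Rightarrow> bool" where
  "mls_in A f \<longleftrightarrow> (\<forall>a. mls_coeff f a \<noteq> 0 \<longrightarrow> Poly_Mapping.keys a \<subseteq> A)"

lemma mls_inD: "mls_in A f \<Longrightarrow> mls_coeff f a \<noteq> 0 \<Longrightarrow> Poly_Mapping.lookup a i \<noteq> 0 \<Longrightarrow> i \<in> A"
  by (auto simp: mls_in_def in_keys_iff subset_iff)

lemma mls_in_mult:
  assumes "mls_in A f" "mls_in A g"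
  shows "mls_in A (f * g)"
  unfolding mls_in_def
proof (intro allI impI)
  fix c assume "mls_coeff (f * g) c \<noteq> 0"
  then obtain a where "mls_coeff f a \<noteq> 0" "mls_coeff g (c - a) \<noteq> 0"
    by (rule mls_mult_nonzeroE)
  hence "Poly_Mapping.keys a \<union> Poly_Mapping.keys (c - a) \<subseteq> A"
    using assms by (auto simp: mls_in_def)
  moreover have "Poly_Mapping.keys c \<subseteq> Poly_Mapping.keys a \<union> Poly_Mapping.keys (c - a)"
    using Poly_Mapping.keys_add[of a "c - a"] by simp
  ultimately show "Poly_Mapping.keys c \<subseteq> A" by blast
qed

lemma mls_in_1 [simp]: "mls_in A 1"
  by (simp add: mls_in_def mls_coeff_1)

lemma mls_in_prod: "(\<And>i. i \<in> B \<Longrightarrow> mls_in A (f i)) \<Longrightarrow> mls_in A (prod f B)"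
  by (induction B rule: infinite_finite_induct) (auto intro: mls_in_mult)

lemma mls_in_power: "mls_in A f \<Longrightarrow> mls_in A (f ^ m)"
  by (induction m) (auto intro: mls_in_mult)

lemma mls_in_mono: "mls_in A f \<Longrightarrow> A \<subseteq> B \<Longrightarrow> mls_in B f"
  by (auto simp: mls_in_def)

lemma mls_coeff_mult_disjoint:
  assumes "mls_in A f" "mls_in B g" "A \<inter> B = {}"
    and "Poly_Mapping.keys c \<subseteq> A" "Poly_Mapping.keys d \<subseteq> B"
  shows "mls_coeff (f * g) (c + d) = mls_coeff f c * mls_coeff g d"
proof -
  have "mls_coeff (f * g) (c + d) = (\<Sum>a\<in>{c}. mls_coeff f a * mls_coeff g (c + d - a))"
  proof (rule mls_coeff_mult_superset)
    fix a assume a: "mls_coeff f a \<noteq> 0" "mls_coeff g (c + d - a) \<noteq> 0"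
    have "Poly_Mapping.lookup a i = Poly_Mapping.lookup c i" for i
    proof (cases "i \<in> A")
      case True
      hence "i \<notin> B" using assms(3) by auto
      hence "Poly_Mapping.lookup (c + d - a) i = 0" "Poly_Mapping.lookup d i = 0"
        using mls_inD[OF assms(2) a(2)] assms(5) by (auto simp: in_keys_iff)
      thus ?thesis by (simp add: lookup_add lookup_minus)
    next
      case False
      thus ?thesis using mls_inD[OF assms(1) a(1)] assms(4) by (metis in_keys_iff subsetD)
    qed
    thus "a \<in> {c}" by (simp add: poly_mapping_eqI)
  qed simp
  thus ?thesis by simp
qed

definition tail_ge :: "nat \<Rightarrow> int \<Rightarrow> 'a::comm_ring_1 mls \<Rightarrow> bool" where
  "tail_ge l v f \<longleftrightarrow> (\<forall>a. mls_coeff f a \<noteq> 0 \<longrightarrow> v \<le> tail l a)"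

lemma tail_ge_mult:
  assumes "tail_ge l v f" "tail_ge l w g"
  shows "tail_ge l (v + w) (f * g)"
  unfolding tail_ge_def
proof (intro allI impI)
  fix c assume "mls_coeff (f * g) c \<noteq> 0"
  then obtain a where "mls_coeff f a \<noteq> 0" "mls_coeff g (c - a) \<noteq> 0"
    by (rule mls_mult_nonzeroE)
  hence "v \<le> tail l a" "w \<le> tail l (c - a)"
    using assms by (auto simp: tail_ge_def)
  thus "v + w \<le> tail l c" by (simp add: tail_diff)
qed

lemma tail_ge_1: "tail_ge l 0 1"
  by (simp add: tail_ge_def mls_coeff_1)

lemma tail_ge_prod: "(\<And>i. i \<in> B \<Longrightarrow> tail_ge l (v i) (f i)) \<Longrightarrow> tail_ge l (sum v B) (prod f B)"
  by (induction B rule: infinite_finite_induct) (auto intro: tail_ge_mult tail_ge_1)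

text \<open>The tail at \<open>l\<close> is the exponent of the ratio \<open>x\<^sub>l / x\<^bsub>l-1\<^esub>\<close>, so a face at the minimal
  exponent \<open>v\<close> is multiplicative, like a leading coefficient.\<close>

lift_definition mls_face :: "nat \<Rightarrow> int \<Rightarrow> 'a::zero mls \<Rightarrow> 'a mls" is
  "\<lambda>l v f a. if tail l a = v then f a else 0"
  by metis

lemma mls_coeff_face: "mls_coeff (mls_face l v f) a = (if tail l a = v then mls_coeff f a else 0)"
  by transfer simp

lemma mls_face_mult:
  fixes f g :: "'a::comm_ring_1 mls"
  assumes "tail_ge l v f" "tail_ge l w g"
  shows "mls_face l (v + w) (f * g) = mls_face l v f * mls_face l w g"
proof (rule mls_eqI)
  fix c
  let ?A = "conv_support (mls_coeff f) (mls_coeff g) c"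
  have fin: "finite ?A" by (rule finite_conv_support_mls)
  have 1: "mls_coeff (f * g) c = (\<Sum>a\<in>?A. mls_coeff f a * mls_coeff g (c - a))"
    by (rule mls_coeff_mult_superset[OF fin]) (auto simp: conv_support_def)
  have 2: "mls_coeff (mls_face l v f * mls_face l w g) c
      = (\<Sum>a\<in>?A. mls_coeff (mls_face l v f) a * mls_coeff (mls_face l w g) (c - a))"
    by (rule mls_coeff_mult_superset[OF fin]) (auto simp: conv_support_def mls_coeff_face split: if_splits)
  show "mls_coeff (mls_face l (v + w) (f * g)) c = mls_coeff (mls_face l v f * mls_face l w g) c"
  proof (cases "tail l c = v + w")
    case True
    have "mls_coeff f a * mls_coeff g (c - a)
        = mls_coeff (mls_face l v f) a * mls_coeff (mls_face l w g) (c - a)" if "a \<in> ?A" for a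
    proof -
      have "v \<le> tail l a" "w \<le> tail l (c - a)"
        using that assms by (auto simp: conv_support_def tail_ge_def)
      thus ?thesis using True by (auto simp: mls_coeff_face tail_diff)
    qed
    thus ?thesis using True by (simp add: 1 2 mls_coeff_face[of _ _ "f * g"] cong: sum.cong)
  next
    case False
    have "mls_coeff (mls_face l v f) a * mls_coeff (mls_face l w g) (c - a) = 0" for a
      using False by (auto simp: mls_coeff_face tail_diff)
    thus ?thesis using False by (simp add: 2 mls_coeff_face[of _ _ "f * g"])
  qed
qed

lemma mls_face_1: "mls_face l 0 1 = 1"
  by (rule mls_eqI) (simp add: mls_coeff_face mls_coeff_1)

lemma mls_face_prod:
  fixes f :: "'b \<Rightarrow> 'a::comm_ring_1 mls"
  assumes "\<And>i. i \<in> B \<Longrightarrow> tail_ge l (v i) (f i)"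
  shows "mls_face l (sum v B) (prod f B) = (\<Prod>i\<in>B. mls_face l (v i) (f i))"
  using assms
proof (induction B rule: infinite_finite_induct)
  case (insert x F)
  thus ?case using tail_ge_prod[of F l v f] by (simp add: mls_face_mult)
qed (simp_all add: mls_face_1)

subsection \<open>The inverse discriminant\<close>

text \<open>The offset \<open>b\<close> lets a kernel sit on any block of consecutive variables: a
  kernel will be split into two on adjacent blocks, and x_b stays free as a neighbour for the
  inversion.\<close>

definition pairs :: "nat \<Rightarrow> nat \<Rightarrow> (nat \<times> nat) set" where
  "pairs b k = {(i, j). b < i \<and> i < j \<and> j \<le> b + k}"

lemma finite_pairs [simp]: "finite (pairs b k)"
  by (rule finite_subset[of _ "{..b+k} \<times> {..b+k}"]) (auto simp: pairs_def)

lemma pairs_0 [simp]: "pairs b 0 = {}"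
  by (auto simp: pairs_def)

lemma pairs_Suc: "pairs b (Suc k) = pairs b k \<union> (\<lambda>i. (i, b + Suc k)) ` {b<..b+k}"
  by (auto simp: pairs_def image_iff)

lemma sum_pairs_Suc:
  "(\<Sum>p\<in>pairs b (Suc k). g p) = (\<Sum>p\<in>pairs b k. g p) + (\<Sum>i\<in>{b<..b+k}. g (i, b + Suc k))"
  unfolding pairs_Suc
  by (subst sum.union_disjoint) (auto simp: sum.reindex inj_on_def, auto simp: pairs_def)

text \<open>Each index belongs to k - 1 pairs.\<close>

lemma sum_pairs_add:
  fixes g :: "nat \<Rightarrow> 'a::comm_ring_1"
  shows "(\<Sum>(i,j)\<in>pairs b k. g i + g j) = (of_nat k - 1) * (\<Sum>i\<in>{b<..b+k}. g i)"
proof (induction k)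
  case (Suc k)
  have "{b<..b + Suc k} = insert (b + Suc k) {b<..b+k}" by auto
  hence "(\<Sum>i\<in>{b<..b + Suc k}. g i) = g (b + Suc k) + (\<Sum>i\<in>{b<..b+k}. g i)" by simp
  thus ?case
    by (simp add: sum_pairs_Suc Suc.IH sum.distrib algebra_simps)
qed simp

definition inv_disc :: "nat \<Rightarrow> nat \<Rightarrow> 'a::comm_ring_1 mls" where
  "inv_disc b k = (\<Prod>(i,j)\<in>pairs b k. (inverse (X i - X j))\<^sup>2)"

lemma inv_disc_0 [simp]: "inv_disc b 0 = 1"
  by (simp add: inv_disc_def)

lemma mls_in_inverse_X_diff: "i < j \<Longrightarrow> mls_in {i, j} (inverse (X i - X j :: 'a::comm_ring_1 mls))"
  unfolding mls_in_def
proof (intro allI impI)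
  fix a assume "i < j" "mls_coeff (inverse (X i - X j) :: 'a mls) a \<noteq> 0"
  then obtain n where a: "a = Poly_Mapping.single j (int n) - Poly_Mapping.single i (int n + 1)"
    by (auto simp: mls_coeff_inverse_X_diff split: if_splits)
  show "Poly_Mapping.keys a \<subseteq> {i, j}"
  proof
    fix x assume "x \<in> Poly_Mapping.keys a"
    hence "Poly_Mapping.lookup a x \<noteq> 0" by (simp add: in_keys_iff)
    thus "x \<in> {i, j}" by (cases "x = i"; cases "x = j") (simp_all add: a lookup_minus lookup_single)
  qed
qed

lemma mls_in_inv_disc: "mls_in {b<..b+k} (inv_disc b k)"
  unfolding inv_disc_def
  by (intro mls_in_prod)
    (auto simp: pairs_def intro!: mls_in_power mls_in_mono[OF mls_in_inverse_X_diff])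

lemma derivation_inv_disc:
  assumes d: "derivation d"
    and l: "\<And>i j. (i, j) \<in> pairs b k \<Longrightarrow> d (X i - X j) = l i j * (X i - X j)"
  shows "d (inv_disc b k :: 'a::comm_ring_1 mls) = - 2 * (\<Sum>(i,j)\<in>pairs b k. l i j) * inv_disc b k"
proof -
  have "d ((inverse (X i - X j))\<^sup>2) = (- 2 * l i j) * (inverse (X i - X j))\<^sup>2" if "(i, j) \<in> pairs b k" for i j
  proof -
    have "d (inverse (X i - X j)) = - l i j * inverse (X i - X j)"
      by (rule derivation_inverse[OF d X_diff_unit l]) (use that in \<open>auto simp: pairs_def\<close>)
    from derivation_mult_log[OF d this this] show ?thesis
      by (simp add: power2_eq_square)
  qed
  hence "d (inv_disc b k) = (\<Sum>(i,j)\<in>pairs b k. - 2 * l i j) * inv_disc b k"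
    unfolding inv_disc_def case_prod_beta
    by (intro derivation_prod_log[OF d]) (auto simp: case_prod_beta)
  thus ?thesis by (simp add: sum_distrib_left case_prod_beta)
qed

lemma vector_field_0_inv_disc:
  "vector_field 0 {b<..b+k} (inv_disc b k :: 'a::comm_ring_1 mls)
     = - of_int (int k * (int k - 1)) * inv_disc b k"
proof -
  have "vector_field 0 {b<..b+k} (inv_disc b k :: 'a mls)
     = - 2 * (\<Sum>(i,j)\<in>pairs b k. 1) * inv_disc b k"
    by (rule derivation_inv_disc[OF derivation_vector_field])
      (auto simp: pairs_def derivation_diff[OF derivation_vector_field] vector_field_X simp flip: X_def)
  moreover have "2 * (\<Sum>(i,j)\<in>pairs b k. 1) = (of_int (int k * (int k - 1)) :: 'a mls)"
    using sum_pairs_add[of "\<lambda>_. 1 :: 'a mls" b k] by (simp add: case_prod_beta mult.commute)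
  ultimately show ?thesis by (metis mult_minus_left)
qed

text \<open>The field sends x_i - x_j to x_i^2 - x_j^2, so its multiplier on a difference is x_i +
  x_j; the inverse square contributes the factor -2.\<close>

lemma vector_field_1_inv_disc:
  "vector_field 1 {b<..b+k} (inv_disc b k :: 'a::comm_ring_1 mls)
     = - 2 * (of_nat k - 1) * (\<Sum>i\<in>{b<..b+k}. X i) * inv_disc b k"
proof -
  have "vector_field 1 {b<..b+k} (inv_disc b k :: 'a mls)
     = - 2 * (\<Sum>(i,j)\<in>pairs b k. X i + X j) * inv_disc b k"
  proof (rule derivation_inv_disc[OF derivation_vector_field])
    fix i j assume ij: "(i, j) \<in> pairs b k"
    have sq: "mls_monom (Poly_Mapping.single n 2) = (X n * X n :: 'a mls)" for n
      by (simp add: X_def mls_monom_mult single_add[symmetric])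
    show "vector_field 1 {b<..b+k} (X i - X j :: 'a mls) = (X i + X j) * (X i - X j)"
      using ij
      by (simp add: pairs_def derivation_diff[OF derivation_vector_field] vector_field_X sq algebra_simps)
  qed
  thus ?thesis by (simp only: sum_pairs_add mult.assoc)
qed

lemma mls_coeff_sum: "mls_coeff (\<Sum>i\<in>A. f i) c = (\<Sum>i\<in>A. mls_coeff (f i) c)"
  for f :: "'b \<Rightarrow> 'a::comm_ring_1 mls"
  by (induction A rule: infinite_finite_induct) simp_all

lemma inv_disc_homogeneous:
  assumes "mls_coeff (inv_disc b k :: rat mls) c \<noteq> 0"
  shows "(\<Sum>i\<in>{b<..b+k}. Poly_Mapping.lookup c i) = - (int k * (int k - 1))"
proof -
  have "(\<Sum>i\<in>{b<..b+k}. of_int (Poly_Mapping.lookup c i)) * mls_coeff (inv_disc b k :: rat mls) c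
      = mls_coeff (vector_field 0 {b<..b+k} (inv_disc b k :: rat mls)) c"
    by (simp add: mls_coeff_vector_field sum_distrib_right)
  also have "\<dots> = mls_coeff (of_int (- (int k * (int k - 1))) * inv_disc b k) c"
    by (simp only: vector_field_0_inv_disc of_int_minus)
  also have "\<dots> = of_int (- (int k * (int k - 1))) * mls_coeff (inv_disc b k) c"
    by (simp only: mls_coeff_of_int_mult)
  finally have "(\<Sum>i\<in>{b<..b+k}. of_int (Poly_Mapping.lookup c i)) = (of_int (- (int k * (int k - 1))) :: rat)"
    using assms by (metis mult_right_cancel)
  thus ?thesis
    by (simp only: of_int_sum[symmetric] of_int_eq_iff)
qed

text \<open>Compare coefficients in \<open>vector_field_1_inv_disc\<close>: the field contributes
  the exponent minus 1, the multiplier 2(k - 1), together the exponent plus 2k - 3.\<close>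

lemma inv_disc_raising:
  "(\<Sum>i\<in>{b<..b+k}. of_int (Poly_Mapping.lookup c i + 2 * int k - 3) *
     mls_coeff (inv_disc b k :: rat mls) (c - Poly_Mapping.single i 1)) = 0"
proof -
  have "(\<Sum>i\<in>{b<..b+k}. of_int (Poly_Mapping.lookup c i - 1) *
     mls_coeff (inv_disc b k :: rat mls) (c - Poly_Mapping.single i 1))
     = mls_coeff (vector_field 1 {b<..b+k} (inv_disc b k :: rat mls)) c"
    by (simp add: mls_coeff_vector_field)
  also have "vector_field 1 {b<..b+k} (inv_disc b k :: rat mls)
    = of_int (- 2 * (int k - 1)) * (\<Sum>i\<in>{b<..b+k}. X i * inv_disc b k)"
    by (simp add: vector_field_1_inv_disc sum_distrib_right mult.assoc)
  also have "mls_coeff \<dots> c = (\<Sum>i\<in>{b<..b+k}. of_int (- 2 * (int k - 1)) *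
      mls_coeff (inv_disc b k :: rat mls) (c - Poly_Mapping.single i 1))"
    by (simp only: mls_coeff_of_int_mult mls_coeff_sum X_def mls_coeff_monom_mult sum_distrib_left)
  finally have "(\<Sum>i\<in>{b<..b+k}. of_int (Poly_Mapping.lookup c i - 1) *
     mls_coeff (inv_disc b k :: rat mls) (c - Poly_Mapping.single i 1)
     - of_int (- 2 * (int k - 1)) * mls_coeff (inv_disc b k :: rat mls) (c - Poly_Mapping.single i 1)) = 0"
    by (simp add: sum_subtractf)
  thus ?thesis
    by (simp add: algebra_simps)
qed


section \<open>Lowest-order faces of the kernel\<close>

lemma inverse_X_diff_nonzeroE:
  assumes "i < j" "mls_coeff (inverse (X i - X j) :: 'a::comm_ring_1 mls) a \<noteq> 0"
  obtains n where "a = Poly_Mapping.single j (int n) - Poly_Mapping.single i (int n + 1)"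
  using assms by (auto simp: mls_coeff_inverse_X_diff split: if_splits)

lemma tail_ge_inverse_X_diff:
  assumes "i < j"
  shows "tail_ge l (if l \<le> i then - 1 else 0) (inverse (X i - X j) :: 'a::comm_ring_1 mls)"
  unfolding tail_ge_def
proof (intro allI impI)
  fix a assume "mls_coeff (inverse (X i - X j) :: 'a mls) a \<noteq> 0"
  thus "(if l \<le> i then - 1 else 0) \<le> tail l a"
    by (rule inverse_X_diff_nonzeroE[OF assms]) (use assms in \<open>simp add: tail_diff tail_single\<close>)
qed

lemma mls_face_id: "(\<And>a. mls_coeff f a \<noteq> 0 \<Longrightarrow> tail l a = v) \<Longrightarrow> mls_face l v f = f"
  by (rule mls_eqI) (auto simp: mls_coeff_face)

lemma mls_face_inverse_X_diff_low:
  assumes "i < j" "l \<le> i"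
  shows "mls_face l (- 1) (inverse (X i - X j)) = (inverse (X i - X j) :: 'a::comm_ring_1 mls)"
proof (rule mls_face_id)
  fix a assume "mls_coeff (inverse (X i - X j) :: 'a mls) a \<noteq> 0"
  thus "tail l a = - 1"
    by (rule inverse_X_diff_nonzeroE[OF assms(1)]) (use assms in \<open>simp add: tail_diff tail_single\<close>)
qed

lemma mls_face_inverse_X_diff_high:
  assumes "i < j" "j < l"
  shows "mls_face l 0 (inverse (X i - X j)) = (inverse (X i - X j) :: 'a::comm_ring_1 mls)"
proof (rule mls_face_id)
  fix a assume "mls_coeff (inverse (X i - X j) :: 'a mls) a \<noteq> 0"
  thus "tail l a = 0"
    by (rule inverse_X_diff_nonzeroE[OF assms(1)]) (use assms in \<open>simp add: tail_diff tail_single\<close>)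
qed

text \<open>In x_i^(-1) \<Sum>(x_j/x_i)^n the tail at \<open>l\<close> equals n when the two
  variables lie on different sides of the cut, so only n = 0 survives.\<close>

lemma mls_face_inverse_X_diff_cross:
  assumes "i < l" "l \<le> j"
  shows "mls_face l 0 (inverse (X i - X j))
    = (mls_monom (- Poly_Mapping.single i 1) :: 'a::comm_ring_1 mls)"
proof (rule mls_eqI)
  fix a
  have ij: "i < j" using assms by simp
  have "tail l (Poly_Mapping.single j (int n) - Poly_Mapping.single i (int n + 1)) = int n" for n
    using assms by (simp add: tail_diff tail_single)
  hence "(\<exists>n. a = Poly_Mapping.single j (int n) - Poly_Mapping.single i (int n + 1)) \<and> tail l a = 0
      \<longleftrightarrow> a = - Poly_Mapping.single i 1"
    using assms by (auto simp: tail_uminus tail_single intro: exI[of _ 0])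
  thus "mls_coeff (mls_face l 0 (inverse (X i - X j)) :: 'a mls) a
      = mls_coeff (mls_monom (- Poly_Mapping.single i 1)) a"
    by (auto simp: mls_coeff_face mls_coeff_inverse_X_diff[OF ij] mls_coeff_monom)
qed

lemma tail_ge_inv_disc_factor:
  assumes "i < j"
  shows "tail_ge l (if l \<le> i then - 2 else 0) ((inverse (X i - X j))\<^sup>2 :: 'a::comm_ring_1 mls)"
  using tail_ge_mult[OF tail_ge_inverse_X_diff[OF assms] tail_ge_inverse_X_diff[OF assms], of l]
  by (simp add: power2_eq_square split: if_splits)

lemma mls_face_inv_disc_factor:
  assumes "i < j"
  shows "mls_face l (if l \<le> i then - 2 else 0) ((inverse (X i - X j))\<^sup>2 :: 'a::comm_ring_1 mls)
    = (mls_face l (if l \<le> i then - 1 else 0) (inverse (X i - X j)))\<^sup>2"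
  using mls_face_mult[OF tail_ge_inverse_X_diff[OF assms] tail_ge_inverse_X_diff[OF assms], of l]
  by (simp add: power2_eq_square split: if_splits)

lemma pairs_split:
  assumes "r \<le> k"
  shows "pairs b k = pairs b r \<union> pairs (b + r) (k - r) \<union> {b<..b+r} \<times> {b+r<..b+k}"
  using assms by (auto simp: pairs_def)

lemma prod_pairs_split:
  assumes "r \<le> k"
  shows "(\<Prod>p\<in>pairs b k. g p) = (\<Prod>p\<in>pairs b r. g p) * (\<Prod>p\<in>pairs (b + r) (k - r). g p)
    * (\<Prod>p\<in>{b<..b+r} \<times> {b+r<..b+k}. g p)"
proof -
  have "(pairs b r \<union> pairs (b + r) (k - r)) \<inter> {b<..b+r} \<times> {b+r<..b+k} = {}"
    "pairs b r \<inter> pairs (b + r) (k - r) = {}"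
    by (auto simp: pairs_def)
  thus ?thesis
    unfolding pairs_split[OF assms] by (subst prod.union_disjoint; simp add: prod.union_disjoint)
qed

lemma two_card_pairs: "2 * int (card (pairs b k)) = int k * (int k - 1)"
  using sum_pairs_add[of "\<lambda>_. 1 :: int" b k] by (simp add: case_prod_beta mult.commute)

lemma sum_pairs_if:
  assumes "r \<le> k"
  shows "(\<Sum>(i,j)\<in>pairs b k. if b + r < i then - 2 else 0 :: int) = - (int (k - r) * (int (k - r) - 1))"
proof -
  have "(\<Sum>(i,j)\<in>pairs b k. if b + r < i then - 2 else 0 :: int)
      = (\<Sum>p\<in>pairs (b + r) (k - r). - 2)"
  proof (rule sum.mono_neutral_cong_right)
    show "pairs (b + r) (k - r) \<subseteq> pairs b k"
      using pairs_split[OF assms] by blast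
    show "\<forall>p\<in>pairs b k - pairs (b + r) (k - r). (case p of (i,j) \<Rightarrow> (if b + r < i then - 2 else 0 :: int)) = 0"
      using assms by (auto simp: pairs_def split: if_splits)
  qed (auto simp: pairs_def[of "b + r"] split: if_splits)
  thus ?thesis using two_card_pairs[of "b + r" "k - r"] by simp
qed

text \<open>Taking this face makes the last k - r variables infinitely smaller than the first r.
  Factors inside either block are unaffected, while each of the r(k - r) cross factors degenerates
  to x_i^(-2).\<close>

lemma mls_face_inv_disc:
  assumes "r \<le> k"
  shows "mls_face (b + r + 1) (- (int (k - r) * (int (k - r) - 1))) (inv_disc b k :: 'a::comm_ring_1 mls)
     = mls_monom (- (\<Sum>i\<in>{b<..b+r}. Poly_Mapping.single i (2 * int (k - r))))
       * (inv_disc b r * inv_disc (b + r) (k - r))"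
proof -
  let ?l = "b + r + 1"
  let ?v = "\<lambda>(i,j). if ?l \<le> i then - 2 else 0 :: int"
  let ?f = "\<lambda>(i,j). (inverse (X i - X j))\<^sup>2 :: 'a mls"
  have "mls_face ?l (\<Sum>p\<in>pairs b k. ?v p) (inv_disc b k :: 'a mls)
      = (\<Prod>p\<in>pairs b k. mls_face ?l (?v p) (?f p))"
    unfolding inv_disc_def
  proof (rule mls_face_prod)
    fix p assume "p \<in> pairs b k"
    thus "tail_ge ?l (?v p) (?f p)"
      using tail_ge_inv_disc_factor[of "fst p" "snd p" ?l] by (auto simp: pairs_def)
  qed
  also have "(\<Sum>p\<in>pairs b k. ?v p) = - (int (k - r) * (int (k - r) - 1))"
    using sum_pairs_if[OF assms, of b] by (simp add: Suc_le_eq)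
  also have "(\<Prod>p\<in>pairs b k. mls_face ?l (?v p) (?f p))
     = (\<Prod>p\<in>pairs b k. (mls_face ?l (if ?l \<le> fst p then - 1 else 0) (inverse (X (fst p) - X (snd p))))\<^sup>2)"
  proof (rule prod.cong)
    fix p assume "p \<in> pairs b k"
    thus "mls_face ?l (?v p) (?f p)
      = (mls_face ?l (if ?l \<le> fst p then - 1 else 0) (inverse (X (fst p) - X (snd p))))\<^sup>2"
      using mls_face_inv_disc_factor[of "fst p" "snd p" ?l, where ?'a = 'a]
      by (auto simp: pairs_def split: if_splits)
  qed simp
  also have "\<dots> = (\<Prod>p\<in>pairs b r. ?f p) * (\<Prod>p\<in>pairs (b + r) (k - r). ?f p)
     * (\<Prod>p\<in>{b<..b+r} \<times> {b+r<..b+k}. (mls_monom (- Poly_Mapping.single (fst p) 1))\<^sup>2)"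
    unfolding prod_pairs_split[OF assms]
    by (intro arg_cong2[where f = "(*)"] prod.cong refl)
      (auto simp: pairs_def mls_face_inverse_X_diff_low mls_face_inverse_X_diff_high
        mls_face_inverse_X_diff_cross)
  also have "(\<Prod>p\<in>{b<..b+r} \<times> {b+r<..b+k}. (mls_monom (- Poly_Mapping.single (fst p) 1))\<^sup>2)
     = (\<Prod>i\<in>{b<..b+r}. \<Prod>j\<in>{b+r<..b+k}. mls_monom (- Poly_Mapping.single i 2) :: 'a mls)"
  proof -
    have "(mls_monom (- Poly_Mapping.single i 1))\<^sup>2 = (mls_monom (- Poly_Mapping.single i 2) :: 'a mls)"
      for i :: nat
      by (simp add: power2_eq_square mls_monom_mult single_uminus[symmetric] single_add[symmetric])
    thus ?thesis
      by (simp only: prod.cartesian_product) (rule prod.cong; auto)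
  qed
  also have "\<dots> = mls_monom (- (\<Sum>i\<in>{b<..b+r}. Poly_Mapping.single i (2 * int (k - r))))"
  proof -
    have "(\<Sum>j\<in>{b+r<..b+k}. - Poly_Mapping.single i (2::int)) = - Poly_Mapping.single i (2 * int (k - r))" for i :: nat
      by (rule poly_mapping_eqI, simp only: lookup_sum lookup_uminus lookup_single)
        (use assms in \<open>auto simp: when_def of_nat_diff\<close>)
    thus ?thesis by (simp only: mls_monom_prod sum_negf neg_equal_iff_equal)
  qed
  finally show ?thesis by (simp add: inv_disc_def mult_ac)
qed

section \<open>Constant terms of monomials against the kernel\<close>

definition expo :: "nat \<Rightarrow> nat \<Rightarrow> (nat \<Rightarrow> int) \<Rightarrow> monomial" where
  "expo b k a = (\<Sum>i=1..k. Poly_Mapping.single (b + i) (a i))"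

lemma lookup_expo:
  "Poly_Mapping.lookup (expo b k a) j = (if b < j \<and> j \<le> b + k then a (j - b) else 0)"
proof -
  have "Poly_Mapping.lookup (expo b k a) j = (\<Sum>i=1..k. if i = j - b \<and> b < j then a i else 0)"
    unfolding expo_def by (auto simp: lookup_sum lookup_single when_def intro!: sum.cong)
  also have "\<dots> = (\<Sum>i=1..k. if i = j - b then (if b < j then a i else 0) else 0)"
    by (intro sum.cong) auto
  also have "\<dots> = (if b < j \<and> j \<le> b + k then a (j - b) else 0)"
    by (subst sum.delta) auto
  finally show ?thesis .
qed

lemma expo_lookup:
  assumes "Poly_Mapping.keys c \<subseteq> {b<..b+k}"
  shows "expo b k (\<lambda>i. Poly_Mapping.lookup c (b + i)) = c"
  by (rule poly_mapping_eqI) (use assms in \<open>auto simp: lookup_expo in_keys_iff subset_iff\<close>)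

lemma sum_lookup_expo: "(\<Sum>i\<in>{b<..b+k}. Poly_Mapping.lookup (expo b k a) i) = (\<Sum>i=1..k. a i)"
  by (rule sum.reindex_bij_witness[of _ "\<lambda>i. b + i" "\<lambda>i. i - b"]) (auto simp: lookup_expo)

lemma tail_sum: "tail l (\<Sum>i\<in>A. f i) = (\<Sum>i\<in>A. tail l (f i))"
  by (induction A rule: infinite_finite_induct) (simp_all add: tail_add)

lemma tail_expo: "tail (b + r + 1) (expo b k a) = (\<Sum>i\<in>{r<..k}. a i)"
proof -
  have "tail (b + r + 1) (expo b k a) = (\<Sum>i=1..k. if r < i then a i else 0)"
    unfolding expo_def by (auto simp: tail_sum tail_single intro!: sum.cong)
  also have "\<dots> = (\<Sum>i\<in>{r<..k}. a i)"
    by (rule sum.mono_neutral_cong_right) auto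
  finally show ?thesis .
qed

lemma tail_keys_below: "Poly_Mapping.keys a \<subseteq> {..<l} \<Longrightarrow> tail l a = 0"
  unfolding tail_def by (rule sum.neutral) fastforce

lemma prod_X: "(\<Prod>i\<in>{b<..b+k}. X i) = (mls_monom (expo b k (\<lambda>_. 1)) :: 'a::comm_ring_1 mls)"
  unfolding X_def mls_monom_prod expo_def
  by (rule arg_cong[where f = mls_monom],
      rule sum.reindex_bij_witness[of _ "\<lambda>i. b + i" "\<lambda>i. i - b"]) auto

text \<open>The constant term of \<open>\<Prod>x\<^bsub>b+i\<^esub> ^ a\<^sub>i\<close> times the inverse discriminant.\<close>

definition disc_coeff :: "nat \<Rightarrow> nat \<Rightarrow> (nat \<Rightarrow> int) \<Rightarrow> rat" where
  "disc_coeff b k a = mls_coeff (inv_disc b k) (- expo b k a)"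

lemma disc_coeff_0 [simp]: "disc_coeff b 0 a = 1"
  by (simp add: disc_coeff_def expo_def mls_coeff_1)

lemma disc_coeff_cong: "(\<And>i. 1 \<le> i \<Longrightarrow> i \<le> k \<Longrightarrow> a i = a' i) \<Longrightarrow> disc_coeff b k a = disc_coeff b k a'"
  unfolding disc_coeff_def expo_def
  by (intro arg_cong[where f = "mls_coeff (inv_disc b k)"] arg_cong[where f = uminus] sum.cong) auto

lemma disc_coeff_homogeneous:
  assumes "disc_coeff b k a \<noteq> 0"
  shows "(\<Sum>i=1..k. a i) = int k * (int k - 1)"
  using inv_disc_homogeneous[of b k "- expo b k a"] assms sum_lookup_expo[of b k a]
  by (simp add: disc_coeff_def sum_negf)

text \<open>This linear relation is all that the fractional linear invariance needs from the kernel;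
  the constant 2k - 3 is the origin of the weight in \<open>pderiv_disc_CT\<close>.\<close>

lemma disc_coeff_raising:
  "(\<Sum>i=1..k. of_int (a i - (2 * int k - 3)) * disc_coeff b k (a(i := a i + 1))) = 0"
proof -
  have eq: "- expo b k a - Poly_Mapping.single j 1 = - expo b k (a(j - b := a (j - b) + 1))"
    if "j \<in> {b<..b+k}" for j
    by (rule poly_mapping_eqI) (use that in \<open>auto simp: lookup_minus lookup_expo lookup_single when_def\<close>)
  have "0 = (\<Sum>j\<in>{b<..b+k}. of_int (Poly_Mapping.lookup (- expo b k a) j + 2 * int k - 3) *
     mls_coeff (inv_disc b k :: rat mls) (- expo b k a - Poly_Mapping.single j 1))"
    by (rule inv_disc_raising[symmetric])
  also have "\<dots> = (\<Sum>i=1..k. of_int (- a i + 2 * int k - 3) * disc_coeff b k (a(i := a i + 1)))"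
    by (rule sum.reindex_bij_witness[of _ "\<lambda>i. b + i" "\<lambda>i. i - b"])
      (auto simp: lookup_expo disc_coeff_def eq)
  also have "\<dots> = - (\<Sum>i=1..k. of_int (a i - (2 * int k - 3)) * disc_coeff b k (a(i := a i + 1)))"
    unfolding sum_negf[symmetric] by (rule sum.cong) (auto simp: algebra_simps)
  finally show ?thesis by simp
qed

text \<open>Only pairs inside the last block lower the tail at the cut, by 2 each, and a monomial
  that cancels against the kernel cannot exceed this. The bound later forces the order of the
  numerator at 0.\<close>

lemma disc_coeff_tail:
  assumes "disc_coeff b k a \<noteq> 0" "r \<le> k"
  shows "(\<Sum>i\<in>{r<..k}. a i) \<le> int (k - r) * (int (k - r) - 1)"
proof -
  let ?v = "\<lambda>(i,j). if b + r < i then - 2 else 0 :: int"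
  let ?f = "\<lambda>(i,j). (inverse (X i - X j))\<^sup>2 :: rat mls"
  have "tail_ge (b + r + 1) (\<Sum>p\<in>pairs b k. ?v p) (inv_disc b k :: rat mls)"
    unfolding inv_disc_def
  proof (rule tail_ge_prod)
    fix p assume "p \<in> pairs b k"
    thus "tail_ge (b + r + 1) (?v p) (?f p)"
      using tail_ge_inv_disc_factor[of "fst p" "snd p" "b + r + 1"] by (auto simp: pairs_def Suc_le_eq)
  qed
  hence "tail_ge (b + r + 1) (- (int (k - r) * (int (k - r) - 1))) (inv_disc b k :: rat mls)"
    using sum_pairs_if[OF assms(2), of b] by simp
  thus ?thesis
    using assms(1) tail_expo[of b r k a] by (auto simp: disc_coeff_def tail_ge_def tail_uminus)
qed

text \<open>In the case of equality in \<open>disc_coeff_tail\<close> the coefficient lies on the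
  extremal face, where the kernel factors; the degenerate cross factors account for the shift by 2(k
  - r).\<close>

lemma disc_coeff_split:
  assumes "r \<le> k" "(\<Sum>i\<in>{r<..k}. a i) = int (k - r) * (int (k - r) - 1)"
  shows "disc_coeff b k a = disc_coeff b r (\<lambda>i. a i - 2 * int (k - r)) * disc_coeff (b + r) (k - r) (\<lambda>i. a (r + i))"
proof -
  let ?m = "\<Sum>i\<in>{b<..b+r}. Poly_Mapping.single i (2 * int (k - r))"
  let ?c = "- expo b r (\<lambda>i. a i - 2 * int (k - r))" and ?d = "- expo (b + r) (k - r) (\<lambda>i. a (r + i))"
  have m: "Poly_Mapping.lookup ?m x = (if b < x \<and> x \<le> b + r then 2 * int (k - r) else 0)" for x
    by (auto simp: lookup_sum lookup_single when_def sum.delta)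
  have eq: "- expo b k a - (- ?m) = ?c + ?d"
    by (rule poly_mapping_eqI, simp only: lookup_minus lookup_uminus lookup_add lookup_expo m)
      (use assms(1) in auto)
  have "disc_coeff b k a = mls_coeff (mls_face (b + r + 1) (- (int (k - r) * (int (k - r) - 1))) (inv_disc b k)) (- expo b k a)"
    using assms(2) by (simp add: disc_coeff_def mls_coeff_face tail_uminus tail_expo[simplified])
  also have "\<dots> = mls_coeff (inv_disc b r * inv_disc (b + r) (k - r)) (?c + ?d)"
    unfolding mls_face_inv_disc[OF assms(1)] mls_coeff_monom_mult eq ..
  also have "\<dots> = mls_coeff (inv_disc b r) ?c * mls_coeff (inv_disc (b + r) (k - r)) ?d"
  proof (rule mls_coeff_mult_disjoint[OF mls_in_inv_disc mls_in_inv_disc])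
    show "Poly_Mapping.keys ?c \<subseteq> {b<..b + r}"
      by (auto simp: in_keys_iff lookup_expo split: if_splits)
    show "Poly_Mapping.keys ?d \<subseteq> {b + r<..b + r + (k - r)}"
      by (auto simp: in_keys_iff lookup_expo split: if_splits)
  qed auto
  finally show ?thesis by (simp add: disc_coeff_def)
qed

definition mls_nonneg :: "rat mls \<Rightarrow> bool" where
  "mls_nonneg f \<longleftrightarrow> (\<forall>a. 0 \<le> mls_coeff f a)"

lemma mls_nonneg_mult: "mls_nonneg f \<Longrightarrow> mls_nonneg g \<Longrightarrow> mls_nonneg (f * g)"
  by (auto simp: mls_nonneg_def mls_coeff_mult intro!: sum_nonneg)

lemma mls_nonneg_prod: "(\<And>i. i \<in> A \<Longrightarrow> mls_nonneg (f i)) \<Longrightarrow> mls_nonneg (prod f A)"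
proof (induction A rule: infinite_finite_induct)
  case (insert x F)
  thus ?case by (simp add: mls_nonneg_mult)
qed (simp_all add: mls_nonneg_def mls_coeff_1)

text \<open>Every 1/(x_i - x_j) with i < j expands with coefficients 0 and 1, so nothing can cancel.
  This yields the exact degree of the polynomial in the end.\<close>

lemma disc_coeff_nonneg: "0 \<le> disc_coeff b k a"
proof -
  have "mls_nonneg (inv_disc b k)"
    unfolding inv_disc_def power2_eq_square
    by (intro mls_nonneg_prod)
      (auto simp: pairs_def mls_nonneg_def[of "inverse (X _ - X _)"] mls_coeff_inverse_X_diff
        intro!: mls_nonneg_mult)
  thus ?thesis by (simp add: mls_nonneg_def disc_coeff_def)
qed


section \<open>Substitutions acting on the tails\<close>

lemma monomial_eqI_tail: "(\<And>i. tail i a = tail i b) \<Longrightarrow> a = b"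
  by (rule poly_mapping_eqI) (simp add: lookup_eq_tail)

text \<open>In the coordinates given by the tails, a permutation of coordinates preserves small monomials,
  so it induces a substitution on Laurent series.\<close>

locale tail_map =
  fixes \<pi> :: "nat \<Rightarrow> nat"
  assumes surj: "surj \<pi>" and at_top: "\<And>K. \<exists>K'. \<forall>i\<ge>K'. K \<le> \<pi> i"
begin

definition push_mono :: "monomial \<Rightarrow> monomial" where
  "push_mono a = Abs_poly_mapping (\<lambda>i. tail (\<pi> i) a - tail (\<pi> (Suc i)) a)"

lemma tail_eventually_0: "\<exists>K. \<forall>i\<ge>K. tail (\<pi> i) a = 0"
proof -
  obtain L where "\<forall>i\<ge>L. tail i a = 0" using tail_eq_0_cofinite by blast
  moreover obtain K where "\<forall>i\<ge>K. L \<le> \<pi> i" using at_top by blast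
  ultimately show ?thesis by blast
qed

lemma lookup_push_mono: "Poly_Mapping.lookup (push_mono a) i = tail (\<pi> i) a - tail (\<pi> (Suc i)) a"
proof -
  obtain K where "\<forall>i\<ge>K. tail (\<pi> i) a = 0" using tail_eventually_0 by blast
  hence "tail (\<pi> i) a - tail (\<pi> (Suc i)) a = 0" if "i \<ge> K" for i
    using that by simp
  hence "{i. tail (\<pi> i) a - tail (\<pi> (Suc i)) a \<noteq> 0} \<subseteq> {..<K}"
    by (auto simp: not_less[symmetric])
  hence "finite {i. tail (\<pi> i) a - tail (\<pi> (Suc i)) a \<noteq> 0}"
    using finite_subset by blast
  thus ?thesis by (simp add: push_mono_def)
qed

lemma tail_push_mono: "tail i (push_mono a) = tail (\<pi> i) a"
proof -
  obtain K where K: "\<forall>i\<ge>K. tail (\<pi> i) a = 0" using tail_eventually_0 by blast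
  obtain L where L: "\<forall>i\<ge>L. tail i (push_mono a) = 0" using tail_eq_0_cofinite by blast
  \<comment> \<open>Both sides vanish far out and have the same successive differences, so the
    induction runs downwards from index i + K + L.\<close>
  have "tail (i + (K + L - n)) (push_mono a) = tail (\<pi> (i + (K + L - n))) a" if "n \<le> K + L" for n
    using that
  proof (induction n)
    case 0
    thus ?case using K L by simp
  next
    case (Suc n)
    let ?m = "i + (K + L - Suc n)"
    have "Suc ?m = i + (K + L - n)" using Suc.prems by simp
    hence "tail (Suc ?m) (push_mono a) = tail (\<pi> (Suc ?m)) a" using Suc by simp
    thus ?case
      using lookup_push_mono[of a ?m] lookup_eq_tail[of "push_mono a" ?m] by simp
  qed
  from this[of "K + L"] show ?thesis by simp
qed

lemma push_mono_add: "push_mono (a + b) = push_mono a + push_mono b"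
  by (rule monomial_eqI_tail) (simp add: tail_push_mono tail_add)

lemma push_mono_diff: "push_mono (a - b) = push_mono a - push_mono b"
  by (rule monomial_eqI_tail) (simp add: tail_push_mono tail_diff)

lemma push_mono_uminus: "push_mono (- b) = - push_mono b"
  by (rule monomial_eqI_tail) (simp add: tail_push_mono tail_uminus)

lemma push_mono_0: "push_mono 0 = 0"
  by (rule monomial_eqI_tail) (simp add: tail_push_mono)

lemma push_mono_sum: "push_mono (\<Sum>i\<in>A. f i) = (\<Sum>i\<in>A. push_mono (f i))"
  by (induction A rule: infinite_finite_induct) (simp_all add: push_mono_0 push_mono_add)

text \<open>By surjectivity of \<open>\<pi>\<close> every tail of \<open>a\<close> reappears as a
  tail of the image.\<close>

lemma inj_push_mono: "push_mono a = push_mono b \<longleftrightarrow> a = b"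
proof
  assume eq: "push_mono a = push_mono b"
  show "a = b"
  proof (rule monomial_eqI_tail)
    fix i
    obtain j where "i = \<pi> j" using surj by (metis surjD)
    thus "tail i a = tail i b" using eq tail_push_mono by metis
  qed
qed simp

definition push :: "'a::comm_ring_1 mls \<Rightarrow> 'a mls" where
  "push f = Abs_mls (\<lambda>c. if \<exists>a. c = push_mono a then mls_coeff f (THE a. c = push_mono a) else 0)"

lemma mls_coeff_push_raw:
  "mls_coeff (push f) c = (if \<exists>a. c = push_mono a then mls_coeff f (THE a. c = push_mono a) else 0)"
proof -
  obtain m where m: "\<And>a. mls_coeff f a \<noteq> 0 \<Longrightarrow> a - m \<in> small_monomials"
    using mls_shift by blast
  have "push_mono a - push_mono m \<in> small_monomials" if "mls_coeff f a \<noteq> 0" for a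
    using m[OF that] by (simp add: small_monomials_def push_mono_diff[symmetric] tail_push_mono)
  hence "\<exists>m. \<forall>c. (if \<exists>a. c = push_mono a then mls_coeff f (THE a. c = push_mono a) else 0) \<noteq> 0
      \<longrightarrow> c - m \<in> small_monomials"
    by (intro exI[of _ "push_mono m"]) (auto simp: inj_push_mono)
  thus ?thesis unfolding push_def by (subst Abs_mls_inverse) auto
qed

lemma mls_coeff_push [simp]: "mls_coeff (push f) (push_mono a) = mls_coeff f a"
  by (subst mls_coeff_push_raw) (auto simp: inj_push_mono)

lemma mls_coeff_push_nonzeroE:
  assumes "mls_coeff (push f) c \<noteq> 0"
  obtains a where "c = push_mono a" "mls_coeff f a \<noteq> 0"
  using assms by (metis mls_coeff_push mls_coeff_push_raw)

lemma push_monom: "push (mls_monom u) = mls_monom (push_mono u)"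
proof (rule mls_eqI)
  fix c
  show "mls_coeff (push (mls_monom u) :: 'a mls) c = mls_coeff (mls_monom (push_mono u)) c"
  proof (cases "\<exists>a. c = push_mono a")
    case True
    thus ?thesis by (auto simp: mls_coeff_monom inj_push_mono)
  next
    case False
    thus ?thesis by (subst mls_coeff_push_raw) (auto simp: mls_coeff_monom)
  qed
qed

lemma push_1: "push 1 = 1"
  using push_monom[of 0] by (simp add: push_mono_0)

lemma push_diff: "push (f - g) = push f - push g"
  by (rule mls_eqI) (simp add: mls_coeff_push_raw)

lemma push_mult: "push (f * g) = push f * push g"
proof (rule mls_eqI)
  fix c
  show "mls_coeff (push (f * g)) c = mls_coeff (push f * push g) c"
  proof (cases "\<exists>a. c = push_mono a")
    case True
    then obtain d where d: "c = push_mono d" by blast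
    let ?A = "conv_support (mls_coeff f) (mls_coeff g) d"
    have fin: "finite ?A" by (rule finite_conv_support_mls)
    have "mls_coeff (push f * push g) c
        = (\<Sum>a\<in>push_mono ` ?A. mls_coeff (push f) a * mls_coeff (push g) (c - a))"
    proof (rule mls_coeff_mult_superset)
      fix a assume a: "mls_coeff (push f) a \<noteq> 0" "mls_coeff (push g) (c - a) \<noteq> 0"
      then obtain b where b: "a = push_mono b" "mls_coeff f b \<noteq> 0"
        by (blast elim: mls_coeff_push_nonzeroE)
      have "mls_coeff g (d - b) \<noteq> 0"
        using a(2) unfolding d b(1) push_mono_diff[symmetric] mls_coeff_push .
      thus "a \<in> push_mono ` ?A" using b by (auto simp: conv_support_def)
    qed (use fin in simp)
    also have "\<dots> = (\<Sum>a\<in>?A. mls_coeff f a * mls_coeff g (d - a))"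
      by (subst sum.reindex) (auto simp: inj_on_def inj_push_mono d push_mono_diff[symmetric])
    also have "\<dots> = mls_coeff (f * g) d"
      by (rule mls_coeff_mult_superset[OF fin, symmetric]) (auto simp: conv_support_def)
    finally show ?thesis by (simp add: d)
  next
    case False
    have "mls_coeff (push f * push g) c = 0"
    proof (rule ccontr)
      assume "mls_coeff (push f * push g) c \<noteq> 0"
      then obtain a where "mls_coeff (push f) a \<noteq> 0" "mls_coeff (push g) (c - a) \<noteq> 0"
        by (rule mls_mult_nonzeroE)
      then obtain b b' where "a = push_mono b" "c - a = push_mono b'"
        by (blast elim: mls_coeff_push_nonzeroE)
      hence "c = push_mono (b + b')" by (simp add: push_mono_add algebra_simps)
      thus False using False by blast
    qed
    thus ?thesis using False by (simp add: mls_coeff_push_raw[of "f * g"])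
  qed
qed

lemma push_prod: "push (prod f A) = (\<Prod>i\<in>A. push (f i))"
  by (induction A rule: infinite_finite_induct) (simp_all add: push_1 push_mult)

lemma push_power: "push (f ^ m) = push f ^ m"
  by (induction m) (simp_all add: push_1 push_mult)

lemma push_inverse:
  assumes "f * inverse f = 1"
  shows "push (inverse f) = inverse (push f)"
  by (rule inverse_mls_eqI[symmetric]) (simp add: assms push_mult[symmetric] push_1)

end

subsection \<open>Translation and reversal of the variables\<close>

text \<open>Truncated subtraction takes the value 0 at both 0 and 1. Hence the exponent of x_0 in an
  image is 0, and x_i goes to x_(i+1).\<close>

definition shift_tail :: "nat \<Rightarrow> nat" where
  "shift_tail i = i - 1"

interpretation shift: tail_map shift_tail
proof
  show "surj shift_tail" by (rule surjI[of _ Suc]) (simp add: shift_tail_def)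
  show "\<exists>K'. \<forall>i\<ge>K'. K \<le> shift_tail i" for K
    by (rule exI[of _ "Suc K"]) (auto simp: shift_tail_def)
qed

lemma shift_push_mono_single:
  "shift.push_mono (Poly_Mapping.single i c) = Poly_Mapping.single (Suc i) c"
  by (rule monomial_eqI_tail) (auto simp: shift.tail_push_mono tail_single shift_tail_def)

lemma shift_push_inv_disc: "shift.push (inv_disc b k :: 'a::comm_ring_1 mls) = inv_disc (Suc b) k"
proof -
  have "shift.push (inv_disc b k :: 'a mls)
      = (\<Prod>p\<in>pairs b k. (inverse (X (Suc (fst p)) - X (Suc (snd p))))\<^sup>2)"
    unfolding inv_disc_def shift.push_prod
  proof (rule prod.cong)
    fix p assume "p \<in> pairs b k"
    hence "fst p < snd p" by (auto simp: pairs_def)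
    moreover have "shift.push (X i :: 'a mls) = X (Suc i)" for i
      by (simp add: X_def shift.push_monom shift_push_mono_single)
    ultimately show "shift.push (case p of (i, j) \<Rightarrow> (inverse (X i - X j))\<^sup>2)
        = ((inverse (X (Suc (fst p)) - X (Suc (snd p))))\<^sup>2 :: 'a mls)"
      by (simp add: case_prod_beta shift.push_power shift.push_inverse[OF X_diff_unit] shift.push_diff)
  qed simp
  also have "\<dots> = inv_disc (Suc b) k"
    unfolding inv_disc_def
    by (rule prod.reindex_bij_witness[of _ "\<lambda>(i,j). (i - 1, j - 1)" "\<lambda>(i,j). (Suc i, Suc j)"])
      (auto simp: pairs_def)
  finally show ?thesis .
qed

lemma disc_coeff_shift: "disc_coeff (Suc b) k a = disc_coeff b k a"
proof -
  have "shift.push_mono (- expo b k a) = - expo (Suc b) k a"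
    by (simp add: shift.push_mono_uminus expo_def shift.push_mono_sum shift_push_mono_single)
  thus ?thesis
    unfolding disc_coeff_def by (metis shift.mls_coeff_push shift_push_inv_disc)
qed

lemma disc_coeff_base: "disc_coeff b k a = disc_coeff 0 k a"
  by (induction b) (simp_all add: disc_coeff_shift)

text \<open>This exchanges \<open>x\<^sub>i\<close> with \<open>x\<^sub>b x\<^bsub>b+k+1\<^esub> / x\<^bsub>2b+k+1-i\<^esub>\<close>, i.e. it is inversion, homogenized by the
  two neighbouring variables so that it respects the order of the variables.\<close>

definition rev_tail :: "nat \<Rightarrow> nat \<Rightarrow> nat \<Rightarrow> nat" where
  "rev_tail b k i = (if b < i \<and> i \<le> b + k + 1 then 2 * b + k + 2 - i else i)"

interpretation rev: tail_map "rev_tail b k" for b k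
proof
  have "rev_tail b k (rev_tail b k i) = i" for i
    by (auto simp: rev_tail_def)
  thus "surj (rev_tail b k)" by (metis surjI)
  show "\<exists>K'. \<forall>i\<ge>K'. K \<le> rev_tail b k i" for K
    by (rule exI[of _ "K + b + k + 2"]) (auto simp: rev_tail_def)
qed

lemma rev_push_mono_single:
  assumes "b < i" "i \<le> b + k"
  shows "rev.push_mono b k (Poly_Mapping.single i c)
    = Poly_Mapping.single b c + Poly_Mapping.single (b + k + 1) c - Poly_Mapping.single (2 * b + k + 1 - i) c"
  by (rule monomial_eqI_tail)
    (use assms in \<open>auto simp: rev.tail_push_mono tail_single tail_add tail_diff rev_tail_def\<close>)

text \<open>Write i' = 2b + k + 1 - i. The difference x_i - x_j becomes x_b x_(b+k+1) (x_j' - x_i')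
  / (x_i' x_j'), and j' < i', so it is again a difference in the order for which the expansion is
  defined.\<close>

lemma rev_push_factor:
  fixes b k :: nat
  defines "e \<equiv> \<lambda>n i. Poly_Mapping.single i n :: monomial"
  assumes "(i, j) \<in> pairs b k"
  shows "rev.push b k ((inverse (X i - X j))\<^sup>2 :: 'a::comm_ring_1 mls)
    = mls_monom (e 2 (2 * b + k + 1 - j) + e 2 (2 * b + k + 1 - i) - e 2 b - e 2 (b + k + 1))
      * (inverse (X (2 * b + k + 1 - j) - X (2 * b + k + 1 - i)))\<^sup>2"
proof -
  let ?i = "2 * b + k + 1 - i" and ?j = "2 * b + k + 1 - j"
  have ij: "b < i" "i < j" "j \<le> b + k" using assms by (auto simp: pairs_def)
  have ji: "?j < ?i" using ij by simp
  let ?u = "e 1 ?j + e 1 ?i - e 1 b - e 1 (b + k + 1)"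
  have e2: "e 2 x = e 1 x + e 1 x" for x
    by (simp add: e_def single_add[symmetric])
  have "rev.push b k (X i - X j :: 'a mls) = mls_monom (- ?u) * (X ?j - X ?i)"
    using ij
    by (simp add: rev.push_diff X_def rev.push_monom rev_push_mono_single right_diff_distrib
        mls_monom_mult e_def algebra_simps)
  moreover have "rev.push b k (inverse (X i - X j :: 'a mls)) = inverse (rev.push b k (X i - X j))"
    by (rule rev.push_inverse[OF X_diff_unit[OF ij(2)]])
  ultimately have "rev.push b k (inverse (X i - X j :: 'a mls))
      = mls_monom ?u * inverse (X ?j - X ?i)"
    by (simp only: mls_inverse_mult(1)[OF mls_monom_unit X_diff_unit[OF ji]] inverse_mls_monom minus_minus)
  hence "rev.push b k ((inverse (X i - X j))\<^sup>2 :: 'a mls)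
      = mls_monom (?u + ?u) * (inverse (X ?j - X ?i))\<^sup>2"
    by (simp only: rev.push_power power_mult_distrib) (simp only: power2_eq_square mls_monom_mult)
  also have "?u + ?u = e 2 ?j + e 2 ?i - e 2 b - e 2 (b + k + 1)"
    by (simp only: e2) simp
  finally show ?thesis .
qed

lemma rev_push_inv_disc:
  "rev.push b k (inv_disc b k :: 'a::comm_ring_1 mls)
    = mls_monom (expo b k (\<lambda>_. 2 * (int k - 1)) - Poly_Mapping.single b (int k * (int k - 1))
        - Poly_Mapping.single (b + k + 1) (int k * (int k - 1))) * inv_disc b k"
proof -
  define e where "e = (\<lambda>i. Poly_Mapping.single i 2 :: monomial)"
  define u where "u = (\<lambda>(i, j). e i + e j - e b - e (b + k + 1))"
  have "rev.push b k (inv_disc b k :: 'a mls)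
      = (\<Prod>(i,j)\<in>pairs b k. mls_monom (u (2 * b + k + 1 - j, 2 * b + k + 1 - i))
          * (inverse (X (2 * b + k + 1 - j) - X (2 * b + k + 1 - i)))\<^sup>2)"
    unfolding inv_disc_def rev.push_prod u_def e_def
    by (rule prod.cong) (auto simp: rev_push_factor)
  also have "\<dots> = (\<Prod>(i,j)\<in>pairs b k. mls_monom (u (i, j)) * (inverse (X i - X j))\<^sup>2)"
    by (rule prod.reindex_bij_witness[of _ "\<lambda>(i,j). (2 * b + k + 1 - j, 2 * b + k + 1 - i)"
          "\<lambda>(i,j). (2 * b + k + 1 - j, 2 * b + k + 1 - i)"])
      (auto simp: pairs_def)
  also have "\<dots> = mls_monom (\<Sum>p\<in>pairs b k. u p) * inv_disc b k"
    by (simp add: inv_disc_def prod.distrib case_prod_beta mls_monom_prod)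
  also have "(\<Sum>p\<in>pairs b k. u p) = expo b k (\<lambda>_. 2 * (int k - 1))
      - Poly_Mapping.single b (int k * (int k - 1)) - Poly_Mapping.single (b + k + 1) (int k * (int k - 1))"
  proof (rule poly_mapping_eqI)
    fix x
    let ?q = "\<lambda>i. Poly_Mapping.lookup (e i) x"
    have "Poly_Mapping.lookup (\<Sum>p\<in>pairs b k. u p) x
        = (\<Sum>p\<in>pairs b k. (?q (fst p) + ?q (snd p)) - (?q b + ?q (b + k + 1)))"
      unfolding u_def
      by (simp add: lookup_sum lookup_add lookup_minus case_prod_beta algebra_simps)
    also have "\<dots> = (int k - 1) * (\<Sum>i\<in>{b<..b+k}. ?q i) - int (card (pairs b k)) * (?q b + ?q (b + k + 1))"
      using sum_pairs_add[of ?q b k, unfolded case_prod_beta] by (simp only: sum_subtractf sum_constant)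
    also have "(\<Sum>i\<in>{b<..b+k}. ?q i) = (if b < x \<and> x \<le> b + k then 2 else 0)"
      by (simp add: e_def lookup_single when_def)
    also have "int (card (pairs b k)) * (?q b + ?q (b + k + 1))
       = 2 * int (card (pairs b k)) * (of_bool (x = b) + of_bool (x = b + k + 1))"
      by (auto simp: e_def lookup_single when_def)
    also have "2 * int (card (pairs b k)) = int k * (int k - 1)" by (rule two_card_pairs)
    finally show "Poly_Mapping.lookup (\<Sum>p\<in>pairs b k. u p) x = Poly_Mapping.lookup
       (expo b k (\<lambda>_. 2 * (int k - 1)) - Poly_Mapping.single b (int k * (int k - 1))
         - Poly_Mapping.single (b + k + 1) (int k * (int k - 1))) x"
      by (auto simp: lookup_minus lookup_expo lookup_single when_def)
  qed
  finally show ?thesis .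
qed

text \<open>If the exponents have the total degree k(k-1) required by homogeneity, the powers of the
  two auxiliary neighbours cancel and \<open>rev_push_inv_disc\<close> applies. Otherwise neither
  side has the right degree and both are 0.\<close>

lemma disc_coeff_inversion: "disc_coeff b k (\<lambda>i. 2 * (int k - 1) - a (k + 1 - i)) = disc_coeff b k a"
proof (cases "(\<Sum>i=1..k. a i) = int k * (int k - 1)")
  case True
  let ?w = "expo b k (\<lambda>_. 2 * (int k - 1)) - Poly_Mapping.single b (int k * (int k - 1))
        - Poly_Mapping.single (b + k + 1) (int k * (int k - 1))"
  have "rev.push_mono b k (expo b k a)
     = (\<Sum>i=1..k. Poly_Mapping.single b (a i) + Poly_Mapping.single (b + k + 1) (a i)
          - Poly_Mapping.single (2 * b + k + 1 - (b + i)) (a i))"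
    unfolding expo_def rev.push_mono_sum by (intro sum.cong refl rev_push_mono_single) auto
  also have "\<dots> = (\<Sum>i=1..k. Poly_Mapping.single b (a i)) + (\<Sum>i=1..k. Poly_Mapping.single (b + k + 1) (a i))
      - (\<Sum>i=1..k. Poly_Mapping.single (b + (k + 1 - i)) (a i))"
    by (simp add: sum.distrib sum_subtractf)
  also have "(\<Sum>i=1..k. Poly_Mapping.single (b + (k + 1 - i)) (a i)) = expo b k (\<lambda>i. a (k + 1 - i))"
    unfolding expo_def
    by (rule sum.reindex_bij_witness[of _ "\<lambda>i. k + 1 - i" "\<lambda>i. k + 1 - i"]) auto
  finally have 1: "rev.push_mono b k (expo b k a) = (\<Sum>i=1..k. Poly_Mapping.single b (a i))
      + (\<Sum>i=1..k. Poly_Mapping.single (b + k + 1) (a i)) - expo b k (\<lambda>i. a (k + 1 - i))" .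
  have sum_single: "(\<Sum>i=1..k. Poly_Mapping.single j (a i)) = Poly_Mapping.single j (\<Sum>i=1..k. a i)" for j
    by (rule poly_mapping_eqI) (simp add: lookup_sum lookup_single when_def)
  have eq: "- rev.push_mono b k (expo b k a) - ?w = - expo b k (\<lambda>i. 2 * (int k - 1) - a (k + 1 - i))"
    unfolding 1 sum_single True
    by (rule poly_mapping_eqI) (auto simp: lookup_minus lookup_add lookup_expo)
  have "disc_coeff b k a = mls_coeff (rev.push b k (inv_disc b k)) (rev.push_mono b k (- expo b k a))"
    by (simp add: disc_coeff_def)
  also have "\<dots> = disc_coeff b k (\<lambda>i. 2 * (int k - 1) - a (k + 1 - i))"
    unfolding rev_push_inv_disc mls_coeff_monom_mult rev.push_mono_uminus eq disc_coeff_def ..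
  finally show ?thesis by simp
next
  case False
  have "(\<Sum>i=1..k. a (k + 1 - i)) = (\<Sum>i=1..k. a i)"
    by (rule sum.reindex_bij_witness[of _ "\<lambda>i. k + 1 - i" "\<lambda>i. k + 1 - i"]) auto
  hence "(\<Sum>i=1..k. 2 * (int k - 1) - a (k + 1 - i)) = 2 * (int k * (int k - 1)) - (\<Sum>i=1..k. a i)"
    by (simp only: sum_subtractf sum_constant) simp
  hence "(\<Sum>i=1..k. 2 * (int k - 1) - a (k + 1 - i)) \<noteq> int k * (int k - 1)"
    using False by linarith
  thus ?thesis using False disc_coeff_homogeneous by metis
qed


subsection \<open>The constant term functional on power series\<close>

definition compositions :: "nat \<Rightarrow> nat \<Rightarrow> (nat \<Rightarrow> nat) set" where
  "compositions k d = {\<alpha>. \<alpha> \<in> ({1..k} \<rightarrow>\<^sub>E {..d}) \<and> (\<Sum>i=1..k. \<alpha> i) = d}"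

lemma finite_compositions [simp]: "finite (compositions k d)"
  unfolding compositions_def
  by (rule finite_subset[of _ "{1..k} \<rightarrow>\<^sub>E {..d}"]) (blast, simp add: finite_PiE)

lemma compositionsI:
  assumes "\<alpha> \<in> extensional {1..k}" "(\<Sum>i=1..k. \<alpha> i) = d"
  shows "\<alpha> \<in> compositions k d"
proof -
  have "\<alpha> i \<le> d" if "i \<in> {1..k}" for i
    using assms(2) member_le_sum[of i "{1..k}" \<alpha>] that by simp
  thus ?thesis using assms by (auto simp: compositions_def PiE_iff)
qed

lemma compositionsD:
  assumes "\<alpha> \<in> compositions k d"
  shows "\<alpha> \<in> extensional {1..k}" "(\<Sum>i=1..k. \<alpha> i) = d"
  using assms unfolding compositions_def PiE_def by blast+

lemma int_mult_pred: "int (k * (k - 1)) = int k * (int k - 1)"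
  by (cases k) (simp_all add: algebra_simps)

lemma int_degree: "int (k * (k - 1) + e * k) = int k * (int k - 1) + int e * int k"
  using int_mult_pred[of k] by simp

text \<open>The constant term of \<Prod>y_i^(-e) f(y_i) times the kernel, see
  \<open>CT_fps_at\<close>. Homogeneity of the kernel leaves a single total degree, which makes the
  sum finite for every power series f.\<close>

definition disc_CT :: "nat \<Rightarrow> nat \<Rightarrow> rat fps \<Rightarrow> rat" where
  "disc_CT k e f = (\<Sum>\<alpha>\<in>compositions k (k * (k - 1) + e * k).
     disc_coeff 0 k (\<lambda>i. int (\<alpha> i) - int e) * (\<Prod>i=1..k. f $ \<alpha> i))"

definition power_series_in :: "nat set \<Rightarrow> 'a::comm_ring_1 mls \<Rightarrow> bool" where
  "power_series_in A f \<longleftrightarrow> (\<forall>a. mls_coeff f a \<noteq> 0 \<longrightarrow>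
     Poly_Mapping.keys a \<subseteq> A \<and> (\<forall>i. 0 \<le> Poly_Mapping.lookup a i))"

lemma power_series_in_imp_in: "power_series_in A f \<Longrightarrow> mls_in A f"
  by (auto simp: power_series_in_def mls_in_def)

lemma power_series_in_mult:
  assumes "power_series_in A f" "power_series_in A g"
  shows "power_series_in A (f * g)"
  unfolding power_series_in_def
proof (intro allI impI)
  fix c assume nz: "mls_coeff (f * g) c \<noteq> 0"
  have "mls_in A (f * g)"
    using assms by (intro mls_in_mult power_series_in_imp_in)
  moreover have "0 \<le> Poly_Mapping.lookup c i" for i
  proof -
    obtain a where "mls_coeff f a \<noteq> 0" "mls_coeff g (c - a) \<noteq> 0"
      using nz by (rule mls_mult_nonzeroE)
    hence "0 \<le> Poly_Mapping.lookup a i" "0 \<le> Poly_Mapping.lookup (c - a) i"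
      using assms by (auto simp: power_series_in_def)
    thus ?thesis by (simp add: lookup_minus)
  qed
  ultimately show "Poly_Mapping.keys c \<subseteq> A \<and> (\<forall>i. 0 \<le> Poly_Mapping.lookup c i)"
    using nz by (auto simp: mls_in_def)
qed

lemma power_series_in_prod:
  "(\<And>i. i \<in> B \<Longrightarrow> power_series_in A (f i)) \<Longrightarrow> power_series_in A (prod f B)"
proof (induction B rule: infinite_finite_induct)
  case (insert x F)
  thus ?case by (simp add: power_series_in_mult)
qed (simp_all add: power_series_in_def mls_coeff_1)

lemma CT_power_series:
  assumes F: "power_series_in {b<..b+k} F"
  shows "CT (mls_monom (- expo b k (\<lambda>_. int e)) * F * inv_disc b k)
    = (\<Sum>\<alpha>\<in>compositions k (k * (k - 1) + e * k). mls_coeff F (expo b k (\<lambda>i. int (\<alpha> i)))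
        * disc_coeff 0 k (\<lambda>i. int (\<alpha> i) - int e))"
proof -
  let ?E = "\<lambda>\<alpha>. expo b k (\<lambda>i. int (\<alpha> i))"
  let ?C = "compositions k (k * (k - 1) + e * k)"
  let ?e = "expo b k (\<lambda>_. int e)"
  have diff: "?e - ?E \<alpha> = - expo b k (\<lambda>i. int (\<alpha> i) - int e)" for \<alpha>
    by (rule poly_mapping_eqI) (simp add: lookup_minus lookup_expo)
  have coeff_D: "mls_coeff (inv_disc b k) (?e - ?E \<alpha>) = disc_coeff 0 k (\<lambda>i. int (\<alpha> i) - int e)" for \<alpha>
    unfolding diff by (simp add: disc_coeff_def[symmetric] disc_coeff_base[of b])
  have inj: "inj_on ?E ?C"
  proof
    fix \<alpha> \<beta> assume ab: "\<alpha> \<in> ?C" "\<beta> \<in> ?C" "?E \<alpha> = ?E \<beta>"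
    have "\<alpha> i = \<beta> i" if "i \<in> {1..k}" for i
      using arg_cong[OF ab(3), of "\<lambda>c. Poly_Mapping.lookup c (b + i)"] that
      by (simp add: lookup_expo)
    thus "\<alpha> = \<beta>" using compositionsD(1)[OF ab(1)] compositionsD(1)[OF ab(2)] by (metis extensionalityI)
  qed
  have "CT (mls_monom (- ?e) * F * inv_disc b k) = mls_coeff (F * inv_disc b k) ?e"
    by (simp add: CT_def mult.assoc mls_coeff_monom_mult)
  also have "\<dots> = (\<Sum>a\<in>?E ` ?C. mls_coeff F a * mls_coeff (inv_disc b k) (?e - a))"
  proof (rule mls_coeff_mult_superset)
    fix a assume a: "mls_coeff F a \<noteq> 0" "mls_coeff (inv_disc b k :: rat mls) (?e - a) \<noteq> 0"
    define \<alpha> where "\<alpha> = restrict (\<lambda>i. nat (Poly_Mapping.lookup a (b + i))) {1..k}"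
    have keys: "Poly_Mapping.keys a \<subseteq> {b<..b+k}" and nn: "\<And>i. 0 \<le> Poly_Mapping.lookup a i"
      using F a(1) by (auto simp: power_series_in_def)
    have "?E \<alpha> = expo b k (\<lambda>i. Poly_Mapping.lookup a (b + i))"
      unfolding expo_def by (rule sum.cong) (auto simp: \<alpha>_def nn)
    hence E: "?E \<alpha> = a" by (simp add: expo_lookup[OF keys])
    hence "disc_coeff 0 k (\<lambda>i. int (\<alpha> i) - int e) \<noteq> 0" using a(2) coeff_D[of \<alpha>] by simp
    from disc_coeff_homogeneous[OF this] have "int (\<Sum>i=1..k. \<alpha> i) = int (k * (k - 1) + e * k)"
      unfolding int_degree by (simp add: sum_subtractf mult.commute)
    hence "\<alpha> \<in> ?C" by (intro compositionsI) (simp_all only: of_nat_eq_iff, simp add: \<alpha>_def)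
    thus "a \<in> ?E ` ?C" using E by blast
  qed simp
  also have "\<dots> = (\<Sum>\<alpha>\<in>?C. mls_coeff F (?E \<alpha>) * disc_coeff 0 k (\<lambda>i. int (\<alpha> i) - int e))"
    by (subst sum.reindex[OF inj]) (simp add: coeff_D)
  finally show ?thesis .
qed

section \<open>One-variable power series inside the Laurent series\<close>

lift_definition fps_at :: "nat \<Rightarrow> 'a::comm_ring_1 fps \<Rightarrow> 'a mls" is
  "\<lambda>i f a. if a = Poly_Mapping.single i (Poly_Mapping.lookup a i) \<and> 0 \<le> Poly_Mapping.lookup a i
     then f $ nat (Poly_Mapping.lookup a i) else 0"
proof -
  fix i and f :: "'a fps"
  have "0 \<le> tail l a"
    if "a = Poly_Mapping.single i (Poly_Mapping.lookup a i)" "0 \<le> Poly_Mapping.lookup a i" for l a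
    by (subst that(1)) (use that(2) in \<open>simp add: tail_single\<close>)
  thus "\<exists>m. \<forall>a. (if a = Poly_Mapping.single i (Poly_Mapping.lookup a i) \<and> 0 \<le> Poly_Mapping.lookup a i
     then f $ nat (Poly_Mapping.lookup a i) else 0) \<noteq> 0 \<longrightarrow> a - m \<in> small_monomials"
    by (intro exI[of _ 0]) (auto simp: small_monomials_def)
qed

lemma mls_coeff_fps_at [simp]: "mls_coeff (fps_at i f) (Poly_Mapping.single i (int n)) = f $ n"
  by transfer simp

lemma fps_at_nonzeroE:
  assumes "mls_coeff (fps_at i f) a \<noteq> 0"
  obtains n where "a = Poly_Mapping.single i (int n)"
  using assms by transfer (metis int_nat_eq)

lemma power_series_in_fps_at: "i \<in> A \<Longrightarrow> power_series_in A (fps_at i f)"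
  unfolding power_series_in_def by (auto elim!: fps_at_nonzeroE simp: lookup_single when_def split: if_splits)

lemma fps_at_eqI:
  assumes "\<And>a. mls_coeff g a \<noteq> 0 \<Longrightarrow> \<exists>n. a = Poly_Mapping.single i (int n)"
    and "\<And>n. mls_coeff g (Poly_Mapping.single i (int n)) = f $ n"
  shows "fps_at i f = g"
proof (rule mls_eqI)
  fix a
  show "mls_coeff (fps_at i f) a = mls_coeff g a"
  proof (cases "\<exists>n. a = Poly_Mapping.single i (int n)")
    case True
    thus ?thesis using assms(2) by auto
  next
    case False
    thus ?thesis using assms(1) fps_at_nonzeroE by metis
  qed
qed

lemma single_int_diff: "Poly_Mapping.single i (int n) - Poly_Mapping.single i (int m) = Poly_Mapping.single i (int n - int m)"
  by (simp add: single_diff)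

lemma fps_at_mult: "fps_at i (f * g) = fps_at i f * fps_at i g"
proof (rule fps_at_eqI)
  fix a assume "mls_coeff (fps_at i f * fps_at i g) a \<noteq> 0"
  then obtain c where "mls_coeff (fps_at i f) c \<noteq> 0" "mls_coeff (fps_at i g) (a - c) \<noteq> 0"
    by (rule mls_mult_nonzeroE)
  then obtain m n where "c = Poly_Mapping.single i (int m)" "a - c = Poly_Mapping.single i (int n)"
    by (metis fps_at_nonzeroE)
  hence "a = Poly_Mapping.single i (int (n + m))" by (simp add: single_add algebra_simps)
  thus "\<exists>n. a = Poly_Mapping.single i (int n)" by blast
next
  fix n
  let ?s = "\<lambda>j. Poly_Mapping.single i (int j)"
  have inj: "inj_on ?s {0..n}"
    by (auto simp: inj_on_def dest: arg_cong[where f = "\<lambda>c. Poly_Mapping.lookup c i"])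
  have "mls_coeff (fps_at i f * fps_at i g) (?s n)
      = (\<Sum>a\<in>?s ` {0..n}. mls_coeff (fps_at i f) a * mls_coeff (fps_at i g) (?s n - a))"
  proof (rule mls_coeff_mult_superset)
    fix a assume a: "mls_coeff (fps_at i f) a \<noteq> 0" "mls_coeff (fps_at i g) (?s n - a) \<noteq> 0"
    obtain j where j: "a = ?s j" using a(1) by (rule fps_at_nonzeroE)
    obtain l where l: "?s n - a = ?s l" using a(2) by (rule fps_at_nonzeroE)
    have "int n - int j = int l"
      using arg_cong[OF l, of "\<lambda>c. Poly_Mapping.lookup c i"] by (simp add: j lookup_minus)
    thus "a \<in> ?s ` {0..n}" using j by auto
  qed simp
  also have "\<dots> = (\<Sum>j=0..n. f $ j * g $ (n - j))"
    unfolding sum.reindex[OF inj]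
    by (rule sum.cong) (auto simp: single_int_diff of_nat_diff[symmetric] simp del: of_nat_diff)
  also have "\<dots> = (f * g) $ n" by (simp add: fps_mult_nth)
  finally show "mls_coeff (fps_at i f * fps_at i g) (?s n) = (f * g) $ n" .
qed

lemma fps_at_1: "fps_at i 1 = 1"
proof (rule fps_at_eqI)
  show "\<exists>n. a = Poly_Mapping.single i (int n)" if "mls_coeff (1 :: 'a mls) a \<noteq> 0" for a
    using that by (intro exI[of _ 0]) (simp add: mls_coeff_1 split: if_splits)
  show "mls_coeff (1 :: 'a mls) (Poly_Mapping.single i (int n)) = 1 $ n" for n
    by (simp add: mls_coeff_1) (metis lookup_single_eq lookup_zero of_nat_eq_0_iff single_zero)
qed

lemma fps_at_diff: "fps_at i (f - g) = fps_at i f - fps_at i g"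
  by (rule fps_at_eqI) (auto elim: fps_at_nonzeroE, metis diff_zero fps_at_nonzeroE)

lemma fps_at_X: "fps_at i fps_X = X i"
proof (rule fps_at_eqI)
  have eq: "Poly_Mapping.single i (int n) = Poly_Mapping.single i 1 \<longleftrightarrow> n = 1" for n
    by (metis lookup_single_eq of_nat_1 of_nat_eq_iff)
  show "\<exists>n. a = Poly_Mapping.single i (int n)" if "mls_coeff (X i :: 'a mls) a \<noteq> 0" for a
    using that by (intro exI[of _ 1]) (simp add: X_def mls_coeff_monom split: if_splits)
  show "mls_coeff (X i :: 'a mls) (Poly_Mapping.single i (int n)) = fps_X $ n" for n
    using eq[of n] by (simp add: X_def mls_coeff_monom)
qed

lemma fps_at_power: "fps_at i (f ^ m) = fps_at i f ^ m"
  by (induction m) (simp_all add: fps_at_1 fps_at_mult)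

lemma fps_at_inverse_one_minus_X:
  "fps_at i (inverse (1 - fps_X) ^ m :: rat fps) = inverse ((1 - X i) ^ m)"
proof (rule inverse_mls_eqI[symmetric])
  have "(1 - fps_X) * inverse (1 - fps_X) = (1 :: rat fps)"
    by (rule inverse_mult_eq_1') simp
  hence "(1 - fps_X) ^ m * inverse (1 - fps_X) ^ m = (1 :: rat fps)"
    by (simp add: power_mult_distrib[symmetric])
  thus "(1 - X i) ^ m * fps_at i (inverse (1 - fps_X) ^ m) = (1 :: rat mls)"
    by (metis fps_at_mult fps_at_1 fps_at_diff fps_at_power fps_at_X)
qed

lemma mls_coeff_prod_fps_at:
  "mls_coeff (\<Prod>i=1..k. fps_at (b + i) (f i)) (expo b k (\<lambda>i. int (\<alpha> i))) = (\<Prod>i=1..k. f i $ \<alpha> i)"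
proof (induction k)
  case 0
  thus ?case by (simp add: expo_def mls_coeff_1)
next
  case (Suc k)
  have expo: "expo b (Suc k) (\<lambda>i. int (\<alpha> i))
      = expo b k (\<lambda>i. int (\<alpha> i)) + Poly_Mapping.single (b + Suc k) (int (\<alpha> (Suc k)))"
    by (simp add: expo_def)
  have "mls_coeff ((\<Prod>i=1..k. fps_at (b + i) (f i)) * fps_at (b + Suc k) (f (Suc k)))
     (expo b k (\<lambda>i. int (\<alpha> i)) + Poly_Mapping.single (b + Suc k) (int (\<alpha> (Suc k))))
    = mls_coeff (\<Prod>i=1..k. fps_at (b + i) (f i)) (expo b k (\<lambda>i. int (\<alpha> i)))
      * mls_coeff (fps_at (b + Suc k) (f (Suc k))) (Poly_Mapping.single (b + Suc k) (int (\<alpha> (Suc k))))"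
  proof (rule mls_coeff_mult_disjoint[of "{b<..b+k}" _ "{b + Suc k}"])
    show "mls_in {b<..b + k} (\<Prod>i=1..k. fps_at (b + i) (f i))"
      by (rule mls_in_prod, rule power_series_in_imp_in, rule power_series_in_fps_at) auto
    show "mls_in {b + Suc k} (fps_at (b + Suc k) (f (Suc k)))"
      by (rule power_series_in_imp_in, rule power_series_in_fps_at) simp
  qed (auto simp: in_keys_iff lookup_expo lookup_single split: if_splits)
  thus ?case by (simp add: expo Suc.IH[simplified])
qed

lemma CT_fps_at:
  "CT (mls_monom (- expo b k (\<lambda>_. int e)) * (\<Prod>i=1..k. fps_at (b + i) f) * inv_disc b k) = disc_CT k e f"
proof -
  have "power_series_in {b<..b+k} (\<Prod>i=1..k. fps_at (b + i) f)"
    by (rule power_series_in_prod, rule power_series_in_fps_at) auto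
  thus ?thesis
    unfolding disc_CT_def by (subst CT_power_series) (simp_all only: mls_coeff_prod_fps_at mult.commute)
qed


subsection \<open>Invariance under projective substitutions\<close>

definition map_coeffs :: "('a \<Rightarrow> 'b) \<Rightarrow> 'a fps \<Rightarrow> 'b fps" where
  "map_coeffs \<phi> f = Abs_fps (\<lambda>n. \<phi> (f $ n))"

lemma map_coeffs_nth [simp]: "map_coeffs \<phi> f $ n = \<phi> (f $ n)"
  by (simp add: map_coeffs_def)

lemma map_coeffs_mult:
  fixes \<phi> :: "'a::comm_ring_1 \<Rightarrow> 'b::comm_ring_1"
  assumes "\<And>x y. \<phi> (x + y) = \<phi> x + \<phi> y" "\<And>x y. \<phi> (x * y) = \<phi> x * \<phi> y"
  shows "map_coeffs \<phi> (f * g) = map_coeffs \<phi> f * map_coeffs \<phi> g"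
proof (rule fps_ext)
  fix n
  have "\<phi> 0 = 0" using assms(1)[of 0 0] by simp
  hence "\<phi> (\<Sum>i\<in>A. u i) = (\<Sum>i\<in>A. \<phi> (u i))" for A and u :: "nat \<Rightarrow> 'a"
    by (induction A rule: infinite_finite_induct) (simp_all add: assms(1))
  thus "map_coeffs \<phi> (f * g) $ n = (map_coeffs \<phi> f * map_coeffs \<phi> g) $ n"
    by (simp add: fps_mult_nth assms(2))
qed

lemma map_coeffs_power:
  fixes \<phi> :: "'a::comm_ring_1 \<Rightarrow> 'b::comm_ring_1"
  assumes "\<And>x y. \<phi> (x + y) = \<phi> x + \<phi> y" "\<And>x y. \<phi> (x * y) = \<phi> x * \<phi> y" "\<phi> 1 = 1"
  shows "map_coeffs \<phi> (f ^ m) = map_coeffs \<phi> f ^ m"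
proof (induction m)
  case 0
  have "\<phi> 0 = 0" using assms(1)[of 0 0] by simp
  thus ?case by (intro fps_ext) (simp add: assms(3))
next
  case (Suc m)
  thus ?case by (simp add: map_coeffs_mult[OF assms(1,2)])
qed

lemma map_coeffs_derivation:
  fixes d :: "'a::comm_ring_1 \<Rightarrow> 'a"
  assumes "\<And>x y. d (x + y) = d x + d y" "\<And>x y. d (x * y) = d x * y + x * d y"
  shows "map_coeffs d (f * g) = map_coeffs d f * g + f * map_coeffs d g"
proof (rule fps_ext)
  fix n
  have "d 0 = 0" using assms(1)[of 0 0] by simp
  hence "d (\<Sum>i\<in>A. u i) = (\<Sum>i\<in>A. d (u i))" for A and u :: "nat \<Rightarrow> 'a"
    by (induction A rule: infinite_finite_induct) (simp_all add: assms(1))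
  thus "map_coeffs d (f * g) $ n = (map_coeffs d f * g + f * map_coeffs d g) $ n"
    by (simp add: fps_mult_nth assms(2) sum.distrib)
qed

text \<open>The infinitesimal form of \<open>g = (1 - s X)\<^sup>c f(X / (1 - s X))\<close>, where \<open>s\<close> is the variable of the
  coefficients.\<close>

definition projective_family :: "int \<Rightarrow> rat poly fps \<Rightarrow> bool" where
  "projective_family c g \<longleftrightarrow> map_coeffs pderiv g = fps_X ^ 2 * fps_deriv g - of_int c * fps_X * g"

lemma map_coeffs_pderiv_mult:
  "map_coeffs pderiv (f * g) = map_coeffs pderiv f * g + f * map_coeffs pderiv (g :: rat poly fps)"
  by (rule map_coeffs_derivation) (simp_all add: pderiv_add pderiv_mult algebra_simps)

lemma projective_family_mult:
  assumes "projective_family c f" "projective_family c' g"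
  shows "projective_family (c + c') (f * g)"
  unfolding projective_family_def map_coeffs_pderiv_mult assms[unfolded projective_family_def]
  by (simp add: algebra_simps)

lemma projective_family_1: "projective_family 0 1"
  unfolding projective_family_def by (auto simp: fps_eq_iff pderiv_1)

lemma projective_family_power:
  assumes "projective_family c f"
  shows "projective_family (int m * c) (f ^ m)"
proof (induction m)
  case 0
  thus ?case by (simp add: projective_family_1)
next
  case (Suc m)
  thus ?case using projective_family_mult[OF assms Suc.IH] by (simp add: distrib_right)
qed

lemma projective_family_inverse:
  assumes "projective_family c f" "f * g = 1"
  shows "projective_family (- c) g"
proof -
  have "map_coeffs pderiv f * g + f * map_coeffs pderiv g = 0"
    using map_coeffs_pderiv_mult[of f g] assms(2) projective_family_1
    by (simp add: projective_family_def)
  hence "g * (map_coeffs pderiv f * g) + (f * g) * map_coeffs pderiv g = 0"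
    by (metis (no_types, lifting) distrib_left mult.assoc mult.commute mult_zero_right)
  hence 1: "map_coeffs pderiv g = - (map_coeffs pderiv f * g * g)"
    using assms(2) by (simp add: eq_neg_iff_add_eq_0 algebra_simps)
  have "fps_deriv f * g + f * fps_deriv g = 0"
    using assms(2) fps_deriv_mult[of f g] by (simp add: add.commute)
  hence "g * (fps_deriv f * g) + (f * g) * fps_deriv g = 0"
    by (metis (no_types, lifting) distrib_left mult.assoc mult.commute mult_zero_right)
  hence 2: "fps_deriv g = - (fps_deriv f * g * g)"
    using assms(2) by (simp add: eq_neg_iff_add_eq_0 algebra_simps)
  have "map_coeffs pderiv g = - (fps_X ^ 2 * (fps_deriv f * g * g)) + of_int c * fps_X * g * (f * g)"
    unfolding 1 assms(1)[unfolded projective_family_def] by (simp add: algebra_simps)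
  also have "\<dots> = fps_X ^ 2 * fps_deriv g - of_int (- c) * fps_X * g"
    unfolding 2 assms(2) by (simp add: algebra_simps)
  finally show ?thesis by (simp add: projective_family_def)
qed

text \<open>The polynomial \<open>[:a, 1:]\<close> is a + s. Under the family described above, 1 -
  aX with weight 1 becomes (1 - sX)(1 - aX/(1 - sX)) = 1 - (a + s)X; \<open>geo_family\<close> is
  its inverse, of weight -1.\<close>

definition lin_family :: "rat \<Rightarrow> rat poly fps" where
  "lin_family a = 1 - fps_const [:a, 1:] * fps_X"

definition geo_family :: "rat \<Rightarrow> rat poly fps" where
  "geo_family a = Abs_fps (\<lambda>n. [:a, 1:] ^ n)"

lemma lin_geo_family: "lin_family a * geo_family a = 1"
proof (rule fps_ext)
  fix n
  show "(lin_family a * geo_family a) $ n = 1 $ n"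
    by (cases n) (simp_all add: lin_family_def geo_family_def algebra_simps)
qed

lemma projective_family_lin: "projective_family 1 (lin_family a)"
  unfolding projective_family_def
proof (rule fps_ext)
  fix n
  have "fps_deriv (lin_family a) = - fps_const [:a, 1:]"
    by (simp add: lin_family_def)
  hence "fps_X ^ 2 * fps_deriv (lin_family a) - of_int 1 * fps_X * lin_family a = - fps_X"
    by (simp add: lin_family_def algebra_simps power2_eq_square)
  moreover have "map_coeffs pderiv (lin_family a) $ n = (- fps_X) $ n"
    by (auto simp: lin_family_def pderiv_minus pderiv_diff pderiv_pCons pderiv_1 fps_X_def)
  ultimately show "map_coeffs pderiv (lin_family a) $ n
      = (fps_X ^ 2 * fps_deriv (lin_family a) - of_int 1 * fps_X * lin_family a) $ n"
    by simp
qed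

lemma projective_family_geo: "projective_family (- 1) (geo_family a)"
  using projective_family_inverse[OF projective_family_lin lin_geo_family] .

text \<open>The differential equation read coefficientwise: differentiating in s lowers the index by
  one at the price of a linear factor, the same kind of factor as in
  \<open>disc_coeff_raising\<close>.\<close>

lemma projective_family_nth:
  assumes "projective_family c g"
  shows "pderiv (g $ 0) = 0" "pderiv (g $ Suc n) = of_int (int n - c) * g $ n"
proof -
  have eq: "pderiv (g $ m) = (fps_X ^ 2 * fps_deriv g - of_int c * fps_X * g) $ m" for m
    using assms unfolding projective_family_def by (metis map_coeffs_nth)
  have "of_int c * fps_X * g = fps_X * (fps_const (of_int c) * g)"
    by (simp add: fps_of_int[symmetric] mult_ac)
  hence eq': "pderiv (g $ m) = (fps_X * (fps_X * fps_deriv g)) $ m - (fps_X * (fps_const (of_int c) * g)) $ m" for m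
    by (simp add: eq power2_eq_square mult.assoc)
  show "pderiv (g $ 0) = 0" by (simp add: eq')
  show "pderiv (g $ Suc n) = of_int (int n - c) * g $ n"
    by (cases n) (simp_all add: eq' algebra_simps)
qed

lemma compositions_Suc_sum:
  assumes "i \<in> {1..k}"
  shows "(\<Sum>\<alpha>\<in>{\<alpha>\<in>compositions k (Suc d). 0 < \<alpha> i}. G \<alpha>) = (\<Sum>\<beta>\<in>compositions k d. G (\<beta>(i := Suc (\<beta> i))))"
proof (rule sum.reindex_bij_witness[of _ "\<lambda>\<beta>. \<beta>(i := Suc (\<beta> i))" "\<lambda>\<alpha>. \<alpha>(i := \<alpha> i - 1)"])
  have upd: "(\<Sum>j=1..k. (\<beta>(i := v)) j) = v + (\<Sum>j\<in>{1..k} - {i}. \<beta> j)" for \<beta> :: "nat \<Rightarrow> nat" and v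
    using assms by (simp add: sum.remove)
  have orig: "(\<Sum>j=1..k. \<beta> j) = \<beta> i + (\<Sum>j\<in>{1..k} - {i}. \<beta> j)" for \<beta> :: "nat \<Rightarrow> nat"
    using assms by (simp add: sum.remove)
  fix \<alpha>
  show "\<alpha>(i := \<alpha> i - 1) \<in> compositions k d" if "\<alpha> \<in> {\<alpha>\<in>compositions k (Suc d). 0 < \<alpha> i}"
    using that assms compositionsD[of \<alpha> k "Suc d"] orig[of \<alpha>]
    by (intro compositionsI) (auto simp: upd[simplified] extensional_def)
  show "\<alpha>(i := Suc (\<alpha> i)) \<in> {\<alpha>\<in>compositions k (Suc d). 0 < \<alpha> i}" if "\<alpha> \<in> compositions k d"
    using that assms compositionsD[of \<alpha> k d] orig[of \<alpha>]
    by (auto intro!: compositionsI simp: upd[simplified] extensional_def)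
qed auto

lemma pderiv_sum_set: "pderiv (\<Sum>x\<in>A. p x) = (\<Sum>x\<in>A. pderiv (p x))"
  by (induction A rule: infinite_finite_induct) (simp_all add: pderiv_add)

lemma smult_sum_right: "smult c (\<Sum>x\<in>A. p x) = (\<Sum>x\<in>A. smult c (p x))"
  by (induction A rule: infinite_finite_induct) (simp_all add: smult_add_right)

lemma smult_sum_left: "smult (\<Sum>x\<in>A. c x) p = (\<Sum>x\<in>A. smult (c x) p)"
  by (induction A rule: infinite_finite_induct) (simp_all add: smult_add_left)

text \<open>Differentiation lowers one exponent. Collected by the lowered exponent vector \<beta>,
  the coefficient of the product of the g $ \<beta>_j is the left side of
  \<open>disc_coeff_raising\<close> at \<beta> - e, which is why the weight has to be 2k - 3 +
  e.\<close>

lemma pderiv_disc_CT: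
  fixes k e :: nat
  defines "d \<equiv> k * (k - 1) + e * k"
  assumes g: "projective_family (2 * int k - 3 + int e) g"
  shows "pderiv (\<Sum>\<alpha>\<in>compositions k d. smult (disc_coeff 0 k (\<lambda>i. int (\<alpha> i) - int e)) (\<Prod>i=1..k. g $ \<alpha> i)) = 0"
proof -
  let ?c = "2 * int k - 3 + int e"
  let ?L = "\<lambda>\<alpha>. disc_coeff 0 k (\<lambda>i. int (\<alpha> i) - int e)"
  let ?P = "\<lambda>\<alpha> i. \<Prod>j\<in>{1..k} - {i}. g $ \<alpha> j"
  have "pderiv (\<Sum>\<alpha>\<in>compositions k d. smult (?L \<alpha>) (\<Prod>i=1..k. g $ \<alpha> i))
      = (\<Sum>\<alpha>\<in>compositions k d. \<Sum>i=1..k. smult (?L \<alpha>) (?P \<alpha> i * pderiv (g $ \<alpha> i)))"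
    by (simp add: pderiv_sum_set pderiv_smult pderiv_prod smult_sum_right)
  also have "\<dots> = (\<Sum>i=1..k. \<Sum>\<alpha>\<in>compositions k d. smult (?L \<alpha>) (?P \<alpha> i * pderiv (g $ \<alpha> i)))"
    by (rule sum.swap)
  also have "\<dots> = (\<Sum>i=1..k. \<Sum>\<alpha>\<in>{\<alpha>\<in>compositions k d. 0 < \<alpha> i}. smult (?L \<alpha>) (?P \<alpha> i * pderiv (g $ \<alpha> i)))"
    by (intro sum.cong refl sum.mono_neutral_right) (auto simp: projective_family_nth(1)[OF g])
  also have "\<dots> = 0"
  proof (cases d)
    case 0
    have "{\<alpha>\<in>compositions k 0. 0 < \<alpha> i} = {}" if "i \<in> {1..k}" for i
      using that by (auto dest!: compositionsD(2))
    hence "(\<Sum>\<alpha>\<in>{\<alpha>\<in>compositions k 0. 0 < \<alpha> i}. smult (?L \<alpha>) (?P \<alpha> i * pderiv (g $ \<alpha> i))) = 0"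
      if "i \<in> {1..k}" for i
      using that by (metis (no_types, lifting) sum.empty)
    thus ?thesis unfolding 0 by (rule sum.neutral[OF ballI])
  next
    case (Suc d')
    have "(\<Sum>i=1..k. \<Sum>\<alpha>\<in>{\<alpha>\<in>compositions k d. 0 < \<alpha> i}. smult (?L \<alpha>) (?P \<alpha> i * pderiv (g $ \<alpha> i)))
      = (\<Sum>i=1..k. \<Sum>\<beta>\<in>compositions k d'. smult (?L (\<beta>(i := Suc (\<beta> i))) * of_int (int (\<beta> i) - ?c))
           (\<Prod>j=1..k. g $ \<beta> j))"
    proof (rule sum.cong[OF refl])
      fix i assume i: "i \<in> {1..k}"
      have P: "?P (\<beta>(i := Suc (\<beta> i))) i = ?P \<beta> i" for \<beta>
        by (rule prod.cong) auto
      have "?P \<beta> i * (of_int (int (\<beta> i) - ?c) * g $ \<beta> i)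
          = smult (of_int (int (\<beta> i) - ?c)) (\<Prod>j=1..k. g $ \<beta> j)" for \<beta>
        using i prod.remove[of "{1..k}" i "\<lambda>j. g $ \<beta> j"]
        by (simp add: of_int_poly mult_ac del: of_int_diff of_int_add of_int_mult)
      thus "(\<Sum>\<alpha>\<in>{\<alpha>\<in>compositions k d. 0 < \<alpha> i}. smult (?L \<alpha>) (?P \<alpha> i * pderiv (g $ \<alpha> i)))
        = (\<Sum>\<beta>\<in>compositions k d'. smult (?L (\<beta>(i := Suc (\<beta> i))) * of_int (int (\<beta> i) - ?c))
           (\<Prod>j=1..k. g $ \<beta> j))"
        unfolding Suc compositions_Suc_sum[OF i] P fun_upd_same projective_family_nth(2)[OF g]
        by (simp only: smult_smult)
    qed
    also have "\<dots> = (\<Sum>\<beta>\<in>compositions k d'. smult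
        (\<Sum>i=1..k. of_int ((int (\<beta> i) - int e) - (2 * int k - 3)) *
          disc_coeff 0 k ((\<lambda>i. int (\<beta> i) - int e)(i := (int (\<beta> i) - int e) + 1))) (\<Prod>j=1..k. g $ \<beta> j))"
    proof -
      have "?L (\<beta>(i := Suc (\<beta> i))) * of_int (int (\<beta> i) - ?c)
          = of_int ((int (\<beta> i) - int e) - (2 * int k - 3)) *
            disc_coeff 0 k ((\<lambda>i. int (\<beta> i) - int e)(i := (int (\<beta> i) - int e) + 1))" for \<beta> i
        by (subst mult.commute, intro arg_cong2[where f = "(*)"] arg_cong[where f = of_int] disc_coeff_cong) auto
      thus ?thesis
        by (subst sum.swap) (simp only: smult_sum_left)
    qed
    also have "\<dots> = 0"
      by (simp only: disc_coeff_raising smult_0_left sum.neutral_const)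
    finally show ?thesis .
  qed
  finally show ?thesis .
qed

lemma disc_CT_projective_family:
  assumes "projective_family (2 * int k - 3 + int e) g"
  shows "disc_CT k e (map_coeffs (\<lambda>p. poly p x) g) = disc_CT k e (map_coeffs (\<lambda>p. poly p y) g)"
proof -
  define p where "p = (\<Sum>\<alpha>\<in>compositions k (k * (k - 1) + e * k).
     smult (disc_coeff 0 k (\<lambda>i. int (\<alpha> i) - int e)) (\<Prod>i=1..k. g $ \<alpha> i))"
  have "pderiv p = 0" unfolding p_def by (rule pderiv_disc_CT[OF assms])
  then obtain c where "p = [:c:]" using pderiv_iszero by blast
  moreover have "disc_CT k e (map_coeffs (\<lambda>p. poly p x) g) = poly p x" for x
    by (simp add: disc_CT_def p_def poly_sum poly_prod)
  ultimately show ?thesis by simp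
qed

lemma map_coeffs_poly_mult:
  "map_coeffs (\<lambda>p. poly p (x::rat)) (f * g) = map_coeffs (\<lambda>p. poly p x) f * map_coeffs (\<lambda>p. poly p x) g"
  by (rule map_coeffs_mult) auto

lemma map_coeffs_poly_power:
  "map_coeffs (\<lambda>p. poly p (x::rat)) (f ^ m) = map_coeffs (\<lambda>p. poly p x) f ^ m"
  by (rule map_coeffs_power) auto

lemma map_coeffs_lin: "map_coeffs (\<lambda>p. poly p x) (lin_family a) = 1 - fps_const (a + x) * fps_X"
  by (rule fps_ext) (simp add: lin_family_def)

lemma map_coeffs_geo: "map_coeffs (\<lambda>p. poly p x) (geo_family a) = inverse (1 - fps_const (a + x) * fps_X)"
proof -
  have "map_coeffs (\<lambda>p. poly p x) (lin_family a) * map_coeffs (\<lambda>p. poly p x) (geo_family a) = 1"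
    unfolding map_coeffs_poly_mult[symmetric] lin_geo_family by (rule fps_ext) simp
  thus ?thesis unfolding map_coeffs_lin by (rule fps_inverse_unique[symmetric])
qed

text \<open>Moving s from 0 to -1 replaces each parameter a by a - 1, so 1 - X becomes 1 and the
  pole disappears to infinity. The hypothesis says that the weights 1, 1 and -1 of the factors add
  up to the required one.\<close>

lemma disc_CT_projective:
  assumes "int p + int p' - int q = 2 * int k - 3 + int e"
  shows "disc_CT k e ((1 - fps_const a * fps_X) ^ p * (1 - fps_const b * fps_X) ^ p' * inverse (1 - fps_X) ^ q)
    = disc_CT k e ((1 + fps_const (1 - a) * fps_X) ^ p * (1 + fps_const (1 - b) * fps_X) ^ p')"
proof -
  let ?g = "lin_family a ^ p * lin_family b ^ p' * geo_family 1 ^ q"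
  have "projective_family (int p * 1 + int p' * 1 + int q * (- 1)) ?g"
    by (intro projective_family_mult projective_family_power projective_family_lin projective_family_geo)
  hence "projective_family (2 * int k - 3 + int e) ?g"
    using assms by simp
  from disc_CT_projective_family[OF this, of 0 "- 1"] show ?thesis
    by (simp add: map_coeffs_poly_mult map_coeffs_poly_power map_coeffs_lin map_coeffs_geo
        fps_const_sub[symmetric] algebra_simps del: fps_const_sub)
qed

section \<open>Scaling and inversion\<close>

lemma disc_CT_scale:
  "disc_CT k e (Abs_fps (\<lambda>n. c ^ n * f $ n)) = c ^ (k * (k - 1) + e * k) * disc_CT k e f"
proof -
  have "(\<Prod>i=1..k. c ^ \<alpha> i) = c ^ (k * (k - 1) + e * k)" if "\<alpha> \<in> compositions k (k * (k - 1) + e * k)" for \<alpha>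
    using compositionsD(2)[OF that] by (simp add: power_sum[symmetric])
  thus ?thesis
    by (simp add: disc_CT_def prod.distrib sum_distrib_left mult_ac)
qed

lemma disc_CT_mult_const: "disc_CT k e (fps_const c * f) = c ^ k * disc_CT k e f"
  by (simp add: disc_CT_def prod.distrib sum_distrib_left mult_ac)

lemma nth_one_plus_X_power: "((1 + fps_X) ^ p :: 'a::comm_ring_1 fps) $ n = of_nat (p choose n)"
proof (induction p arbitrary: n)
  case 0
  thus ?case by (cases n) simp_all
next
  case (Suc p)
  have "((1 + fps_X) ^ Suc p :: 'a fps) $ n = (1 + fps_X) ^ p $ n + (fps_X * (1 + fps_X) ^ p) $ n"
    by (simp add: algebra_simps)
  thus ?case using Suc by (cases n) simp_all
qed

text \<open>Inversion matches \<alpha>_i with p - \<alpha>_(k+1-i), leaving the binomials unchanged.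
  By \<open>disc_coeff_inversion\<close> the kernel does the same if p - \<alpha> - e' = 2(k-1) -
  (\<alpha> - e), which is the hypothesis.\<close>

lemma disc_CT_inversion:
  assumes "e + e' + 2 * k = p + 2"
  shows "disc_CT k e ((1 + fps_X) ^ p) = disc_CT k e' ((1 + fps_X) ^ p)"
proof (cases "k = 0")
  case True
  thus ?thesis by (simp add: disc_CT_def)
next
  case False
  \<comment> \<open>Beyond p the binomial coefficients are 0; restricting to \<alpha>_i \<le> p
    keeps the natural subtraction p - \<alpha>_i exact and makes \<open>r\<close> an
    involution.\<close>
  let ?C = "\<lambda>e. {\<alpha>\<in>compositions k (k * (k - 1) + e * k). \<forall>i\<in>{1..k}. \<alpha> i \<le> p}"
  let ?T = "\<lambda>e \<alpha>. disc_coeff 0 k (\<lambda>i. int (\<alpha> i) - int e) * (\<Prod>i=1..k. of_nat (p choose \<alpha> i))"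
  have L: "disc_CT k e ((1 + fps_X) ^ p) = (\<Sum>\<alpha>\<in>?C e. ?T e \<alpha>)" for e
    unfolding disc_CT_def nth_one_plus_X_power
    by (rule sum.mono_neutral_right) (auto simp: not_le intro!: prod_zero)
  define r where "r = (\<lambda>\<alpha>. restrict (\<lambda>i. p - \<alpha> (k + 1 - i)) {1..k})"
  have rr: "r (r \<alpha>) = \<alpha>" if "\<alpha> \<in> ?C e" for \<alpha> e
  proof
    fix i
    show "r (r \<alpha>) i = \<alpha> i"
      using that compositionsD(1)[of \<alpha>] by (auto simp: r_def extensional_def)
  qed
  have rC: "r \<alpha> \<in> ?C e'" if \<alpha>: "\<alpha> \<in> ?C e" and ee: "e + e' + 2 * k = p + 2" for \<alpha> e e'
  proof -
    have "(\<Sum>i=1..k. r \<alpha> i) = (\<Sum>i=1..k. p - \<alpha> i)"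
      unfolding r_def
      by (rule sum.reindex_bij_witness[of _ "\<lambda>i. k + 1 - i" "\<lambda>i. k + 1 - i"]) auto
    hence "int (\<Sum>i=1..k. r \<alpha> i) = (\<Sum>i=1..k. int p - int (\<alpha> i))"
      using \<alpha> by (simp add: of_nat_diff)
    also have "\<dots> = int k * int p - int (k * (k - 1) + e * k)"
    proof -
      have "(\<Sum>i=1..k. \<alpha> i) = k * (k - 1) + e * k" using \<alpha> compositionsD(2) by blast
      thus ?thesis by (simp only: sum_subtractf sum_constant of_nat_sum[symmetric]) simp
    qed
    also have "int p = int e + int e' + 2 * int k - 2" using ee by linarith
    also have "int k * (int e + int e' + 2 * int k - 2) - int (k * (k - 1) + e * k)
        = int (k * (k - 1) + e' * k)"
      unfolding int_degree by (simp add: algebra_simps)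
    finally have "(\<Sum>i=1..k. r \<alpha> i) = k * (k - 1) + e' * k"
      by (simp only: of_nat_eq_iff)
    moreover have "r \<alpha> \<in> extensional {1..k}" by (simp add: r_def)
    ultimately show ?thesis by (auto intro!: compositionsI) (simp add: r_def)
  qed
  have T: "?T e' (r \<alpha>) = ?T e \<alpha>" if \<alpha>: "\<alpha> \<in> ?C e" for \<alpha>
  proof -
    have le: "\<alpha> (Suc k - i) \<le> p" if "1 \<le> i" "i \<le> k" for i
    proof -
      have "Suc k - i \<in> {1..k}" using that by auto
      thus ?thesis using \<alpha> by blast
    qed
    have "(\<Prod>i=1..k. of_nat (p choose r \<alpha> i)) = (\<Prod>i=1..k. of_nat (p choose \<alpha> i) :: rat)"
      by (rule prod.reindex_bij_witness[of _ "\<lambda>i. k + 1 - i" "\<lambda>i. k + 1 - i"])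
        (use \<alpha> in \<open>auto simp: r_def le intro!: binomial_symmetric\<close>)
    moreover have "disc_coeff 0 k (\<lambda>i. int (r \<alpha> i) - int e')
       = disc_coeff 0 k (\<lambda>i. 2 * (int k - 1) - (int (\<alpha> (k + 1 - i)) - int e))"
    proof (rule disc_coeff_cong)
      fix i assume i: "1 \<le> i" "i \<le> k"
      hence "\<alpha> (k + 1 - i) \<le> p" using le by simp
      thus "int (r \<alpha> i) - int e' = 2 * (int k - 1) - (int (\<alpha> (k + 1 - i)) - int e)"
        using i assms by (simp add: r_def of_nat_diff)
    qed
    ultimately show ?thesis by (simp only: disc_coeff_inversion[of 0 k "\<lambda>i. int (\<alpha> i) - int e"])
  qed
  have "(\<Sum>\<alpha>\<in>?C e. ?T e \<alpha>) = (\<Sum>\<alpha>\<in>?C e'. ?T e' \<alpha>)"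
  proof (rule sum.reindex_bij_witness[of _ r r])
    show "r (r \<alpha>) = \<alpha>" "r \<alpha> \<in> ?C e'" "?T e' (r \<alpha>) = ?T e \<alpha>" if "\<alpha> \<in> ?C e" for \<alpha>
      using rr[OF that] rC[OF that assms] T[OF that] by this
    show "r (r \<alpha>) = \<alpha>" "r \<alpha> \<in> ?C e" if "\<alpha> \<in> ?C e'" for \<alpha>
      using rr[OF that] rC[OF that, of e] assms by (simp_all only: add.commute)
  qed
  thus ?thesis by (simp add: L)
qed

section \<open>Removing the smallest variable; positivity\<close>

lemma disc_coeff_1: "disc_coeff b 1 a = of_bool (a 1 = 0)"
proof -
  have "pairs b 1 = {}" by (auto simp: pairs_def)
  hence "disc_coeff b 1 a = of_bool (Poly_Mapping.single (b + 1) (a 1) = 0)"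
    by (simp add: disc_coeff_def inv_disc_def expo_def mls_coeff_1 of_bool_def)
  also have "Poly_Mapping.single (b + 1) (a 1) = 0 \<longleftrightarrow> a 1 = 0"
    by (metis lookup_single_eq lookup_zero single_zero)
  finally show ?thesis .
qed

lemma disc_coeff_last:
  assumes "a (Suc k) = 0"
  shows "disc_coeff b (Suc k) a = disc_coeff b k (\<lambda>i. a i - 2)"
proof -
  have "{k<..Suc k} = {Suc k}" by auto
  thus ?thesis using disc_coeff_split[of k "Suc k" a b] assms by (simp add: disc_coeff_1[simplified])
qed

text \<open>The smallest variable has only nonnegative exponents both in f and in the kernel, so it
  must occur with exponent 0. Setting it to 0 turns its factors into x_i^(-2) for the other
  variables, hence e = 2.\<close>

lemma disc_CT_last:
  assumes "f $ 0 = 1"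
  shows "disc_CT (Suc k) 0 f = disc_CT k 2 f"
proof -
  let ?d = "k * (k - 1) + 2 * k"
  have d: "Suc k * (Suc k - 1) + 0 * Suc k = ?d" by (cases k) simp_all
  let ?C = "{\<alpha>\<in>compositions (Suc k) ?d. \<alpha> (Suc k) = 0}"
  let ?T = "\<lambda>\<alpha>. disc_coeff 0 (Suc k) (\<lambda>i. int (\<alpha> i)) * (\<Prod>i=1..Suc k. f $ \<alpha> i)"
  have "disc_CT (Suc k) 0 f = (\<Sum>\<alpha>\<in>compositions (Suc k) ?d. ?T \<alpha>)"
    by (simp only: disc_CT_def d of_nat_0 diff_0_right)
  also have "\<dots> = (\<Sum>\<alpha>\<in>?C. ?T \<alpha>)"
  proof (rule sum.mono_neutral_right)
    show "\<forall>\<alpha>\<in>compositions (Suc k) ?d - ?C. ?T \<alpha> = 0"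
    proof
      fix \<alpha> assume "\<alpha> \<in> compositions (Suc k) ?d - ?C"
      hence "\<alpha> (Suc k) \<noteq> 0" by auto
      moreover have "{k<..Suc k} = {Suc k}" by auto
      ultimately have "disc_coeff 0 (Suc k) (\<lambda>i. int (\<alpha> i)) = 0"
        using disc_coeff_tail[of 0 "Suc k" "\<lambda>i. int (\<alpha> i)" k] by fastforce
      thus "?T \<alpha> = 0" by simp
    qed
  qed auto
  also have "\<dots> = (\<Sum>\<alpha>\<in>compositions k ?d. disc_coeff 0 k (\<lambda>i. int (\<alpha> i) - int 2) * (\<Prod>i=1..k. f $ \<alpha> i))"
  proof (rule sum.reindex_bij_witness[of _ "\<lambda>\<beta>. \<beta>(Suc k := 0)" "\<lambda>\<alpha>. restrict \<alpha> {1..k}"])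
    fix \<alpha> assume \<alpha>: "\<alpha> \<in> ?C"
    show "restrict \<alpha> {1..k} \<in> compositions k ?d"
      using \<alpha> compositionsD(2)[of \<alpha> "Suc k" ?d] by (intro compositionsI) auto
    show "(restrict \<alpha> {1..k})(Suc k := 0) = \<alpha>"
    proof
      fix i show "((restrict \<alpha> {1..k})(Suc k := 0)) i = \<alpha> i"
        using \<alpha> compositionsD(1)[of \<alpha> "Suc k" ?d] by (auto simp: extensional_def not_le le_Suc_eq)
    qed
    have "disc_coeff 0 k (\<lambda>i. int (restrict \<alpha> {1..k} i) - int 2) = disc_coeff 0 k (\<lambda>i. int (\<alpha> i) - 2)"
      by (rule disc_coeff_cong) auto
    moreover have "disc_coeff 0 (Suc k) (\<lambda>i. int (\<alpha> i)) = disc_coeff 0 k (\<lambda>i. int (\<alpha> i) - 2)"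
      using \<alpha> by (intro disc_coeff_last) simp
    moreover have "(\<Prod>i=1..k. f $ restrict \<alpha> {1..k} i) = (\<Prod>i=1..Suc k. f $ \<alpha> i)"
      using \<alpha> assms by simp
    ultimately show "disc_coeff 0 k (\<lambda>i. int (restrict \<alpha> {1..k} i) - int 2) * (\<Prod>i=1..k. f $ restrict \<alpha> {1..k} i) = ?T \<alpha>"
      by simp
  next
    fix \<beta> assume \<beta>: "\<beta> \<in> compositions k ?d"
    show "restrict (\<beta>(Suc k := 0)) {1..k} = \<beta>"
      using compositionsD(1)[OF \<beta>] by (auto simp: extensional_def fun_eq_iff)
    have "(\<Sum>i=1..k. (\<beta>(Suc k := 0)) i) = (\<Sum>i=1..k. \<beta> i)" by (rule sum.cong) auto
    thus "\<beta>(Suc k := 0) \<in> ?C"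
      using compositionsD[OF \<beta>] by (auto intro!: compositionsI simp: extensional_def)
  qed
  also have "\<dots> = disc_CT k 2 f" by (simp add: disc_CT_def)
  finally show ?thesis .
qed

text \<open>The first term of 1/(x_i - x_j)^2 is x_i^(-2), and i is the smaller index in k - i
  pairs.\<close>

lemma disc_coeff_leading: "disc_coeff b k (\<lambda>i. 2 * (int k - int i)) = 1"
proof (induction k)
  case (Suc k)
  have "disc_coeff b (Suc k) (\<lambda>i. 2 * (int (Suc k) - int i)) = disc_coeff b k (\<lambda>i. 2 * (int (Suc k) - int i) - 2)"
    by (rule disc_coeff_last) simp
  thus ?case using Suc by (simp add: algebra_simps)
qed simp

text \<open>No summand is negative and the staircase of \<open>disc_coeff_leading\<close>
  contributes a positive one; its largest entry is 2(k - 1), whence the range in the second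
  assumption.\<close>

lemma disc_CT_pos:
  assumes "\<And>n. 0 \<le> f $ n" "\<And>n. n \<le> 2 * (k - 1) \<Longrightarrow> 0 < f $ n"
  shows "0 < disc_CT k 0 f"
proof -
  define \<delta> where "\<delta> = restrict (\<lambda>i. 2 * (k - i)) {1..k}"
  have L: "disc_coeff 0 k (\<lambda>i. int (\<delta> i)) = 1"
    using disc_coeff_leading[of 0 k] by (subst disc_coeff_cong[of k _ "\<lambda>i. 2 * (int k - int i)"]) (auto simp: \<delta>_def)
  hence "int (\<Sum>i=1..k. \<delta> i) = int (k * (k - 1))"
    using disc_coeff_homogeneous[of 0 k "\<lambda>i. int (\<delta> i)"] unfolding int_mult_pred by simp
  hence \<delta>: "\<delta> \<in> compositions k (k * (k - 1))"
    by (intro compositionsI) (simp_all only: of_nat_eq_iff, simp add: \<delta>_def)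
  have "(\<Sum>\<alpha>\<in>compositions k (k * (k - 1)). disc_coeff 0 k (\<lambda>i. int (\<alpha> i)) * (\<Prod>i=1..k. f $ \<alpha> i)) > 0"
  proof (rule sum_pos2[OF _ \<delta>])
    show "0 < disc_coeff 0 k (\<lambda>i. int (\<delta> i)) * (\<Prod>i=1..k. f $ \<delta> i)"
      unfolding L by (auto intro!: prod_pos assms(2) simp: \<delta>_def)
    show "0 \<le> disc_coeff 0 k (\<lambda>i. int (\<alpha> i)) * (\<Prod>i=1..k. f $ \<alpha> i)" for \<alpha>
      by (intro mult_nonneg_nonneg disc_coeff_nonneg prod_nonneg) (auto intro: assms(1))
  qed simp
  thus ?thesis by (simp add: disc_CT_def)
qed


subsection \<open>Morris constant terms\<close>

lemma prod_nested_pairs: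
  "(\<Prod>i=b+1..b+k. \<Prod>j=i+1..b+k. g i j) = (\<Prod>(i,j)\<in>pairs b k. g i j)"
proof -
  have "pairs b k = (SIGMA i:{b+1..b+k}. {i+1..b+k})"
    by (auto simp: pairs_def)
  thus ?thesis by (simp add: prod.Sigma)
qed

lemma inverse_nested_pairs:
  fixes b k :: nat
  defines "Q \<equiv> \<Prod>i=b+1..b+k. \<Prod>j=i+1..b+k. (X i - X j :: 'a::comm_ring_1 mls) ^ 2"
  shows "inverse Q = inv_disc b k" "Q * inverse Q = 1"
proof -
  have Q: "Q = (\<Prod>p\<in>pairs b k. (X (fst p) - X (snd p)) ^ 2)"
    unfolding Q_def prod_nested_pairs by (simp add: case_prod_beta)
  have unit: "(X (fst p) - X (snd p)) ^ 2 * inverse ((X (fst p) - X (snd p)) ^ 2) = (1 :: 'a mls)"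
    if "p \<in> pairs b k" for p
    by (rule mls_inverse_power(2), rule X_diff_unit) (use that in \<open>auto simp: pairs_def\<close>)
  have "inverse Q = (\<Prod>p\<in>pairs b k. inverse ((X (fst p) - X (snd p)) ^ 2))"
    unfolding Q by (rule mls_inverse_prod(1)[OF unit])
  also have "\<dots> = inv_disc b k"
    unfolding inv_disc_def
    by (rule prod.cong) (auto simp: pairs_def mls_inverse_power(1)[OF X_diff_unit])
  finally show "inverse Q = inv_disc b k" .
  show "Q * inverse Q = 1"
    unfolding Q by (rule mls_inverse_prod(2)[OF unit])
qed

lemma inverse_prod_X_power:
  "inverse (\<Prod>i=b+1..b+k. X i ^ e :: 'a::comm_ring_1 mls) = mls_monom (- expo b k (\<lambda>_. int e))"
proof -
  have "(\<Prod>i=b+1..b+k. X i ^ e :: 'a mls) = mls_monom (expo b k (\<lambda>_. int e))"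
    unfolding X_power mls_monom_prod expo_def
    by (rule arg_cong[where f = mls_monom], rule sum.reindex_bij_witness[of _ "\<lambda>i. b + i" "\<lambda>i. i - b"]) auto
  thus ?thesis by (simp add: inverse_mls_monom)
qed

lemma one_minus_X_power_unit: "(1 - X i) ^ m * inverse ((1 - X i) ^ m) = (1 :: 'a::comm_ring_1 mls)"
  by (rule mls_inverse_power(2)[OF one_minus_X_unit])

lemma CT_M: "CT (M m (Suc e) k2 2) = disc_CT m e (inverse (1 - fps_X) ^ k2)"
proof -
  let ?A = "\<Prod>i=1..m. X i ^ e :: rat mls" and ?B = "\<Prod>i=1..m. (1 - X i) ^ k2 :: rat mls"
    and ?Q = "\<Prod>i=1..m. \<Prod>j=i+1..m. (X i - X j) ^ 2 :: rat mls"
  have A: "inverse ?A = mls_monom (- expo 0 m (\<lambda>_. int e))" "?A * inverse ?A = 1"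
    using inverse_prod_X_power[where b = 0 and k = m and e = e and ?'a = rat] mls_inverse_prod(2)[of "{1..m}" "\<lambda>i. X i ^ e :: rat mls"]
    by (auto simp: mls_inverse_power(2)[OF X_unit])
  have B: "inverse ?B = (\<Prod>i=1..m. fps_at (0 + i) (inverse (1 - fps_X) ^ k2))" "?B * inverse ?B = 1"
    using mls_inverse_prod[of "{1..m}" "\<lambda>i. (1 - X i) ^ k2 :: rat mls", OF one_minus_X_power_unit]
    unfolding fps_at_inverse_one_minus_X by simp_all
  have Q: "inverse ?Q = inv_disc 0 m" "?Q * inverse ?Q = 1"
    using inverse_nested_pairs[of 0 m] by simp_all
  have "M m (Suc e) k2 2 = inverse (?A * ?B * ?Q)"
    by (simp add: M_def divide_mls_def)
  also have "\<dots> = inverse ?A * inverse ?B * inverse ?Q"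
    by (simp only: mls_inverse_mult(1)[OF mls_inverse_mult(2)[OF A(2) B(2)] Q(2)]
        mls_inverse_mult(1)[OF A(2) B(2)])
  finally show ?thesis
    unfolding A B Q by (simp only: CT_fps_at)
qed

subsection \<open>Translation to the simple pole\<close>

lemma mls_theta_in: "mls_in A f \<Longrightarrow> i \<notin> A \<Longrightarrow> mls_theta i f = 0"
proof (rule mls_eqI)
  fix a assume "mls_in A f" "i \<notin> A"
  hence "mls_coeff f a = 0 \<or> Poly_Mapping.lookup a i = 0"
    using mls_inD by blast
  thus "mls_coeff (mls_theta i f) a = mls_coeff 0 a" by auto
qed

lemma power_series_in_vector_field:
  assumes "power_series_in A f"
  shows "power_series_in A (vector_field (- 1) A f)"
  unfolding power_series_in_def
proof (intro allI impI)
  fix c assume "mls_coeff (vector_field (- 1) A f) c \<noteq> 0"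
  then obtain i where i: "i \<in> A" "of_int (Poly_Mapping.lookup c i - (- 1)) *
      mls_coeff f (c - Poly_Mapping.single i (- 1)) \<noteq> 0"
    unfolding mls_coeff_vector_field by (rule sum.not_neutral_contains_not_neutral)
  let ?c' = "c - Poly_Mapping.single i (- 1)"
  have i': "Poly_Mapping.lookup c i \<noteq> - 1" "mls_coeff f ?c' \<noteq> 0"
    using i(2) by auto
  have k: "Poly_Mapping.keys ?c' \<subseteq> A" and nn: "\<And>j. 0 \<le> Poly_Mapping.lookup ?c' j"
    using assms i'(2) by (auto simp: power_series_in_def)
  have "Poly_Mapping.keys c \<subseteq> A"
  proof
    fix j assume "j \<in> Poly_Mapping.keys c"
    thus "j \<in> A"
      using k i(1) by (cases "j = i") (auto simp: in_keys_iff subset_iff lookup_minus lookup_single)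
  qed
  moreover have "0 \<le> Poly_Mapping.lookup c j" for j
    using nn[of j] i'(1) by (cases "j = i") (auto simp: lookup_minus lookup_single)
  ultimately show "Poly_Mapping.keys c \<subseteq> A \<and> (\<forall>j. 0 \<le> Poly_Mapping.lookup c j)" by blast
qed

lemma vector_field_insert:
  assumes "finite A" "i \<notin> A"
  shows "vector_field u (insert i A) f = mls_monom (Poly_Mapping.single i u) * mls_theta i f + vector_field u A f"
  using assms by (simp add: vector_field_def)

definition pole_part :: "nat \<Rightarrow> rat mls" where
  "pole_part k = (\<Prod>i\<in>{1<..1+k}. inverse (X i - X (Suc (Suc k))))"

lemma power_series_in_T_pow:
  assumes "power_series_in {1<..1+k} F"
  shows "power_series_in {1<..1+k} ((vector_field (- 1) {1<..1+k} ^^ i) F)"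
proof (induction i)
  case 0
  show ?case using assms by simp
next
  case (Suc i)
  show ?case using power_series_in_vector_field[OF Suc] by simp
qed

text \<open>For \<open>i = 0\<close> this is the coefficient of \<open>z\<^sup>j\<close> in the integrand for \<open>h\<close> without \<open>(1 - z)\<^bsup>-2\<^esup>\<close>.
  Integration by parts trades derivatives of \<open>F\<close> for powers of \<open>z\<close>, until the pole at \<open>z\<close> is
  replaced by a pole at 0.\<close>

definition taylor_term :: "nat \<Rightarrow> rat mls \<Rightarrow> nat \<Rightarrow> nat \<Rightarrow> rat" where
  "taylor_term k F i j = mls_coeff (mls_monom (expo 1 k (\<lambda>_. 1)) * ((vector_field (- 1) {1<..1+k} ^^ i) F * inv_disc 1 k * pole_part k))
     (Poly_Mapping.single (Suc (Suc k)) (int j))"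

text \<open>The translation field in all variables, z included, annihilates every difference, hence
  both the kernel and the simple poles. On this product it therefore differentiates only F, while in
  the coefficients considered it acts as d/dz.\<close>

lemma taylor_term_Suc:
  assumes "power_series_in {1<..1+k} F"
  shows "taylor_term k F (Suc i) j = of_nat (Suc j) * taylor_term k F i (Suc j)"
proof -
  let ?S = "vector_field (- 1) (insert (Suc (Suc k)) {1<..1+k}) :: rat mls \<Rightarrow> rat mls"
  let ?E = "expo 1 k (\<lambda>_. 1)"
  let ?c = "Poly_Mapping.single (Suc (Suc k)) (int j)"
  let ?P = "(vector_field (- 1) {1<..1+k} ^^ i) F"
  have der: "derivation ?S" by (rule derivation_vector_field)
  have SX: "?S (X a - X b) = 0 * (X a - X b)" if "a \<in> insert (Suc (Suc k)) {1<..1+k}" "b \<in> insert (Suc (Suc k)) {1<..1+k}" for a b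
    unfolding derivation_diff[OF der] vector_field_X[OF finite.insertI[OF finite_greaterThanAtMost]]
    using that by simp
  have "?S (inv_disc 1 k) = - 2 * (\<Sum>(i,j)\<in>pairs 1 k. 0) * inv_disc 1 k"
    by (rule derivation_inv_disc[OF der SX]) (auto simp: pairs_def)
  hence SD: "?S (inv_disc 1 k) = 0" by simp
  have "?S (pole_part k) = (\<Sum>i\<in>{1<..1+k}. - 0) * pole_part k"
    unfolding pole_part_def
    by (rule derivation_prod_log[OF der], rule derivation_inverse[OF der X_diff_unit SX]) auto
  hence SB: "?S (pole_part k) = 0" by simp
  have "mls_theta (Suc (Suc k)) ?P = 0"
    by (rule mls_theta_in[OF power_series_in_imp_in[OF power_series_in_T_pow[OF assms]]]) simp
  hence SP: "?S ?P = (vector_field (- 1) {1<..1+k} ^^ Suc i) F"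
    by (simp add: vector_field_insert)
  have S: "?S (?P * inv_disc 1 k * pole_part k) = (vector_field (- 1) {1<..1+k} ^^ Suc i) F * inv_disc 1 k * pole_part k"
    by (simp only: derivationD(2)[OF der] SD SB SP mult_zero_right add_0_right)
  have "taylor_term k F (Suc i) j = mls_coeff (?S (?P * inv_disc 1 k * pole_part k)) (?c - ?E)"
    unfolding taylor_term_def mls_coeff_monom_mult S ..
  also have "\<dots> = (\<Sum>l\<in>insert (Suc (Suc k)) {1<..1+k}. of_int (Poly_Mapping.lookup (?c - ?E) l - (- 1)) *
     mls_coeff (?P * inv_disc 1 k * pole_part k) (?c - ?E - Poly_Mapping.single l (- 1)))"
    by (rule mls_coeff_vector_field)
  \<comment> \<open>Every variable other than z has exponent -1 at this index, and d/dx_l of a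
    Laurent series has no term with x_l^(-1).\<close>
  also have "\<dots> = (\<Sum>l\<in>{Suc (Suc k)}. of_int (Poly_Mapping.lookup (?c - ?E) l - (- 1)) *
     mls_coeff (?P * inv_disc 1 k * pole_part k) (?c - ?E - Poly_Mapping.single l (- 1)))"
    by (rule sum.mono_neutral_right) (auto simp: lookup_minus lookup_expo lookup_single)
  also have "\<dots> = of_int (int j + 1) *
     mls_coeff (?P * inv_disc 1 k * pole_part k) (?c - ?E - Poly_Mapping.single (Suc (Suc k)) (- 1))"
    by (simp add: lookup_minus lookup_expo lookup_single)
  also have "?c - ?E - Poly_Mapping.single (Suc (Suc k)) (- 1) = Poly_Mapping.single (Suc (Suc k)) (int (Suc j)) - ?E"
    by (simp add: single_add single_uminus algebra_simps)
  finally show ?thesis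
    unfolding taylor_term_def mls_coeff_monom_mult by (simp add: add.commute)
qed

lemma taylor_term_fact:
  assumes "power_series_in {1<..1+k} F"
  shows "fact j * taylor_term k F i j = fact (i + j) * taylor_term k F 0 (i + j)"
proof (induction i arbitrary: j)
  case (Suc i)
  have "fact j * taylor_term k F (Suc i) j = fact (Suc j) * taylor_term k F i (Suc j)"
    unfolding taylor_term_Suc[OF assms] by simp
  also have "\<dots> = fact (i + Suc j) * taylor_term k F 0 (i + Suc j)"
    by (rule Suc.IH)
  finally show ?case by (simp only: add_Suc_right add_Suc)
qed simp

text \<open>The monomial \<open>expo 1 k\<close> supplies one x_j for each pole, and x_j/(x_j - z)
  has value 1 at z = 0. Taking the face of lowest order in z expresses this evaluation.\<close>

lemma taylor_term_pole:
  assumes "power_series_in {1<..1+k} F"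
  shows "taylor_term k F i 0 = CT ((vector_field (- 1) {1<..1+k} ^^ i) F * inv_disc 1 k)"
proof -
  let ?P = "(vector_field (- 1) {1<..1+k} ^^ i) F * inv_disc 1 k"
  let ?g = "\<lambda>j. X j * inverse (X j - X (Suc (Suc k))) :: rat mls"
  have inP: "mls_in {1<..1+k} ?P"
    by (intro mls_in_mult power_series_in_imp_in power_series_in_T_pow[OF assms] mls_in_inv_disc)
  have tail0: "tail (Suc (Suc k)) a = 0" if "mls_coeff ?P a \<noteq> 0" for a
  proof -
    have "Poly_Mapping.keys a \<subseteq> {1<..1+k}"
      using inP that unfolding mls_in_def by blast
    thus ?thesis by (intro tail_keys_below) fastforce
  qed
  have X0: "mls_face (Suc (Suc k)) 0 (X j) = (X j :: rat mls)" "tail_ge (Suc (Suc k)) 0 (X j :: rat mls)" if "j \<in> {1<..1+k}" for j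
    using that by (auto intro!: mls_face_id simp: tail_ge_def X_def mls_coeff_monom tail_single split: if_splits)
  have I0: "tail_ge (Suc (Suc k)) 0 (inverse (X j - X (Suc (Suc k))) :: rat mls)" if "j \<in> {1<..1+k}" for j
    using tail_ge_inverse_X_diff[of j "Suc (Suc k)" "Suc (Suc k)"] that by simp
  have g: "tail_ge (Suc (Suc k)) 0 (?g j)" "mls_face (Suc (Suc k)) 0 (?g j) = 1" if "j \<in> {1<..1+k}" for j
  proof -
    show "tail_ge (Suc (Suc k)) 0 (?g j)" using tail_ge_mult[OF X0(2) I0, OF that that] by simp
    have "mls_face (Suc (Suc k)) 0 (?g j) = X j * mls_monom (- Poly_Mapping.single j 1)"
      using mls_face_mult[OF X0(2) I0, OF that that] that X0(1)[OF that]
      by (simp add: mls_face_inverse_X_diff_cross)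
    thus "mls_face (Suc (Suc k)) 0 (?g j) = 1" by (simp add: X_def mls_monom_mult)
  qed
  have tg: "tail_ge (Suc (Suc k)) 0 (\<Prod>j\<in>{1<..1+k}. ?g j)" "mls_face (Suc (Suc k)) 0 (\<Prod>j\<in>{1<..1+k}. ?g j) = 1"
    using tail_ge_prod[of "{1<..1+k}" "Suc (Suc k)" "\<lambda>_. 0" ?g] mls_face_prod[of "{1<..1+k}" "Suc (Suc k)" "\<lambda>_. 0" ?g] g
    by simp_all
  have "(\<Prod>j\<in>{1<..1+k}. X j) = (mls_monom (expo 1 k (\<lambda>_. 1)) :: rat mls)"
    by (rule prod_X)
  hence "taylor_term k F i 0 = mls_coeff (?P * (\<Prod>j\<in>{1<..1+k}. ?g j)) 0"
    by (simp add: taylor_term_def pole_part_def prod.distrib mult_ac)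
  also have "\<dots> = mls_coeff (mls_face (Suc (Suc k)) (0 + 0) (?P * (\<Prod>j\<in>{1<..1+k}. ?g j))) 0"
    by (simp add: mls_coeff_face)
  also have "\<dots> = mls_coeff (mls_face (Suc (Suc k)) 0 ?P * 1) 0"
  proof -
    have "tail_ge (Suc (Suc k)) 0 ?P" using tail0 by (metis order_refl tail_ge_def)
    thus ?thesis by (simp only: mls_face_mult[OF _ tg(1)] tg(2))
  qed
  also have "mls_face (Suc (Suc k)) 0 ?P = ?P"
    by (rule mls_face_id) (rule tail0)
  finally show ?thesis by (simp add: CT_def)
qed

lemma fps_deriv_prod_set: "fps_deriv (prod f A) = (\<Sum>i\<in>A. prod f (A - {i}) * fps_deriv (f i))"
  for f :: "'b \<Rightarrow> 'a::comm_ring_1 fps"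
proof (induction A rule: infinite_finite_induct)
  case (insert a A)
  have "prod f (insert a A - {i}) = f a * prod f (A - {i})" if "i \<in> A" for i
  proof -
    have "insert a A - {i} = insert a (A - {i})" using insert.hyps that by auto
    thus ?thesis using insert.hyps by simp
  qed
  thus ?case using insert by (simp add: sum_distrib_left mult_ac add.commute cong: sum.cong)
qed simp_all

lemma fps_prod_nth_0: "prod f A $ 0 = (\<Prod>i\<in>A. f i $ 0)"
  for f :: "'b \<Rightarrow> 'a::comm_ring_1 fps"
  by (induction A rule: infinite_finite_induct) simp_all

text \<open>The hypotheses describe the expansion f(z + w) = \<Sum>c_n(z) w^n. Applying the
  translation field j times to \<Prod>f(x_i) is the j-th z-derivative at 0 of the product of
  translates \<Prod>f(z + x_i).\<close>

lemma mls_coeff_taylor: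
  assumes c0: "\<And>n. c n $ 0 = f $ n" and c': "\<And>n. fps_deriv (c n) = of_nat (Suc n) * c (Suc n)"
  shows "mls_coeff ((vector_field (- 1) {b<..b+k} ^^ j) (\<Prod>i=1..k. fps_at (b + i) f :: rat mls)) (expo b k (\<lambda>i. int (\<alpha> i)))
    = fact j * (\<Prod>i=1..k. c (\<alpha> i)) $ j"
proof (induction j arbitrary: \<alpha>)
  case 0
  have "(\<Prod>i=1..k. c (\<alpha> i)) $ 0 = (\<Prod>i=1..k. f $ \<alpha> i)"
    by (simp add: fps_prod_nth_0 c0)
  thus ?case using mls_coeff_prod_fps_at[of b "\<lambda>_. f" k \<alpha>] by simp
next
  case (Suc j)
  let ?G = "(vector_field (- 1) {b<..b+k} ^^ j) (\<Prod>i=1..k. fps_at (b + i) f :: rat mls)"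
  have upd: "expo b k (\<lambda>i. int (\<alpha> i)) - Poly_Mapping.single x (- 1)
      = expo b k (\<lambda>l. int ((\<alpha>(x - b := Suc (\<alpha> (x - b)))) l))" if "x \<in> {b<..b+k}" for x
    by (rule poly_mapping_eqI) (use that in \<open>auto simp: lookup_minus lookup_expo lookup_single when_def\<close>)
  have "mls_coeff (vector_field (- 1) {b<..b+k} ?G) (expo b k (\<lambda>i. int (\<alpha> i)))
     = (\<Sum>l\<in>{b<..b+k}. of_int (Poly_Mapping.lookup (expo b k (\<lambda>i. int (\<alpha> i))) l - (- 1)) *
         mls_coeff ?G (expo b k (\<lambda>i. int (\<alpha> i)) - Poly_Mapping.single l (- 1)))"
    by (rule mls_coeff_vector_field)
  also have "\<dots> = (\<Sum>i=1..k. of_nat (Suc (\<alpha> i)) * mls_coeff ?G (expo b k (\<lambda>l. int ((\<alpha>(i := Suc (\<alpha> i))) l))))"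
    by (rule sum.reindex_bij_witness[of _ "\<lambda>i. b + i" "\<lambda>l. l - b"])
      (auto simp: lookup_expo upd algebra_simps simp del: fun_upd_apply)
  also have "\<dots> = (\<Sum>i=1..k. fact j * (of_nat (Suc (\<alpha> i)) * (\<Prod>l=1..k. c ((\<alpha>(i := Suc (\<alpha> i))) l))) $ j)"
    unfolding Suc.IH by (intro sum.cong refl) (simp add: fps_of_nat[symmetric] del: of_nat_Suc)
  also have "\<dots> = fact j * (\<Sum>i=1..k. (\<Prod>l\<in>{1..k} - {i}. c (\<alpha> l)) * fps_deriv (c (\<alpha> i))) $ j"
  proof -
    have "of_nat (Suc (\<alpha> i)) * (\<Prod>l=1..k. c ((\<alpha>(i := Suc (\<alpha> i))) l))
      = (\<Prod>l\<in>{1..k} - {i}. c (\<alpha> l)) * fps_deriv (c (\<alpha> i))" if "i \<in> {1..k}" for i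
    proof -
      have "(\<Prod>l=1..k. c ((\<alpha>(i := Suc (\<alpha> i))) l)) = c (Suc (\<alpha> i)) * (\<Prod>l\<in>{1..k} - {i}. c ((\<alpha>(i := Suc (\<alpha> i))) l))"
        using that by (subst prod.remove[of _ i]) auto
      also have "(\<Prod>l\<in>{1..k} - {i}. c ((\<alpha>(i := Suc (\<alpha> i))) l)) = (\<Prod>l\<in>{1..k} - {i}. c (\<alpha> l))"
        by (rule prod.cong) auto
      finally show ?thesis by (simp only: c' mult_ac)
    qed
    thus ?thesis
      unfolding fps_sum_nth sum_distrib_left by (intro sum.cong refl) (simp only:)
  qed
  also have "\<dots> = fact j * fps_deriv (\<Prod>i=1..k. c (\<alpha> i)) $ j"
    unfolding fps_deriv_prod_set ..
  also have "\<dots> = fact (Suc j) * (\<Prod>i=1..k. c (\<alpha> i)) $ Suc j"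
    by (simp add: algebra_simps)
  finally show ?case by simp
qed


subsection \<open>The generating function of h\<close>

text \<open>The Taylor expansion at \<open>z\<close> of \<open>y\<^sup>k (1 - y)\<^bsup>-3\<^esup>\<close>, in powers of \<open>w = y - z\<close>.\<close>

definition taylor_fps :: "nat \<Rightarrow> rat fps fps" where
  "taylor_fps k = (fps_const fps_X + fps_X) ^ k * Abs_fps (\<lambda>n. inverse (1 - fps_X) ^ Suc n) ^ 3"

lemma map_coeffs_fps_deriv_mult:
  assumes "map_coeffs fps_deriv f = fps_deriv f" "map_coeffs fps_deriv g = fps_deriv g"
  shows "map_coeffs fps_deriv (f * g) = fps_deriv (f * g :: 'a::comm_ring_1 fps fps)"
proof -
  have "map_coeffs fps_deriv (f * g) = map_coeffs fps_deriv f * g + f * map_coeffs fps_deriv g"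
    by (rule map_coeffs_derivation) simp_all
  thus ?thesis using assms by simp
qed

lemma map_coeffs_fps_deriv_power:
  assumes "map_coeffs fps_deriv f = fps_deriv f"
  shows "map_coeffs fps_deriv (f ^ m) = fps_deriv (f ^ m :: 'a::comm_ring_1 fps fps)"
proof (induction m)
  case 0
  show ?case by (rule fps_ext) simp
next
  case (Suc m)
  thus ?case using map_coeffs_fps_deriv_mult[OF assms] by simp
qed

lemma fps_deriv_inverse_one_minus_X:
  "fps_deriv (inverse (1 - fps_X) :: rat fps) = inverse (1 - fps_X) ^ 2"
  using fps_inverse_deriv[of "1 - fps_X :: rat fps"] by simp

text \<open>A function of z + w has the same derivative in z and in w; the property is checked on
  the two building blocks and passes to products.\<close>

lemma fps_deriv_taylor_fps: "fps_deriv (taylor_fps k $ n) = of_nat (Suc n) * taylor_fps k $ Suc n"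
proof -
  have 1: "map_coeffs fps_deriv (fps_const fps_X + fps_X) = fps_deriv (fps_const fps_X + fps_X :: rat fps fps)"
  proof (rule fps_ext)
    show "map_coeffs fps_deriv (fps_const fps_X + fps_X) $ n = fps_deriv (fps_const fps_X + fps_X :: rat fps fps) $ n" for n
      by (cases n) (auto simp: fps_X_nth)
  qed
  have "fps_deriv (inverse (1 - fps_X) ^ Suc n) = of_nat (Suc n) * inverse (1 - fps_X :: rat fps) ^ Suc (Suc n)" for n
    unfolding fps_deriv_power' fps_deriv_inverse_one_minus_X by (simp add: power2_eq_square mult_ac)
  hence 2: "map_coeffs fps_deriv (Abs_fps (\<lambda>n. inverse (1 - fps_X) ^ Suc n))
      = fps_deriv (Abs_fps (\<lambda>n. inverse (1 - fps_X :: rat fps) ^ Suc n))"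
    by (intro fps_ext) (simp del: power_Suc of_nat_Suc)
  have "map_coeffs fps_deriv (taylor_fps k) = fps_deriv (taylor_fps k)"
    unfolding taylor_fps_def
    by (intro map_coeffs_fps_deriv_mult map_coeffs_fps_deriv_power 1 2)
  hence "map_coeffs fps_deriv (taylor_fps k) $ n = fps_deriv (taylor_fps k) $ n" by simp
  thus ?thesis by simp
qed

lemma taylor_fps_nth_0: "taylor_fps k $ n $ 0 = (fps_X ^ k * inverse (1 - fps_X) ^ 3) $ n"
proof -
  let ?\<phi> = "\<lambda>f :: rat fps. f $ 0"
  have hom: "?\<phi> (x + y) = ?\<phi> x + ?\<phi> y" "?\<phi> (x * y) = ?\<phi> x * ?\<phi> y" "?\<phi> 1 = 1" for x y
    by simp_all
  have 1: "map_coeffs ?\<phi> (fps_const fps_X + fps_X) = fps_X"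
    by (rule fps_ext) (auto simp: fps_X_def)
  have 2: "map_coeffs ?\<phi> (Abs_fps (\<lambda>n. inverse (1 - fps_X) ^ Suc n)) = inverse (1 - fps_X)"
    unfolding fps_inverse_gp'[symmetric] fps_inverse_idempotent
    by (rule fps_ext) (simp add: fps_power_zeroth)
  have "map_coeffs ?\<phi> (taylor_fps k) = fps_X ^ k * inverse (1 - fps_X) ^ 3"
    unfolding taylor_fps_def
    by (simp only: map_coeffs_mult[of ?\<phi>, OF hom(1,2)] map_coeffs_power[of ?\<phi>, OF hom] 1 2)
  thus ?thesis by (metis map_coeffs_nth)
qed

text \<open>This is (z + (1 - z)X)^k (1 - X)^(-3) with coefficients in the polynomials in z: what
  remains of \<open>taylor_fps\<close> after the substitution w = (1 - z)X.\<close>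

definition scaled_fps :: "nat \<Rightarrow> rat poly fps" where
  "scaled_fps k = (fps_const [:0, 1:] + fps_const [:1, - 1:] * fps_X) ^ k * Abs_fps (\<lambda>_. 1) ^ 3"

text \<open>Since 1 - z - w = (1 - z)(1 - X), the triple pole accounts for three powers of 1 - z,
  and the coefficient of w^n for n more.\<close>

lemma taylor_fps_scaled: "(1 - fps_X) ^ (n + 3) * taylor_fps k $ n = fps_of_poly (scaled_fps k $ n)"
proof -
  let ?v = "1 - fps_X :: rat fps"
  let ?s = "fps_const ?v * fps_X"
  let ?U = "Abs_fps (\<lambda>n. inverse ?v ^ Suc n)"
  have v: "?v * inverse ?v = 1" by (rule inverse_mult_eq_1') simp
  have s0: "?s $ 0 = 0" by simp
  have "?v * (?v ^ n * inverse ?v ^ Suc n) = 1" for n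
  proof -
    have "?v * (?v ^ n * inverse ?v ^ Suc n) = (?v * inverse ?v) ^ Suc n"
      by (simp only: power_mult_distrib power_Suc mult_ac)
    thus ?thesis by (simp only: v power_one)
  qed
  hence U: "fps_const ?v * (?U oo ?s) = Abs_fps (\<lambda>_. 1)"
    unfolding fps_compose_linear by (intro fps_ext) simp
  have L: "(fps_const fps_X + fps_X) oo ?s = fps_const fps_X + ?s"
    by (simp add: fps_compose_add_distrib fps_X_fps_compose_startby0[OF s0])
  have "fps_const (?v ^ 3) * (taylor_fps k oo ?s)
      = ((fps_const fps_X + fps_X) oo ?s) ^ k * (fps_const ?v * (?U oo ?s)) ^ 3"
    unfolding taylor_fps_def fps_compose_mult_distrib[OF s0] fps_compose_power[OF s0, symmetric]
    by (simp add: power_mult_distrib fps_const_power mult_ac)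
  also have "\<dots> = (fps_const fps_X + ?s) ^ k * Abs_fps (\<lambda>_. 1) ^ 3"
    by (simp only: L U)
  also have "\<dots> = map_coeffs fps_of_poly (scaled_fps k)"
  proof -
    note hom = fps_of_poly_add fps_of_poly_mult fps_of_poly_1
    have "map_coeffs fps_of_poly (fps_const [:0, 1:] + fps_const [:1, - 1:] * fps_X) = fps_const fps_X + ?s"
    proof (rule fps_ext)
      have "fps_of_poly [:1, - 1 :: rat:] = 1 - fps_X"
        unfolding fps_of_poly_linear' by simp
      thus "map_coeffs fps_of_poly (fps_const [:0, 1:] + fps_const [:1, - 1:] * fps_X) $ n
          = (fps_const fps_X + ?s) $ n" for n
        by (auto simp: fps_X_nth simp del: mult_pCons_left)
    qed
    moreover have "map_coeffs fps_of_poly (Abs_fps (\<lambda>_. 1 :: rat poly)) = Abs_fps (\<lambda>_. 1)"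
      by (rule fps_ext) simp
    ultimately show ?thesis
      unfolding scaled_fps_def
      by (simp only: map_coeffs_mult[of fps_of_poly, OF hom(1,2)] map_coeffs_power[of fps_of_poly, OF hom])
  qed
  finally have "(fps_const (?v ^ 3) * (taylor_fps k oo ?s)) $ n = map_coeffs fps_of_poly (scaled_fps k) $ n"
    by simp
  thus ?thesis
    unfolding fps_compose_linear by (simp add: power_add mult_ac)
qed

definition numerator :: "nat \<Rightarrow> rat poly" where
  "numerator k = (\<Sum>\<alpha>\<in>compositions k (k * (k - 1)). smult (disc_coeff 0 k (\<lambda>i. int (\<alpha> i))) (\<Prod>i=1..k. scaled_fps k $ \<alpha> i))"

lemma poly_numerator:
  "poly (numerator k) z = disc_CT k 0 ((fps_const z + fps_const (1 - z) * fps_X) ^ k * inverse (1 - fps_X) ^ 3)"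
proof -
  let ?\<phi> = "\<lambda>p. poly p z"
  have 1: "map_coeffs ?\<phi> (fps_const [:0, 1:] + fps_const [:1, - 1:] * fps_X) = fps_const z + fps_const (1 - z) * fps_X"
    by (rule fps_ext) (simp add: fps_X_def)
  have 2: "map_coeffs ?\<phi> (Abs_fps (\<lambda>_. 1)) = inverse (1 - fps_X)"
    unfolding fps_inverse_gp'[symmetric] fps_inverse_idempotent by (rule fps_ext) simp
  have "map_coeffs ?\<phi> (scaled_fps k) = (fps_const z + fps_const (1 - z) * fps_X) ^ k * inverse (1 - fps_X) ^ 3"
    by (simp only: scaled_fps_def map_coeffs_poly_mult map_coeffs_poly_power 1 2)
  hence "disc_CT k 0 ((fps_const z + fps_const (1 - z) * fps_X) ^ k * inverse (1 - fps_X) ^ 3)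
      = disc_CT k 0 (map_coeffs ?\<phi> (scaled_fps k))"
    by simp
  thus ?thesis by (simp add: numerator_def disc_CT_def poly_sum poly_prod)
qed

definition taylor_series :: "nat \<Rightarrow> rat fps" where
  "taylor_series k = (\<Sum>\<alpha>\<in>compositions k (k * (k - 1)). fps_const (disc_coeff 0 k (\<lambda>i. int (\<alpha> i))) * (\<Prod>i=1..k. taylor_fps k $ \<alpha> i))"

text \<open>Each variable uses \<alpha>_i + 3 powers of 1 - z, and the \<alpha>_i add up to k(k-1)
  whichever composition is taken, so one power clears all denominators.\<close>

lemma taylor_series_numerator: "(1 - fps_X) ^ (k * (k - 1) + 3 * k) * taylor_series k = fps_of_poly (numerator k)"
proof -
  have "(1 - fps_X) ^ (k * (k - 1) + 3 * k) * (\<Prod>i=1..k. taylor_fps k $ \<alpha> i) = fps_of_poly (\<Prod>i=1..k. scaled_fps k $ \<alpha> i)"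
    if "\<alpha> \<in> compositions k (k * (k - 1))" for \<alpha>
  proof -
    have "(\<Sum>i=1..k. \<alpha> i + 3) = k * (k - 1) + 3 * k"
      using compositionsD(2)[OF that] by (simp add: sum.distrib)
    hence "(1 - fps_X :: rat fps) ^ (k * (k - 1) + 3 * k) = (\<Prod>i=1..k. (1 - fps_X) ^ (\<alpha> i + 3))"
      by (metis power_sum)
    thus ?thesis
      by (simp only: prod.distrib[symmetric] taylor_fps_scaled fps_of_poly_prod)
  qed
  hence "(1 - fps_X) ^ (k * (k - 1) + 3 * k) * (fps_const c * (\<Prod>i=1..k. taylor_fps k $ \<alpha> i))
      = fps_of_poly (smult c (\<Prod>i=1..k. scaled_fps k $ \<alpha> i))" if "\<alpha> \<in> compositions k (k * (k - 1))" for \<alpha> c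
    using that by (simp add: fps_of_poly_smult mult.left_commute)
  thus ?thesis
    by (simp add: taylor_series_def numerator_def sum_distrib_left fps_of_poly_sum)
qed

definition regular_part :: "nat \<Rightarrow> rat mls" where
  "regular_part k = (\<Prod>i=1..k. fps_at (1 + i) (fps_X ^ k * inverse (1 - fps_X) ^ 3))"

lemma power_series_in_regular_part: "power_series_in {1<..1+k} (regular_part k)"
  unfolding regular_part_def by (rule power_series_in_prod, rule power_series_in_fps_at) auto

lemma taylor_series_nth: "taylor_term k (regular_part k) 0 j = taylor_series k $ j"
proof -
  let ?T = "vector_field (- 1) {1<..1+k} :: rat mls \<Rightarrow> rat mls"
  let ?c = "taylor_fps k"
  note F = power_series_in_regular_part[of k]
  have "expo 1 k (\<lambda>_. int 0) = 0" by (simp add: expo_def)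
  hence "CT ((?T ^^ j) (regular_part k) * inv_disc 1 k)
     = (\<Sum>\<alpha>\<in>compositions k (k * (k - 1)). mls_coeff ((?T ^^ j) (regular_part k)) (expo 1 k (\<lambda>i. int (\<alpha> i)))
         * disc_coeff 0 k (\<lambda>i. int (\<alpha> i)))"
    using CT_power_series[OF power_series_in_T_pow[OF F, of j], of 0] by simp
  also have "\<dots> = (\<Sum>\<alpha>\<in>compositions k (k * (k - 1)). fact j * (fps_const (disc_coeff 0 k (\<lambda>i. int (\<alpha> i))) * (\<Prod>i=1..k. ?c $ \<alpha> i)) $ j)"
  proof (rule sum.cong[OF refl])
    fix \<alpha>
    have "mls_coeff ((?T ^^ j) (regular_part k)) (expo 1 k (\<lambda>i. int (\<alpha> i))) = fact j * (\<Prod>i=1..k. ?c $ \<alpha> i) $ j"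
      unfolding regular_part_def by (rule mls_coeff_taylor[OF taylor_fps_nth_0 fps_deriv_taylor_fps])
    thus "mls_coeff ((?T ^^ j) (regular_part k)) (expo 1 k (\<lambda>i. int (\<alpha> i))) * disc_coeff 0 k (\<lambda>i. int (\<alpha> i))
       = fact j * (fps_const (disc_coeff 0 k (\<lambda>i. int (\<alpha> i))) * (\<Prod>i=1..k. ?c $ \<alpha> i)) $ j"
      by simp
  qed
  also have "\<dots> = fact j * taylor_series k $ j"
    by (simp only: taylor_series_def fps_sum_nth sum_distrib_left)
  also have "CT ((?T ^^ j) (regular_part k) * inv_disc 1 k) = fact j * taylor_term k (regular_part k) 0 j"
    using taylor_term_fact[OF F, of 0 j] taylor_term_pole[OF F, of j] by simp
  finally show ?thesis by simp
qed

text \<open>One factor x_i - z of each double pole at z cancels and (1 - z)/(1 - z)^3 leaves (1 -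
  z)^(-2). Of x_i^(k+1) one x_i is kept aside, to be paired with the remaining simple pole, and
  x_i^k goes into \<open>regular_part\<close>.\<close>

lemma h_eq:
  "h (k + 2) t = mls_coeff (fps_at (k + 2) (inverse (1 - fps_X) ^ 2) *
     (mls_monom (expo 1 k (\<lambda>_. 1)) * (regular_part k * inv_disc 1 k * pole_part k)))
     (Poly_Mapping.single (k + 2) (int t))"
proof -
  let ?z = "k + 2"
  let ?I = "{2..k+1}"
  let ?Z = "X ?z ^ t :: rat mls"
  let ?B = "\<Prod>i=2..k+2. (1 - X i) ^ 3 :: rat mls"
  let ?Q = "\<Prod>i=2..k+2. \<Prod>j=i+1..k+2. (X i - X j) ^ 2 :: rat mls"
  have I: "{2..k+2} = insert ?z ?I" "?I = {1<..1+k}" by auto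
  have Z: "inverse ?Z = mls_monom (- Poly_Mapping.single ?z (int t))" "?Z * inverse ?Z = 1"
    by (simp_all only: X_power inverse_mls_monom mls_monom_mult) simp
  have B: "inverse ?B = inverse ((1 - X ?z) ^ 3) * (\<Prod>i\<in>?I. inverse ((1 - X i) ^ 3))" "?B * inverse ?B = 1"
    using mls_inverse_prod[of "{2..k+2}" "\<lambda>i. (1 - X i) ^ 3 :: rat mls", OF one_minus_X_power_unit]
    unfolding I(1) by simp_all
  have Q: "inverse ?Q = inv_disc 1 (Suc k)" "?Q * inverse ?Q = 1"
  proof -
    have "1 + Suc k = k + 2" "1 + 1 = (2 :: nat)" by simp_all
    thus "inverse ?Q = inv_disc 1 (Suc k)" "?Q * inverse ?Q = 1"
      using inverse_nested_pairs[where b = 1 and k = "Suc k" and ?'a = rat] by (simp_all only:)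
  qed
  have disc: "inv_disc 1 (Suc k) = inv_disc 1 k * (\<Prod>i\<in>?I. (inverse (X i - X ?z))\<^sup>2 :: rat mls)"
  proof -
    have "pairs 1 k \<inter> (\<lambda>i. (i, 1 + Suc k)) ` {1<..1+k} = {}" by (auto simp: pairs_def)
    hence "inv_disc 1 (Suc k) = inv_disc 1 k *
        (\<Prod>(i,j)\<in>(\<lambda>i. (i, 1 + Suc k)) ` {1<..1+k}. (inverse (X i - X j))\<^sup>2 :: rat mls)"
      unfolding inv_disc_def pairs_Suc by (subst prod.union_disjoint) auto
    thus ?thesis unfolding I(2) by (simp add: prod.reindex inj_on_def)
  qed
  have unit: "(X i - X ?z) * (inverse (X i - X ?z))\<^sup>2 = (inverse (X i - X ?z) :: rat mls)" if "i \<in> ?I" for i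
    using X_diff_unit[of i ?z, where ?'a = rat] that
    by (simp add: power2_eq_square mult.assoc[symmetric])
  have oneZ: "(1 - X ?z) * inverse ((1 - X ?z) ^ 3) = (inverse ((1 - X ?z) ^ 2) :: rat mls)"
  proof -
    have "(1 - X ?z) * inverse ((1 - X ?z) ^ 3)
        = ((1 - X ?z) * inverse (1 - X ?z)) * inverse (1 - X ?z) ^ 2"
      unfolding mls_inverse_power(1)[OF one_minus_X_unit] by (simp add: power3_eq_cube power2_eq_square mult_ac)
    thus ?thesis by (simp add: one_minus_X_unit mls_inverse_power(1)[OF one_minus_X_unit])
  qed
  have E: "mls_monom (expo 1 k (\<lambda>_. 1)) * regular_part k = (\<Prod>i\<in>?I. X i ^ (k + 1)) * (\<Prod>i\<in>?I. inverse ((1 - X i) ^ 3) :: rat mls)"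
  proof -
    have "mls_monom (expo 1 k (\<lambda>_. 1)) = (\<Prod>i\<in>?I. X i :: rat mls)"
      unfolding I(2) by (rule prod_X[symmetric])
    moreover have "regular_part k = (\<Prod>i\<in>?I. X i ^ k * inverse ((1 - X i) ^ 3))"
      unfolding regular_part_def fps_at_mult fps_at_power[of _ fps_X] fps_at_X fps_at_inverse_one_minus_X
      by (rule prod.reindex_bij_witness[of _ "\<lambda>i. i - 1" "\<lambda>i. 1 + i"]) auto
    ultimately show ?thesis
      by (simp only: prod.distrib power_add power_one_right mult_ac)
  qed
  have pole: "(\<Prod>i\<in>?I. (X i - X ?z)) * (\<Prod>i\<in>?I. (inverse (X i - X ?z))\<^sup>2) = pole_part k"
    unfolding prod.distrib[symmetric] pole_part_def I(2)[symmetric]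
    by (rule prod.cong) (auto simp: unit[simplified])
  have "h (k + 2) t = CT ((1 - X ?z) * (\<Prod>i\<in>?I. X i ^ (k + 1)) * (\<Prod>i\<in>?I. (X i - X ?z)) * inverse (?Z * ?B * ?Q))"
    by (simp add: h_def divide_mls_def)
  also have "inverse (?Z * ?B * ?Q) = inverse ?Z * inverse ?B * inverse ?Q"
    by (simp only: mls_inverse_mult(1)[OF mls_inverse_mult(2)[OF Z(2) B(2)] Q(2)]
        mls_inverse_mult(1)[OF Z(2) B(2)])
  also have "(1 - X ?z) * (\<Prod>i\<in>?I. X i ^ (k + 1)) * (\<Prod>i\<in>?I. (X i - X ?z)) * (inverse ?Z * inverse ?B * inverse ?Q)
     = mls_monom (- Poly_Mapping.single ?z (int t)) * (((1 - X ?z) * inverse ((1 - X ?z) ^ 3)) *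
        (((\<Prod>i\<in>?I. X i ^ (k + 1)) * (\<Prod>i\<in>?I. inverse ((1 - X i) ^ 3))) * inv_disc 1 k *
          ((\<Prod>i\<in>?I. (X i - X ?z)) * (\<Prod>i\<in>?I. (inverse (X i - X ?z))\<^sup>2))))"
    unfolding Z(1) B(1) Q(1) disc by (simp only: mult_ac)
  also have "\<dots> = mls_monom (- Poly_Mapping.single ?z (int t)) * (fps_at ?z (inverse (1 - fps_X) ^ 2) *
       (mls_monom (expo 1 k (\<lambda>_. 1)) * (regular_part k * inv_disc 1 k * pole_part k)))"
    unfolding pole oneZ E[symmetric] fps_at_inverse_one_minus_X by (simp only: mult.assoc)
  finally show ?thesis
    by (simp add: CT_def mls_coeff_monom_mult)
qed

lemma h_series: "Abs_fps (h (k + 2)) = inverse (1 - fps_X) ^ 2 * taylor_series k"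
proof (rule fps_ext)
  fix t
  let ?z = "k + 2"
  let ?f = "inverse (1 - fps_X) ^ 2 :: rat fps"
  let ?G = "mls_monom (expo 1 k (\<lambda>_. 1)) * (regular_part k * inv_disc 1 k * pole_part k)"
  let ?s = "\<lambda>j. Poly_Mapping.single ?z (int j)"
  have inj: "inj_on ?s {0..t}"
    by (auto simp: inj_on_def dest: arg_cong[where f = "\<lambda>c. Poly_Mapping.lookup c ?z"])
  have G0: "mls_coeff ?G (?s j) = taylor_series k $ j" for j
    using taylor_series_nth[of k j] by (simp add: taylor_term_def)
  \<comment> \<open>As z is the smallest variable, the poles expand in nonnegative powers of z;
    hence the convolution with (1 - z)^(-2) is a finite Cauchy product.\<close>
  have nonneg: "0 \<le> tail ?z a" if "mls_coeff ?G a \<noteq> 0" for a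
  proof -
    have "tail_ge ?z 0 (mls_monom (expo 1 k (\<lambda>_. 1)) :: rat mls)"
    proof -
      have "tail ?z (expo 1 k (\<lambda>_. 1)) = 0" using tail_expo[of 1 k k "\<lambda>_. 1"] by simp
      thus ?thesis by (simp add: tail_ge_def mls_coeff_monom)
    qed
    moreover have "tail_ge ?z 0 f" if "mls_in {1<..1+k} f" for f :: "rat mls"
      unfolding tail_ge_def
    proof (intro allI impI)
      fix a assume "mls_coeff f a \<noteq> 0"
      hence "Poly_Mapping.keys a \<subseteq> {1<..1+k}" using that unfolding mls_in_def by blast
      hence "tail ?z a = 0" by (intro tail_keys_below) fastforce
      thus "0 \<le> tail ?z a" by simp
    qed
    hence "tail_ge ?z 0 (regular_part k)" "tail_ge ?z 0 (inv_disc 1 k :: rat mls)"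
      using power_series_in_imp_in[OF power_series_in_regular_part] mls_in_inv_disc by blast+
    moreover have "tail_ge ?z 0 (pole_part k)"
    proof -
      have "tail_ge ?z 0 (inverse (X i - X (Suc (Suc k))) :: rat mls)" if "i \<in> {1<..1+k}" for i
        using tail_ge_inverse_X_diff[of i ?z ?z] that by simp
      hence "tail_ge ?z (\<Sum>i\<in>{1<..1+k}. 0) (pole_part k)"
        unfolding pole_part_def by (rule tail_ge_prod)
      thus ?thesis by (simp only: sum.neutral_const)
    qed
    ultimately have "tail_ge ?z (0 + ((0 + 0) + 0)) ?G"
      by (intro tail_ge_mult)
    thus ?thesis using that by (simp add: tail_ge_def)
  qed
  have "h ?z t = (\<Sum>a\<in>?s ` {0..t}. mls_coeff (fps_at ?z ?f) a * mls_coeff ?G (?s t - a))"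
    unfolding h_eq
  proof (rule mls_coeff_mult_superset)
    fix a assume a: "mls_coeff (fps_at ?z ?f) a \<noteq> 0" "mls_coeff ?G (?s t - a) \<noteq> 0"
    obtain j where j: "a = ?s j" using a(1) by (rule fps_at_nonzeroE)
    have "0 \<le> int t - int j" using nonneg[OF a(2)] by (simp add: j tail_diff tail_single)
    thus "a \<in> ?s ` {0..t}" using j by auto
  qed simp
  also have "\<dots> = (\<Sum>j=0..t. ?f $ j * mls_coeff ?G (?s (t - j)))"
    unfolding sum.reindex[OF inj]
    by (rule sum.cong) (auto simp: single_int_diff of_nat_diff[symmetric] simp del: of_nat_diff)
  also have "\<dots> = (?f * taylor_series k) $ t" by (simp only: G0 fps_mult_nth)
  finally show "Abs_fps (h ?z) $ t = (?f * taylor_series k) $ t" by simp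
qed

lemma h_series_numerator: "(1 - fps_X) ^ ((k + 1)\<^sup>2 + 1) * Abs_fps (h (k + 2)) = fps_of_poly (numerator k)"
proof -
  let ?v = "1 - fps_X :: rat fps"
  have v: "?v * inverse ?v = 1" by (rule inverse_mult_eq_1') simp
  have "(k + 1)\<^sup>2 + 1 = (k * (k - 1) + 3 * k) + 2"
    by (cases k) (simp_all add: power2_eq_square)
  hence "?v ^ ((k + 1)\<^sup>2 + 1) * Abs_fps (h (k + 2))
      = (?v ^ (k * (k - 1) + 3 * k) * taylor_series k) * (?v * inverse ?v) ^ 2"
    by (simp only: h_series power_add power_mult_distrib mult_ac)
  thus ?thesis by (simp only: v taylor_series_numerator power_one mult_1_right)
qed


subsection \<open>The numerator of the generating function\<close>

text \<open>The inner sum is the coefficient of X^\<alpha>_i in (1 + zX)^k (1 + X)^k, written out as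
  a polynomial in z so that its coefficients can be studied combinatorially.\<close>

definition core_poly :: "nat \<Rightarrow> rat poly" where
  "core_poly k = (\<Sum>\<alpha>\<in>compositions k (k * (k - 1)). smult (disc_coeff 0 k (\<lambda>i. int (\<alpha> i)))
     (\<Prod>i=1..k. \<Sum>j\<in>{..\<alpha> i}. monom (of_nat ((k choose j) * (k choose (\<alpha> i - j)))) j))"

lemma one_plus_const_X_power: "(1 + fps_const z * fps_X) ^ p = (1 + fps_X) ^ p oo (fps_const z * fps_X :: 'a::idom fps)"
proof -
  have 0: "(fps_const z * fps_X) $ 0 = 0" by simp
  have "(1 + fps_const z * fps_X) = (1 + fps_X) oo (fps_const z * fps_X)"
    by (simp add: fps_compose_add_distrib fps_X_fps_compose_startby0[OF 0])
  thus ?thesis by (simp only: fps_compose_power[OF 0])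
qed

lemma nth_one_plus_const_X_power:
  "(1 + fps_const z * fps_X) ^ p $ n = (of_nat (p choose n) * z ^ n :: 'a::idom)"
  unfolding one_plus_const_X_power fps_compose_linear by (simp add: nth_one_plus_X_power)

lemma poly_core_poly:
  "poly (core_poly k) z = disc_CT k 0 ((1 + fps_const z * fps_X) ^ k * (1 + fps_X) ^ k)"
proof -
  have "((1 + fps_const z * fps_X) ^ k * (1 + fps_X) ^ k) $ n
      = poly (\<Sum>j\<in>{..n}. monom (of_nat ((k choose j) * (k choose (n - j)))) j) z" for n
    unfolding fps_mult_nth nth_one_plus_const_X_power nth_one_plus_X_power
    by (simp add: poly_sum poly_monom atLeast0AtMost mult_ac)
  thus ?thesis by (simp add: core_poly_def disc_CT_def poly_sum poly_prod)
qed

text \<open>Removing the pole turns the zero factor into (1 + X/z)^k and creates (1 + X)^k;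
  replacing X by zX then gives the symmetric product. The scalar factors amount to z^(k*k), of which
  rescaling uses z^(k(k-1)), leaving z^k.\<close>

lemma numerator_eq_nonzero:
  assumes "z \<noteq> 0"
  shows "poly (numerator k) z = z ^ k * poly (core_poly k) z"
proof -
  let ?a = "(z - 1) / z"
  let ?f = "(1 + fps_const (1 / z) * fps_X) ^ k * (1 + fps_X) ^ k :: rat fps"
  have eq: "fps_const z + fps_const (1 - z) * fps_X = fps_const z * (1 - fps_const ?a * fps_X)"
  proof (rule fps_ext)
    show "(fps_const z + fps_const (1 - z) * fps_X) $ n = (fps_const z * (1 - fps_const ?a * fps_X)) $ n" for n
      using assms by (cases n) (auto simp: fps_X_nth field_simps)
  qed
  \<comment> \<open>The trivial factor with parameter 0 stands for the zero of order k at infinity.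
    It is needed for the weight k + k - 3 and becomes (1 + X)^k.\<close>
  have "(fps_const z + fps_const (1 - z) * fps_X) ^ k * inverse (1 - fps_X) ^ 3
      = fps_const (z ^ k) * ((1 - fps_const ?a * fps_X) ^ k * (1 - fps_const 0 * fps_X) ^ k * inverse (1 - fps_X) ^ 3)"
    unfolding eq power_mult_distrib[of "fps_const z"] fps_const_power by (simp add: mult.assoc)
  hence "poly (numerator k) z = (z ^ k) ^ k *
     disc_CT k 0 ((1 - fps_const ?a * fps_X) ^ k * (1 - fps_const 0 * fps_X) ^ k * inverse (1 - fps_X) ^ 3)"
    by (simp only: poly_numerator disc_CT_mult_const)
  also have "disc_CT k 0 ((1 - fps_const ?a * fps_X) ^ k * (1 - fps_const 0 * fps_X) ^ k * inverse (1 - fps_X) ^ 3)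
      = disc_CT k 0 ((1 + fps_const (1 - ?a) * fps_X) ^ k * (1 + fps_const (1 - 0) * fps_X) ^ k)"
    by (rule disc_CT_projective) simp
  also have "1 - ?a = 1 / z" using assms by (simp add: field_simps)
  finally have W: "poly (numerator k) z = (z ^ k) ^ k * disc_CT k 0 ?f" by simp
  have 0: "(fps_const z * fps_X) $ 0 = 0" by simp
  have "Abs_fps (\<lambda>n. z ^ n * ?f $ n) = ?f oo (fps_const z * fps_X)"
    by (simp add: fps_compose_linear)
  also have "\<dots> = (1 + fps_X) ^ k * (1 + fps_const z * fps_X) ^ k"
  proof -
    have "((1 + fps_const (1 / z) * fps_X) oo (fps_const z * fps_X)) = 1 + fps_X"
      unfolding fps_compose_linear by (rule fps_ext) (use assms in \<open>auto simp: fps_X_nth\<close>)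
    thus ?thesis
      unfolding fps_compose_mult_distrib[OF 0] one_plus_const_X_power[of z]
      by (simp only: fps_compose_power[OF 0, symmetric])
  qed
  finally have "z ^ (k * (k - 1) + 0 * k) * disc_CT k 0 ?f = poly (core_poly k) z"
    unfolding poly_core_poly disc_CT_scale[symmetric] by (simp only: mult.commute)
  moreover have "(z ^ k) ^ k = z ^ k * z ^ (k * (k - 1) + 0 * k)"
    by (cases k) (simp_all add: power_mult[symmetric] power_add[symmetric] algebra_simps)
  ultimately show ?thesis by (simp only: W mult.assoc)
qed

lemma numerator_eq: "numerator k = monom 1 k * core_poly k"
proof -
  \<comment> \<open>The derivation divided by z, so z = 0 is not covered; multiplying both sides by
    the variable makes the evaluations agree there as well.\<close>
  have "poly ([:0, 1:] * numerator k) z = poly ([:0, 1:] * (monom 1 k * core_poly k)) z" for z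
    by (cases "z = 0") (simp_all add: numerator_eq_nonzero poly_monom)
  hence "[:0, 1:] * numerator k = [:0, 1:] * (monom 1 k * core_poly k)"
    by (intro poly_eq_poly_eq_iff[THEN iffD1] ext)
  moreover have "[:0, 1 :: rat:] \<noteq> 0" by simp
  ultimately show ?thesis by (metis mult_left_cancel)
qed

section \<open>Coefficients of the core polynomial\<close>

definition bounded_compositions :: "nat \<Rightarrow> (nat \<Rightarrow> nat) \<Rightarrow> nat \<Rightarrow> (nat \<Rightarrow> nat) set" where
  "bounded_compositions k \<alpha> m = {j \<in> PiE {1..k} (\<lambda>i. {..\<alpha> i}). (\<Sum>i=1..k. j i) = m}"

lemma finite_bounded_compositions [simp]: "finite (bounded_compositions k \<alpha> m)"
  unfolding bounded_compositions_def by (rule finite_subset[of _ "PiE {1..k} (\<lambda>i. {..\<alpha> i})"]) (blast, simp add: finite_PiE)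

definition core_term :: "nat \<Rightarrow> (nat \<Rightarrow> nat) \<Rightarrow> (nat \<Rightarrow> nat) \<Rightarrow> rat" where
  "core_term k \<alpha> j = disc_coeff 0 k (\<lambda>i. int (\<alpha> i)) * (\<Prod>i=1..k. of_nat ((k choose j i) * (k choose (\<alpha> i - j i))))"

lemma prod_monom: "(\<Prod>i\<in>A. monom (c i) (e i)) = monom (\<Prod>i\<in>A. c i) (\<Sum>i\<in>A. e i)"
  by (induction A rule: infinite_finite_induct) (simp_all add: mult_monom monom_eq_1)

lemma coeff_core_poly:
  "coeff (core_poly k) m = (\<Sum>\<alpha>\<in>compositions k (k * (k - 1)). \<Sum>j\<in>bounded_compositions k \<alpha> m. core_term k \<alpha> j)"
proof -
  have "coeff (\<Prod>i=1..k. \<Sum>j\<in>{..\<alpha> i}. monom (of_nat ((k choose j) * (k choose (\<alpha> i - j)))) j) m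
     = (\<Sum>j\<in>bounded_compositions k \<alpha> m. (\<Prod>i=1..k. of_nat ((k choose j i) * (k choose (\<alpha> i - j i))) :: rat))" for \<alpha>
  proof -
    have "coeff (\<Prod>i=1..k. \<Sum>j\<in>{..\<alpha> i}. monom (of_nat ((k choose j) * (k choose (\<alpha> i - j)))) j) m
      = (\<Sum>j\<in>PiE {1..k} (\<lambda>i. {..\<alpha> i}). if (\<Sum>i=1..k. j i) = m
          then (\<Prod>i=1..k. of_nat ((k choose j i) * (k choose (\<alpha> i - j i))) :: rat) else 0)"
      by (subst prod_sum_PiE) (simp_all add: prod_monom coeff_sum cong: if_cong)
    also have "\<dots> = (\<Sum>j\<in>bounded_compositions k \<alpha> m. (\<Prod>i=1..k. of_nat ((k choose j i) * (k choose (\<alpha> i - j i))) :: rat))"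
      unfolding bounded_compositions_def by (subst sum.inter_filter) (simp_all add: finite_PiE)
    finally show ?thesis .
  qed
  thus ?thesis
    by (simp add: core_poly_def coeff_sum core_term_def sum_distrib_left)
qed

lemma bounded_compositionsD:
  assumes "j \<in> bounded_compositions k \<alpha> m"
  shows "j \<in> extensional {1..k}" "\<And>i. i \<in> {1..k} \<Longrightarrow> j i \<le> \<alpha> i" "(\<Sum>i=1..k. j i) = m"
  using assms unfolding bounded_compositions_def PiE_def by auto

lemma bounded_compositionsI:
  assumes "j \<in> extensional {1..k}" "\<And>i. i \<in> {1..k} \<Longrightarrow> j i \<le> \<alpha> i" "(\<Sum>i=1..k. j i) = m"
  shows "j \<in> bounded_compositions k \<alpha> m"
  using assms unfolding bounded_compositions_def PiE_def by auto

text \<open>The map j to \<alpha> - j exchanges the roles of (1 + zX)^k and (1 + X)^k, for each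
  fixed \<alpha>.\<close>

lemma coeff_core_poly_palindromic:
  assumes "m + m' = k * (k - 1)"
  shows "coeff (core_poly k) m = coeff (core_poly k) m'"
  unfolding coeff_core_poly
proof (rule sum.cong[OF refl])
  fix \<alpha> assume \<alpha>: "\<alpha> \<in> compositions k (k * (k - 1))"
  define r where "r = (\<lambda>j. restrict (\<lambda>i. \<alpha> i - j i) {1..k})"
  have r: "r j \<in> bounded_compositions k \<alpha> m'" "r (r j) = j" "core_term k \<alpha> (r j) = core_term k \<alpha> j"
    if j: "j \<in> bounded_compositions k \<alpha> m" and mm: "m + m' = k * (k - 1)" for j m m'
  proof -
    have "(\<Sum>i=1..k. r j i) + (\<Sum>i=1..k. j i) = (\<Sum>i=1..k. \<alpha> i)"
      unfolding sum.distrib[symmetric] r_def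
      by (rule sum.cong) (use bounded_compositionsD(2)[OF j] in auto)
    hence "(\<Sum>i=1..k. r j i) = m'"
      using bounded_compositionsD(3)[OF j] compositionsD(2)[OF \<alpha>] mm by simp
    thus "r j \<in> bounded_compositions k \<alpha> m'" by (intro bounded_compositionsI) (auto simp: r_def)
    show "r (r j) = j"
    proof
      fix i show "r (r j) i = j i"
        using bounded_compositionsD(1,2)[OF j] by (cases "i \<in> {1..k}") (auto simp: r_def extensional_def)
    qed
    have "(\<Prod>i=1..k. of_nat ((k choose r j i) * (k choose (\<alpha> i - r j i))) :: rat)
        = (\<Prod>i=1..k. of_nat ((k choose j i) * (k choose (\<alpha> i - j i))))"
      by (rule prod.cong) (use bounded_compositionsD(2)[OF j] in \<open>auto simp: r_def\<close>)
    thus "core_term k \<alpha> (r j) = core_term k \<alpha> j" by (simp only: core_term_def)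
  qed
  have m': "m' + m = k * (k - 1)" using assms by simp
  show "(\<Sum>j\<in>bounded_compositions k \<alpha> m. core_term k \<alpha> j) = (\<Sum>j\<in>bounded_compositions k \<alpha> m'. core_term k \<alpha> j)"
    by (rule sum.reindex_bij_witness[of _ r r]) (simp_all add: r[OF _ assms] r[OF _ m'])
qed

lemma coeff_core_poly_high:
  assumes "m > k * (k - 1)"
  shows "coeff (core_poly k) m = 0"
proof -
  have "bounded_compositions k \<alpha> m = {}" if "\<alpha> \<in> compositions k (k * (k - 1))" for \<alpha>
  proof (rule ccontr)
    assume "bounded_compositions k \<alpha> m \<noteq> {}"
    then obtain j where j: "j \<in> bounded_compositions k \<alpha> m" by blast
    have "(\<Sum>i=1..k. j i) \<le> (\<Sum>i=1..k. \<alpha> i)"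
      by (rule sum_mono) (rule bounded_compositionsD(2)[OF j])
    thus False using bounded_compositionsD(3)[OF j] compositionsD(2)[OF that] assms by simp
  qed
  thus ?thesis by (simp add: coeff_core_poly)
qed

lemma sum_split_at:
  fixes g :: "nat \<Rightarrow> 'a::comm_monoid_add"
  assumes "r \<le> k"
  shows "(\<Sum>i=1..k. g i) = (\<Sum>i=1..r. g i) + (\<Sum>i\<in>{r<..k}. g i)"
proof -
  have "{1..k} = {1..r} \<union> {r<..k}" using assms by auto
  thus ?thesis by (simp add: sum.union_disjoint ivl_disj_int)
qed

lemma prod_split_at:
  fixes g :: "nat \<Rightarrow> 'a::comm_monoid_mult"
  assumes "r \<le> k"
  shows "(\<Prod>i=1..k. g i) = (\<Prod>i=1..r. g i) * (\<Prod>i\<in>{r<..k}. g i)"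
proof -
  have "{1..k} = {1..r} \<union> {r<..k}" using assms by auto
  thus ?thesis by (simp add: prod.union_disjoint ivl_disj_int)
qed

text \<open>The lowest power of \<open>z\<close> is attained when the first \<open>r\<close> variables use up the factor
  \<open>(1 + w)^k\<close> and the others do not touch \<open>(1 + z w)^k\<close>; then the kernel splits as well.\<close>

lemma core_term_nonzeroD:
  assumes nz: "core_term k \<alpha> j \<noteq> 0" and j: "j \<in> bounded_compositions k \<alpha> m"
    and r: "r \<le> k" "int m \<le> int r * (int k - int r - 1)"
  shows "int m = int r * (int k - int r - 1)"
    and "\<And>i. 1 \<le> i \<Longrightarrow> i \<le> r \<Longrightarrow> \<alpha> i = j i + k"
    and "\<And>i. r < i \<Longrightarrow> i \<le> k \<Longrightarrow> j i = 0"
    and "(\<Sum>i\<in>{r<..k}. int (\<alpha> i)) = int (k - r) * (int (k - r) - 1)"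
proof -
  have L: "disc_coeff 0 k (\<lambda>i. int (\<alpha> i)) \<noteq> 0" using nz by (simp add: core_term_def)
  have ch: "\<alpha> i - j i \<le> k" if "i \<in> {1..k}" for i
  proof (rule ccontr)
    assume "\<not> \<alpha> i - j i \<le> k"
    hence "(\<Prod>i=1..k. of_nat ((k choose j i) * (k choose (\<alpha> i - j i))) :: rat) = 0"
      using that by (intro prod_zero) (auto intro!: bexI[of _ i])
    thus False using nz by (simp add: core_term_def)
  qed
  have tail: "(\<Sum>i\<in>{r<..k}. int (\<alpha> i)) \<le> int (k - r) * (int (k - r) - 1)"
    by (rule disc_coeff_tail[OF L r(1)])
  have tot: "(\<Sum>i=1..r. int (\<alpha> i)) + (\<Sum>i\<in>{r<..k}. int (\<alpha> i)) = int k * (int k - 1)"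
    using disc_coeff_homogeneous[OF L] sum_split_at[OF r(1), of "\<lambda>i. int (\<alpha> i)"] by simp
  have m: "(\<Sum>i=1..r. int (j i)) + (\<Sum>i\<in>{r<..k}. int (j i)) = int m"
  proof -
    have "int m = (\<Sum>i=1..k. int (j i))"
      by (simp only: bounded_compositionsD(3)[OF j, symmetric] of_nat_sum)
    thus ?thesis using sum_split_at[OF r(1), of "\<lambda>i. int (j i)"] by simp
  qed
  let ?d = "\<Sum>i=1..r. int (j i) + int k - int (\<alpha> i)"
  have d: "?d = (\<Sum>i=1..r. int (j i)) + int r * int k - (\<Sum>i=1..r. int (\<alpha> i))"
    by (simp add: sum.distrib sum_subtractf)
  have dnn: "0 \<le> int (j i) + int k - int (\<alpha> i)" if "i \<in> {1..r}" for i
    using ch[of i] that r(1) by simp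
  have d0: "0 \<le> ?d" by (rule sum_nonneg) (rule dnn)
  have s0: "0 \<le> (\<Sum>i\<in>{r<..k}. int (j i))" by (rule sum_nonneg) simp
  have arith: "int k * (int k - 1) - int (k - r) * (int (k - r) - 1) = int r * (int k - int r - 1) + int r * int k"
    using r(1) by (simp add: of_nat_diff algebra_simps)
  show "int m = int r * (int k - int r - 1)"
    using r(2) d d0 s0 m tot tail arith by linarith
  have "?d = 0" using r(2) d d0 s0 m tot tail arith by linarith
  hence dz: "int (j i) + int k - int (\<alpha> i) = 0" if "i \<in> {1..r}" for i
    using sum_nonneg_eq_0_iff[of "{1..r}" "\<lambda>i. int (j i) + int k - int (\<alpha> i)"] dnn that by blast
  show "\<alpha> i = j i + k" if "1 \<le> i" "i \<le> r" for i
    using dz[of i] that by simp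
  have "(\<Sum>i\<in>{r<..k}. int (j i)) = 0" using r(2) d d0 s0 m tot tail arith by linarith
  thus "j i = 0" if "r < i" "i \<le> k" for i
    using sum_nonneg_eq_0_iff[of "{r<..k}" "\<lambda>i. int (j i)"] that by simp
  show "(\<Sum>i\<in>{r<..k}. int (\<alpha> i)) = int (k - r) * (int (k - r) - 1)"
    using r(2) d d0 s0 m tot tail arith by linarith
qed

lemma coeff_core_poly_low:
  assumes "r \<le> k" "int m < int r * (int k - int r - 1)"
  shows "coeff (core_poly k) m = 0"
  unfolding coeff_core_poly
proof (intro sum.neutral ballI)
  fix \<alpha> j assume j: "j \<in> bounded_compositions k \<alpha> m"
  show "core_term k \<alpha> j = 0"
    using core_term_nonzeroD(1)[OF _ j assms(1)] assms(2) by force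
qed

text \<open>By \<open>core_term_nonzeroD\<close> a surviving pair is determined by j on the first
  block and \<alpha> on the second. In the first block \<open>disc_coeff_split\<close> leaves the
  exponents j_i + k - 2(k - r) = j_i - e, which is how \<open>e\<close> enters.\<close>

lemma coeff_core_poly_low_degree:
  assumes k: "k = e + 2 * r" and m: "int m = int r * (int k - int r - 1)"
  shows "coeff (core_poly k) m = disc_CT r e ((1 + fps_X) ^ k) * disc_CT (k - r) 0 ((1 + fps_X) ^ k)"
proof -
  have rk: "r \<le> k" using k by simp
  let ?d = "k * (k - 1)"
  let ?S = "SIGMA \<alpha>:compositions k ?d. bounded_compositions k \<alpha> m"
  let ?B = "compositions r (r * (r - 1) + e * r)" and ?G = "compositions (k - r) ((k - r) * (k - r - 1) + 0 * (k - r))"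
  \<comment> \<open>\<open>A\<close> and \<open>J\<close> recover \<alpha> and j from the data
    \<beta> = j on the first block and \<gamma> = \<alpha> on the second.\<close>
  define A where "A = (\<lambda>\<beta> \<gamma>. restrict (\<lambda>i. if i \<le> r then \<beta> i + k else \<gamma> (i - r)) {1..k} :: nat \<Rightarrow> nat)"
  define J where "J = (\<lambda>\<beta>. restrict (\<lambda>i. if i \<le> r then \<beta> i else 0) {1..k} :: nat \<Rightarrow> nat)"
  let ?f = "\<lambda>(\<beta>, \<gamma>). (A \<beta> \<gamma>, J \<beta>)"
  have ik: "int k = int e + 2 * int r" using k by simp
  have deg_r: "int (r * (r - 1) + e * r) = int m"
    unfolding int_degree m ik by (simp add: algebra_simps)
  hence deg_r': "r * (r - 1) + e * r = m" by (simp only: of_nat_eq_iff)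
  have shift: "(\<Sum>i\<in>{r<..k}. g i) = (\<Sum>i=1..k - r. g (r + i))" for g :: "nat \<Rightarrow> 'a::comm_monoid_add"
    by (rule sum.reindex_bij_witness[of _ "\<lambda>i. r + i" "\<lambda>i. i - r"]) auto
  have shift_prod: "(\<Prod>i\<in>{r<..k}. g i) = (\<Prod>i=1..k - r. g (r + i))" for g :: "nat \<Rightarrow> 'a::comm_monoid_mult"
    by (rule prod.reindex_bij_witness[of _ "\<lambda>i. r + i" "\<lambda>i. i - r"]) auto
  have sumA: "(\<Sum>i=1..r. A \<beta> \<gamma> i) = (\<Sum>i=1..r. \<beta> i) + r * k" "(\<Sum>i\<in>{r<..k}. A \<beta> \<gamma> i) = (\<Sum>i=1..k-r. \<gamma> i)" for \<beta> \<gamma>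
  proof -
    have "(\<Sum>i=1..r. A \<beta> \<gamma> i) = (\<Sum>i=1..r. \<beta> i + k)"
      by (rule sum.cong) (use rk in \<open>auto simp: A_def\<close>)
    thus "(\<Sum>i=1..r. A \<beta> \<gamma> i) = (\<Sum>i=1..r. \<beta> i) + r * k" by (simp add: sum.distrib)
    show "(\<Sum>i\<in>{r<..k}. A \<beta> \<gamma> i) = (\<Sum>i=1..k-r. \<gamma> i)"
      unfolding shift by (rule sum.cong) (auto simp: A_def)
  qed
  have fS: "(A \<beta> \<gamma>, J \<beta>) \<in> ?S" if "\<beta> \<in> ?B" "\<gamma> \<in> ?G" for \<beta> \<gamma>
  proof -
    have "int (\<Sum>i=1..k. A \<beta> \<gamma> i) = int (r * (r - 1) + e * r) + int r * int k + int ((k - r) * (k - r - 1) + 0 * (k - r))"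
      unfolding sum_split_at[OF rk] sumA compositionsD(2)[OF that(1)] compositionsD(2)[OF that(2)] by simp
    also have "\<dots> = int ?d"
      unfolding deg_r int_degree int_mult_pred m of_nat_diff[OF rk] by (simp add: ik algebra_simps)
    finally have "(\<Sum>i=1..k. A \<beta> \<gamma> i) = ?d" by (simp only: of_nat_eq_iff)
    hence 1: "A \<beta> \<gamma> \<in> compositions k ?d" by (intro compositionsI) (auto simp: A_def)
    have "(\<Sum>i=1..k. J \<beta> i) = (\<Sum>i=1..r. J \<beta> i) + (\<Sum>i\<in>{r<..k}. J \<beta> i)" by (rule sum_split_at[OF rk])
    also have "(\<Sum>i=1..r. J \<beta> i) = (\<Sum>i=1..r. \<beta> i)" by (rule sum.cong) (use rk in \<open>auto simp: J_def\<close>)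
    also have "(\<Sum>i\<in>{r<..k}. J \<beta> i) = 0" by (rule sum.neutral) (auto simp: J_def)
    finally have "(\<Sum>i=1..k. J \<beta> i) = m" using compositionsD(2)[OF that(1)] deg_r' by simp
    hence "J \<beta> \<in> bounded_compositions k (A \<beta> \<gamma>) m" by (intro bounded_compositionsI) (auto simp: A_def J_def)
    thus ?thesis using 1 by simp
  qed
  have inj: "inj_on ?f (?B \<times> ?G)"
  proof (rule inj_onI, clarify)
    fix \<beta> \<gamma> \<beta>' \<gamma>'
    assume in_compositions: "\<beta> \<in> ?B" "\<beta>' \<in> ?B" "\<gamma> \<in> ?G" "\<gamma>' \<in> ?G" and A: "A \<beta> \<gamma> = A \<beta>' \<gamma>'" and J: "J \<beta> = J \<beta>'"
    have "\<beta> i = \<beta>' i" if "i \<in> {1..r}" for i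
      using fun_cong[OF J, of i] that rk by (simp add: J_def)
    moreover have "\<gamma> i = \<gamma>' i" if "i \<in> {1..k - r}" for i
    proof -
      have "r + i \<in> {1..k}" "\<not> r + i \<le> r" using that rk by auto
      thus ?thesis using fun_cong[OF A, of "r + i"] by (simp add: A_def)
    qed
    ultimately show "\<beta> = \<beta>' \<and> \<gamma> = \<gamma>'"
      using in_compositions[THEN compositionsD(1)] by (meson extensionalityI)
  qed
  have surj: "p \<in> ?f ` (?B \<times> ?G)" if p: "p \<in> ?S" and nz: "core_term k (fst p) (snd p) \<noteq> 0" for p
  proof -
    obtain \<alpha> j where p_eq: "p = (\<alpha>, j)" by (cases p)
    have \<alpha>: "\<alpha> \<in> compositions k ?d" and j: "j \<in> bounded_compositions k \<alpha> m" using p by (auto simp: p_eq)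
    have m': "int m \<le> int r * (int k - int r - 1)" using m by simp
    note D = core_term_nonzeroD[OF nz[unfolded p_eq fst_conv snd_conv] j rk m']
    define \<beta> where "\<beta> = restrict j {1..r}"
    define \<gamma> where "\<gamma> = restrict (\<lambda>i. \<alpha> (r + i)) {1..k - r}"
    have "(\<Sum>i\<in>{r<..k}. j i) = 0" by (rule sum.neutral) (use D(3) in auto)
    hence "(\<Sum>i=1..r. \<beta> i) = m"
      using sum_split_at[OF rk, of j] bounded_compositionsD(3)[OF j] by (simp add: \<beta>_def)
    hence "\<beta> \<in> ?B" using deg_r' by (intro compositionsI) (auto simp: \<beta>_def)
    moreover have "\<gamma> \<in> ?G"
    proof (rule compositionsI)
      have "int (\<Sum>i=1..k-r. \<gamma> i) = (\<Sum>i\<in>{r<..k}. int (\<alpha> i))" by (simp add: shift \<gamma>_def)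
      also have "\<dots> = int ((k - r) * (k - r - 1) + 0 * (k - r))" unfolding D(4) int_degree by simp
      finally show "(\<Sum>i=1..k-r. \<gamma> i) = (k - r) * (k - r - 1) + 0 * (k - r)" by (simp only: of_nat_eq_iff)
    qed (simp add: \<gamma>_def)
    moreover have "A \<beta> \<gamma> = \<alpha>"
    proof
      fix i show "A \<beta> \<gamma> i = \<alpha> i"
        using compositionsD(1)[OF \<alpha>] D(2)[of i] by (auto simp: A_def \<beta>_def \<gamma>_def extensional_def)
    qed
    moreover have "J \<beta> = j"
    proof
      fix i show "J \<beta> i = j i"
        using bounded_compositionsD(1)[OF j] D(3)[of i] by (auto simp: J_def \<beta>_def extensional_def)
    qed
    ultimately show ?thesis unfolding p_eq by (intro image_eqI[of _ _ "(\<beta>, \<gamma>)"]) auto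
  qed
  have core_term: "core_term k (A \<beta> \<gamma>) (J \<beta>) =
     (disc_coeff 0 r (\<lambda>i. int (\<beta> i) - int e) * (\<Prod>i=1..r. (1 + fps_X) ^ k $ \<beta> i)) *
     (disc_coeff 0 (k - r) (\<lambda>i. int (\<gamma> i) - int 0) * (\<Prod>i=1..k - r. (1 + fps_X) ^ k $ \<gamma> i))"
    if "\<beta> \<in> ?B" "\<gamma> \<in> ?G" for \<beta> \<gamma>
  proof -
    have "int (\<Sum>i\<in>{r<..k}. A \<beta> \<gamma> i) = int ((k - r) * (k - r - 1) + 0 * (k - r))"
      unfolding sumA compositionsD(2)[OF that(2)] ..
    hence "(\<Sum>i\<in>{r<..k}. int (A \<beta> \<gamma> i)) = int (k - r) * (int (k - r) - 1)"
      unfolding int_degree by simp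
    hence "disc_coeff 0 k (\<lambda>i. int (A \<beta> \<gamma> i)) = disc_coeff 0 r (\<lambda>i. int (A \<beta> \<gamma> i) - 2 * int (k - r))
        * disc_coeff 0 (k - r) (\<lambda>i. int (A \<beta> \<gamma> (r + i)))"
      using disc_coeff_split[OF rk, of "\<lambda>i. int (A \<beta> \<gamma> i)" 0] disc_coeff_base[of r] by simp
    also have "disc_coeff 0 r (\<lambda>i. int (A \<beta> \<gamma> i) - 2 * int (k - r)) = disc_coeff 0 r (\<lambda>i. int (\<beta> i) - int e)"
      by (rule disc_coeff_cong) (use k in \<open>auto simp: A_def\<close>)
    also have "disc_coeff 0 (k - r) (\<lambda>i. int (A \<beta> \<gamma> (r + i))) = disc_coeff 0 (k - r) (\<lambda>i. int (\<gamma> i) - int 0)"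
      by (rule disc_coeff_cong) (use rk in \<open>auto simp: A_def\<close>)
    finally have L: "disc_coeff 0 k (\<lambda>i. int (A \<beta> \<gamma> i)) = disc_coeff 0 r (\<lambda>i. int (\<beta> i) - int e) * disc_coeff 0 (k - r) (\<lambda>i. int (\<gamma> i) - int 0)" .
    have P1: "(\<Prod>i=1..r. of_nat ((k choose J \<beta> i) * (k choose (A \<beta> \<gamma> i - J \<beta> i))) :: rat)
        = (\<Prod>i=1..r. (1 + fps_X) ^ k $ \<beta> i)"
      unfolding nth_one_plus_X_power by (rule prod.cong) (use rk in \<open>auto simp: A_def J_def\<close>)
    have P2: "(\<Prod>i\<in>{r<..k}. of_nat ((k choose J \<beta> i) * (k choose (A \<beta> \<gamma> i - J \<beta> i))) :: rat)
        = (\<Prod>i=1..k - r. (1 + fps_X) ^ k $ \<gamma> i)"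
      unfolding nth_one_plus_X_power shift_prod by (rule prod.cong) (use rk in \<open>auto simp: A_def J_def\<close>)
    show ?thesis
      unfolding core_term_def L prod_split_at[OF rk] P1 P2 by (simp only: mult_ac)
  qed
  have "coeff (core_poly k) m = (\<Sum>p\<in>?S. core_term k (fst p) (snd p))"
    unfolding coeff_core_poly by (subst sum.Sigma) (simp_all add: case_prod_beta)
  also have "\<dots> = (\<Sum>p\<in>?f ` (?B \<times> ?G). core_term k (fst p) (snd p))"
  proof (rule sum.mono_neutral_right)
    show "?f ` (?B \<times> ?G) \<subseteq> ?S" using fS by auto
    show "\<forall>p\<in>?S - ?f ` (?B \<times> ?G). core_term k (fst p) (snd p) = 0" using surj by blast
  qed simp
  also have "\<dots> = (\<Sum>p\<in>?B \<times> ?G. core_term k (A (fst p) (snd p)) (J (fst p)))"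
    by (subst sum.reindex[OF inj]) (simp add: case_prod_beta)
  also have "\<dots> = (\<Sum>\<beta>\<in>?B. \<Sum>\<gamma>\<in>?G. core_term k (A \<beta> \<gamma>) (J \<beta>))"
    by (subst sum.cartesian_product) (simp add: case_prod_beta)
  also have "\<dots> = disc_CT r e ((1 + fps_X) ^ k) * disc_CT (k - r) 0 ((1 + fps_X) ^ k)"
    unfolding disc_CT_def sum_product by (intro sum.cong refl) (rule core_term)
  finally show ?thesis .
qed


subsection \<open>The Ehrhart polynomial\<close>

lemma disc_CT_Morris:
  assumes "int p - int q = 2 * int m - 3 + int e"
  shows "CT (M m (Suc e) q 2) = disc_CT m e ((1 + fps_X) ^ p)"
  using disc_CT_projective[where p = p and p' = 0 and q = q and k = m and e = e and a = 0] assms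
  by (simp add: CT_M)

text \<open>At z = 1 the two binomial factors merge into (1 + y)^(2k). Inversion trades e = 0 for e
  = 2, which is exactly what an additional smallest variable leaves behind; hence k + 1
  variables.\<close>

lemma poly_numerator_1: "poly (numerator k) 1 = CT (M (k + 1) 1 1 2)"
proof -
  have "poly (numerator k) 1 = disc_CT k 0 ((1 + fps_X) ^ (2 * k))"
    by (simp add: numerator_eq poly_monom poly_core_poly power_add[symmetric] mult_2)
  also have "\<dots> = disc_CT k 2 ((1 + fps_X) ^ (2 * k))"
    by (rule disc_CT_inversion) simp
  also have "\<dots> = disc_CT (Suc k) 0 ((1 + fps_X) ^ (2 * k))"
    by (rule disc_CT_last[symmetric]) (simp add: nth_one_plus_X_power)
  also have "\<dots> = CT (M (k + 1) 1 1 2)"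
    using disc_CT_Morris[of "2 * k" 1 "Suc k" 0] by simp
  finally show ?thesis .
qed

lemma poly_numerator_1_pos: "0 < poly (numerator k) 1"
proof -
  have "poly (numerator k) 1 = disc_CT k 0 ((1 + fps_X) ^ (2 * k))"
    by (simp add: numerator_eq poly_monom poly_core_poly power_add[symmetric] mult_2)
  also have "\<dots> > 0"
    by (rule disc_CT_pos) (simp_all add: nth_one_plus_X_power)
  finally show ?thesis .
qed

text \<open>\<open>low_degree k = \<lfloor>(k + 1)\<^sup>2 / 4\<rfloor>\<close> is the order of \<open>numerator k\<close> at 0.\<close>

definition low_degree :: "nat \<Rightarrow> nat" where
  "low_degree k = (k + 1)\<^sup>2 div 4"

lemma low_degree_odd: "low_degree (2 * s + 1) = (s + 1) * (s + 1)"
proof -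
  have "(2 * s + 1 + 1)\<^sup>2 = ((s + 1) * (s + 1)) * 4" by (simp add: power2_eq_square)
  thus ?thesis unfolding low_degree_def by (metis nonzero_mult_div_cancel_right zero_neq_numeral)
qed

lemma low_degree_even: "low_degree (2 * s) = s * s + s"
proof -
  have "(2 * s + 1)\<^sup>2 = (s * s + s) * 4 + 1" by (simp add: power2_eq_square)
  thus ?thesis unfolding low_degree_def by simp
qed

text \<open>Here s = k div 2 is a maximizer of r(k - r - 1), so it gives the best bound in
  \<open>coeff_core_poly_low\<close>; the two cases correspond to e = 0 and e = 1 in k = e +
  2s.\<close>

lemma low_degree_eq:
  obtains s where "k = 2 * s" "int (low_degree k) - int k = int s * (int k - int s - 1)" "k \<le> low_degree k" "low_degree k \<le> k * k"
  | s where "k = 2 * s + 1" "int (low_degree k) - int k = int s * (int k - int s - 1)" "k \<le> low_degree k" "low_degree k \<le> k * k"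
proof (cases "even k")
  case True
  then obtain s where s: "k = 2 * s" by (auto elim: evenE)
  have sq: "s \<le> s * s" by (cases s) simp_all
  show ?thesis
  proof (rule that(1)[OF s])
    show "int (low_degree k) - int k = int s * (int k - int s - 1)"
      unfolding s low_degree_even by (simp add: algebra_simps)
    show "k \<le> low_degree k" "low_degree k \<le> k * k"
      using sq unfolding s low_degree_even by (simp_all add: algebra_simps)
  qed
next
  case False
  then obtain s where s: "k = 2 * s + 1" by (auto elim: oddE)
  show ?thesis
  proof (rule that(2)[OF s])
    show "int (low_degree k) - int k = int s * (int k - int s - 1)"
      unfolding s low_degree_odd by (simp add: algebra_simps)
    show "k \<le> low_degree k" "low_degree k \<le> k * k"
      unfolding s low_degree_odd by (simp_all add: algebra_simps)
  qed
qed

lemma low_degree_bounds: "k \<le> low_degree k" "low_degree k \<le> k * k"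
  by (rule low_degree_eq[of k]; simp)+

lemma coeff_numerator: "coeff (numerator k) j = (if k \<le> j then coeff (core_poly k) (j - k) else 0)"
  by (simp add: numerator_eq coeff_monom_mult not_le)

text \<open>The factor z^k shifts both indices by k, so the sum k(k-1) for the core becomes k(k-1) +
  2k.\<close>

lemma coeff_numerator_palindromic:
  assumes "j + j' = k * k + k"
  shows "coeff (numerator k) j = coeff (numerator k) j'"
proof -
  have kk: "k * k = k * (k - 1) + k" by (cases k) simp_all
  consider "j < k" | "j' < k" | "k \<le> j" "k \<le> j'" by linarith
  thus ?thesis
  proof cases
    case 1
    hence "j' - k > k * (k - 1)" "k \<le> j'" using assms kk by linarith+
    thus ?thesis using 1 by (simp add: coeff_numerator coeff_core_poly_high)
  next
    case 2
    hence "j - k > k * (k - 1)" "k \<le> j" using assms kk by linarith+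
    thus ?thesis using 2 by (simp add: coeff_numerator coeff_core_poly_high)
  next
    case 3
    hence "(j - k) + (j' - k) = k * (k - 1)" using assms kk by linarith
    thus ?thesis using 3 coeff_core_poly_palindromic by (simp add: coeff_numerator)
  qed
qed

lemma coeff_numerator_low: "j < low_degree k \<Longrightarrow> coeff (numerator k) j = 0"
proof (rule low_degree_eq[of k])
  fix s assume "j < low_degree k" "k = 2 * s" "int (low_degree k) - int k = int s * (int k - int s - 1)"
  thus ?thesis using coeff_core_poly_low[of s k "j - k"] by (auto simp: coeff_numerator of_nat_diff)
next
  fix s assume "j < low_degree k" "k = 2 * s + 1" "int (low_degree k) - int k = int s * (int k - int s - 1)"
  thus ?thesis using coeff_core_poly_low[of s k "j - k"] by (auto simp: coeff_numerator of_nat_diff)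
qed

lemma coeff_numerator_high: "j + low_degree k > k * k + k \<Longrightarrow> coeff (numerator k) j = 0"
proof -
  assume j: "j + low_degree k > k * k + k"
  show ?thesis
  proof (cases "j \<le> k * k + k")
    case True
    hence "coeff (numerator k) j = coeff (numerator k) (k * k + k - j)"
      by (intro coeff_numerator_palindromic) simp
    thus ?thesis using coeff_numerator_low[of "k * k + k - j" k] j True by simp
  next
    case False
    have "k * k = k * (k - 1) + k" by (cases k) simp_all
    hence "j - k > k * (k - 1)" "k \<le> j" using False by linarith+
    thus ?thesis by (simp add: coeff_numerator coeff_core_poly_high)
  qed
qed

text \<open>For even k the two factors agree at once, and inversion takes e = 0 to e = 2. For odd k
  the first factor goes from e = 1 to e = 2 by inversion and then gains a variable, which makes it
  the second factor; inversion finally takes e = 0 to e = 1.\<close>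

lemma coeff_numerator_low_degree:
  "coeff (numerator k) (low_degree k) = (CT (M ((k + 1) div 2) (2 + of_bool (even k)) 1 2))\<^sup>2"
proof (rule low_degree_eq[of k])
  fix s assume s: "k = 2 * s" and m: "int (low_degree k) - int k = int s * (int k - int s - 1)" "k \<le> low_degree k"
  have "coeff (numerator k) (low_degree k) = disc_CT s 0 ((1 + fps_X) ^ k) * disc_CT (k - s) 0 ((1 + fps_X) ^ k)"
    using coeff_core_poly_low_degree[of k 0 s "low_degree k - k"] s m by (simp add: coeff_numerator of_nat_diff)
  also have "\<dots> = (disc_CT s 0 ((1 + fps_X) ^ k))\<^sup>2"
    using s by (simp add: power2_eq_square mult_2)
  also have "disc_CT s 0 ((1 + fps_X) ^ k) = disc_CT s 2 ((1 + fps_X) ^ k)"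
    by (rule disc_CT_inversion) (simp add: s)
  also have "\<dots> = CT (M s 3 1 2)"
    using disc_CT_Morris[of k 1 s 2] s by (simp add: numeral_3_eq_3)
  also have "M s 3 1 2 = M ((k + 1) div 2) (2 + of_bool (even k)) 1 2"
    using s by simp
  finally show ?thesis .
next
  fix s assume s: "k = 2 * s + 1" and m: "int (low_degree k) - int k = int s * (int k - int s - 1)" "k \<le> low_degree k"
  let ?f = "(1 + fps_X) ^ k :: rat fps"
  have "coeff (numerator k) (low_degree k) = disc_CT s 1 ?f * disc_CT (k - s) 0 ?f"
    using coeff_core_poly_low_degree[of k 1 s "low_degree k - k"] s m by (simp add: coeff_numerator of_nat_diff)
  also have "k - s = Suc s" using s by simp
  also have "disc_CT s 1 ?f = disc_CT s 2 ?f" by (rule disc_CT_inversion) (simp add: s)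
  also have "disc_CT s 2 ?f = disc_CT (Suc s) 0 ?f" by (rule disc_CT_last[symmetric]) (simp add: nth_one_plus_X_power)
  also have "disc_CT (Suc s) 0 ?f = disc_CT (Suc s) 1 ?f" by (rule disc_CT_inversion) (simp add: s)
  also have "\<dots> = CT (M (Suc s) 2 1 2)"
    using disc_CT_Morris[of k 1 "Suc s" 1] s by (simp add: numeral_2_eq_2)
  also have "M (Suc s) 2 1 2 = M ((k + 1) div 2) (2 + of_bool (even k)) 1 2"
    using s by simp
  finally show ?thesis by (simp add: power2_eq_square)
qed

section \<open>From the generating function to the polynomial\<close>

text \<open>The polynomial binomial(t - j + d, d) in t. For t \<ge> j it is the coefficient of z^t
  in z^j/(1 - z)^(d+1).\<close>

definition binomial_poly :: "nat \<Rightarrow> nat \<Rightarrow> rat poly" where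
  "binomial_poly d j = smult (1 / fact d) (\<Prod>i=1..d. [:of_nat i - of_nat j, 1:])"

lemma poly_binomial_poly: "poly (binomial_poly d j) x = (\<Prod>i=1..d. x - of_nat j + of_nat i) / fact d"
  by (simp add: binomial_poly_def poly_prod algebra_simps)

lemma degree_binomial_poly: "degree (binomial_poly d j) = d"
  by (simp add: binomial_poly_def degree_prod_eq_sum_degree)

lemma lead_coeff_binomial_poly: "coeff (binomial_poly d j) d = 1 / fact d"
proof -
  have "lead_coeff (\<Prod>i=1..d. [:of_nat i - of_nat j, 1 :: rat:]) = 1"
    by (simp add: lead_coeff_prod)
  moreover have "degree (\<Prod>i=1..d. [:of_nat i - of_nat j, 1 :: rat:]) = d"
    by (simp add: degree_prod_eq_sum_degree)
  ultimately show ?thesis by (simp add: binomial_poly_def)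
qed

lemma poly_binomial_poly_nat:
  "poly (binomial_poly d j) (of_nat (j + m)) = of_nat (m + d choose d)"
proof -
  have "(\<Prod>i=1..d. of_nat m + of_nat i) * fact m = (fact (m + d) :: rat)" for d
  proof (induction d)
    case (Suc d)
    have "(\<Prod>i=1..Suc d. of_nat m + of_nat i) * fact m
        = (of_nat m + of_nat (Suc d)) * ((\<Prod>i=1..d. of_nat m + of_nat i) * fact m :: rat)"
      by simp
    also have "\<dots> = fact (m + Suc d)"
      unfolding Suc by (simp add: algebra_simps)
    finally show ?case .
  qed simp
  hence "(\<Prod>i=1..d. of_nat m + of_nat i) = (fact (m + d) / fact m :: rat)"
    by (metis fact_nonzero nonzero_eq_divide_eq)
  thus ?thesis
    by (simp add: poly_binomial_poly binomial_fact[of d "m + d"] mult.commute)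
qed

lemma poly_binomial_poly_zero:
  assumes "1 \<le> int j - i" "int j - i \<le> int d"
  shows "poly (binomial_poly d j) (of_int i) = 0"
proof -
  have "of_int i - of_nat j + of_nat (nat (int j - i)) = (0 :: rat)"
    using assms by (simp add: of_nat_nat)
  hence "(\<Prod>l=1..d. of_int i - of_nat j + of_nat l :: rat) = 0"
    using assms by (intro prod_zero) (auto intro!: bexI[of _ "nat (int j - i)"])
  thus ?thesis by (simp add: poly_binomial_poly)
qed

lemma poly_binomial_poly_reflect:
  assumes "j + j' + c = d + 1"
  shows "poly (binomial_poly d j) (- of_nat c - x) = (- 1) ^ d * poly (binomial_poly d j') x"
proof -
  have "(\<Prod>i=1..d. - of_nat c - x - of_nat j + of_nat i) = (\<Prod>i=1..d. - (x - of_nat j' + of_nat i))"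
  proof (rule prod.reindex_bij_witness[of _ "\<lambda>i. d + 1 - i" "\<lambda>i. d + 1 - i"])
    fix i assume "i \<in> {1..d}"
    hence "of_nat (d + 1 - i) = (of_nat (d + 1) - of_nat i :: rat)" by (subst of_nat_diff) auto
    moreover have "of_nat (d + 1) = (of_nat j + of_nat j' + of_nat c :: rat)"
      unfolding assms[symmetric] by simp
    ultimately show "- (x - of_nat j' + of_nat (d + 1 - i)) = - of_nat c - x - of_nat j + of_nat i" by simp
  qed auto
  also have "\<dots> = (- 1) ^ d * (\<Prod>i=1..d. x - of_nat j' + of_nat i)"
    by (subst prod_uminus) simp
  finally show ?thesis by (simp add: poly_binomial_poly)
qed

text \<open>The range contains the support of the numerator and ends below (k+1)^2, so that each
  binomial polynomial used also has the correct value 0 at the integers 0 \<le> t < j.\<close>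

definition ehrhart_poly :: "nat \<Rightarrow> rat poly" where
  "ehrhart_poly k = (\<Sum>j=k..k * k. smult (coeff (numerator k) j) (binomial_poly ((k + 1)\<^sup>2) j))"

lemma coeff_numerator_outside: "j \<notin> {k..k * k} \<Longrightarrow> coeff (numerator k) j = 0"
  using coeff_numerator_low[of j k] coeff_numerator_high[of k j] low_degree_bounds[of k] by fastforce

lemma ehrhart_poly_eval: "poly (ehrhart_poly k) (of_nat t) = h (k + 2) t"
proof -
  let ?d = "(k + 1)\<^sup>2"
  let ?W = "\<lambda>j. coeff (numerator k) j"
  have inv: "inverse ((1 - fps_X) ^ (?d + 1)) = Abs_fps (\<lambda>m. of_nat (m + ?d choose ?d) :: rat)"
  proof -
    have "?d + 1 + m - 1 choose m = m + ?d choose ?d" for m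
      using binomial_symmetric[of m "m + ?d"] by (simp add: add.commute)
    thus ?thesis
      using one_minus_const_fps_X_neg_power'[of "?d + 1" "1 :: rat"] by simp
  qed
  have unit: "(1 - fps_X) ^ (?d + 1) * inverse ((1 - fps_X) ^ (?d + 1)) = (1 :: rat fps)"
    by (rule inverse_mult_eq_1') simp
  have "Abs_fps (h (k + 2)) = ((1 - fps_X) ^ (?d + 1) * inverse ((1 - fps_X) ^ (?d + 1))) * Abs_fps (h (k + 2))"
    by (simp only: unit mult_1_left)
  also have "\<dots> = fps_of_poly (numerator k) * inverse ((1 - fps_X) ^ (?d + 1))"
    unfolding h_series_numerator[symmetric] by (simp only: mult_ac)
  finally have "Abs_fps (h (k + 2)) $ t = (fps_of_poly (numerator k) * Abs_fps (\<lambda>m. of_nat (m + ?d choose ?d))) $ t"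
    unfolding inv by simp
  hence "h (k + 2) t = (\<Sum>j=0..t. ?W j * of_nat (t - j + ?d choose ?d))"
    by (simp add: fps_mult_nth)
  also have "\<dots> = (\<Sum>j\<in>{0..t} \<inter> {k..k * k}. ?W j * of_nat (t - j + ?d choose ?d))"
  proof (rule sum.mono_neutral_right)
    show "\<forall>j\<in>{0..t} - {0..t} \<inter> {k..k * k}. ?W j * of_nat (t - j + ?d choose ?d) = 0"
      using coeff_numerator_outside[of _ k] by (metis DiffD1 DiffD2 IntI mult_zero_left)
  qed auto
  also have "\<dots> = (\<Sum>j\<in>{0..t} \<inter> {k..k * k}. ?W j * poly (binomial_poly ?d j) (of_nat t))"
  proof (rule sum.cong[OF refl])
    fix j assume "j \<in> {0..t} \<inter> {k..k * k}"
    thus "?W j * of_nat (t - j + ?d choose ?d) = ?W j * poly (binomial_poly ?d j) (of_nat t)"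
      using poly_binomial_poly_nat[of ?d j "t - j"] by simp
  qed
  also have "\<dots> = (\<Sum>j=k..k * k. ?W j * poly (binomial_poly ?d j) (of_nat t))"
  proof (rule sum.mono_neutral_left)
    show "\<forall>j\<in>{k..k * k} - {0..t} \<inter> {k..k * k}. ?W j * poly (binomial_poly ?d j) (of_nat t) = 0"
    proof
      fix j assume j: "j \<in> {k..k * k} - {0..t} \<inter> {k..k * k}"
      have "k * k \<le> ?d" by (simp add: power2_eq_square)
      hence "j \<le> ?d" "t < j" using j by auto
      hence "int j \<le> int ?d" "int t < int j" by (simp_all only: of_nat_le_iff of_nat_less_iff)
      hence "poly (binomial_poly ?d j) (of_int (int t)) = 0"
        by (intro poly_binomial_poly_zero) linarith+
      thus "?W j * poly (binomial_poly ?d j) (of_nat t) = 0" by simp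
    qed
  qed auto
  finally show ?thesis by (simp add: ehrhart_poly_def poly_sum)
qed

lemma coeff_ehrhart_poly_lead: "coeff (ehrhart_poly k) ((k + 1)\<^sup>2) = 1 / fact ((k + 1)\<^sup>2) * CT (M (k + 1) 1 1 2)"
proof -
  have "poly (numerator k) 1 = (\<Sum>j=k..k * k. coeff (numerator k) j)"
  proof -
    have "poly (numerator k) 1 = (\<Sum>j\<le>degree (numerator k). coeff (numerator k) j)"
      by (simp add: poly_altdef)
    also have "\<dots> = (\<Sum>j=k..k * k. coeff (numerator k) j)"
      by (rule sum.mono_neutral_cong)
        (auto simp: coeff_numerator_outside coeff_eq_0 not_le simp del: atLeastAtMost_iff)
    finally show ?thesis .
  qed
  thus ?thesis
    by (simp add: ehrhart_poly_def coeff_sum lead_coeff_binomial_poly sum_distrib_right[symmetric]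
        poly_numerator_1[symmetric, simplified] sum_divide_distrib[symmetric])
qed

lemma degree_ehrhart_poly: "degree (ehrhart_poly k) = (k + 1)\<^sup>2"
proof (rule antisym)
  show "degree (ehrhart_poly k) \<le> (k + 1)\<^sup>2"
    unfolding ehrhart_poly_def
    by (rule degree_sum_le) (auto intro!: order_trans[OF degree_smult_le] simp: degree_binomial_poly)
  have "coeff (ehrhart_poly k) ((k + 1)\<^sup>2) \<noteq> 0"
    using poly_numerator_1_pos[of k] unfolding coeff_ehrhart_poly_lead poly_numerator_1 by simp
  thus "(k + 1)\<^sup>2 \<le> degree (ehrhart_poly k)" by (rule le_degree)
qed

text \<open>Reflection sends the binomial polynomial of j to that of k^2 + k - j up to the sign
  (-1)^d, and the two coefficients agree. The numbers (k+1)^2 and k + 1 have the same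
  parity.\<close>

lemma ehrhart_poly_reciprocity: "poly (ehrhart_poly k) (- of_nat (k + 2) - x) = (- 1) ^ (k + 1) * poly (ehrhart_poly k) x"
proof -
  let ?d = "(k + 1)\<^sup>2"
  let ?W = "\<lambda>j. coeff (numerator k) j"
  have d: "k * k + k + (k + 2) = ?d + 1" by (simp add: power2_eq_square)
  have parity: "(- 1) ^ ?d = ((- 1) ^ (k + 1) :: rat)"
    by (cases "even k") (simp_all add: power2_eq_square)
  have "poly (ehrhart_poly k) (- of_nat (k + 2) - x)
     = (\<Sum>j=k..k * k. ?W j * poly (binomial_poly ?d j) (- of_nat (k + 2) - x))"
    by (simp only: ehrhart_poly_def poly_sum poly_smult)
  also have "\<dots> = (\<Sum>j=k..k * k. ?W j * ((- 1) ^ ?d * poly (binomial_poly ?d j) x))"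
  proof (rule sum.reindex_bij_witness[of _ "\<lambda>j. k * k + k - j" "\<lambda>j. k * k + k - j"])
    fix j assume j: "j \<in> {k..k * k}"
    hence jj: "j + (k * k + k - j) = k * k + k" by simp
    have "poly (binomial_poly ?d j) (- of_nat (k + 2) - x) = (- 1) ^ ?d * poly (binomial_poly ?d (k * k + k - j)) x"
      by (rule poly_binomial_poly_reflect) (simp only: jj d)
    thus "?W (k * k + k - j) * ((- 1) ^ ?d * poly (binomial_poly ?d (k * k + k - j)) x)
       = ?W j * poly (binomial_poly ?d j) (- of_nat (k + 2) - x)"
      by (simp only: coeff_numerator_palindromic[OF jj])
  qed auto
  also have "\<dots> = (- 1) ^ ?d * poly (ehrhart_poly k) x"
    by (simp add: ehrhart_poly_def poly_sum sum_distrib_left mult_ac)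
  finally show ?thesis by (simp only: parity)
qed

text \<open>The binomial polynomial of j vanishes at j - d, ..., j - 1. As j runs through N, ...,
  k^2 + k - N with d = k^2 + 2k + 1, the common part of these intervals is the stated one.\<close>

lemma ehrhart_poly_root:
  assumes "- int (low_degree k) - int (k + 2) + 1 \<le> i" "i \<le> int (low_degree k) - 1"
  shows "poly (ehrhart_poly k) (of_int i) = 0"
  unfolding ehrhart_poly_def poly_sum poly_smult
proof (rule sum.neutral, rule ballI)
  fix j
  show "coeff (numerator k) j * poly (binomial_poly ((k + 1)\<^sup>2) j) (of_int i) = 0"
  proof (cases "low_degree k \<le> j \<and> j + low_degree k \<le> k * k + k")
    case True
    hence j: "int (low_degree k) \<le> int j" "int j + int (low_degree k) \<le> int k * int k + int k"
      by (simp_all flip: of_nat_mult of_nat_add)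
    have "int ((k + 1)\<^sup>2) = int k * int k + 2 * int k + 1" by (simp add: power2_eq_square)
    hence "poly (binomial_poly ((k + 1)\<^sup>2) j) (of_int i) = 0"
      using j assms by (intro poly_binomial_poly_zero) simp_all
    thus ?thesis by simp
  next
    case False
    thus ?thesis using coeff_numerator_low coeff_numerator_high by (auto simp: not_le)
  qed
qed

text \<open>At t = N the term j = N carries binomial(d, d) = 1; smaller j have coefficient 0 and
  larger j a vanishing binomial polynomial.\<close>

lemma ehrhart_poly_low_degree: "poly (ehrhart_poly k) (of_nat (low_degree k)) = coeff (numerator k) (low_degree k)"
proof -
  let ?N = "low_degree k"
  have "poly (ehrhart_poly k) (of_nat ?N) = (\<Sum>j=k..k * k. coeff (numerator k) j * poly (binomial_poly ((k + 1)\<^sup>2) j) (of_nat ?N))"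
    by (simp add: ehrhart_poly_def poly_sum)
  also have "\<dots> = (\<Sum>j\<in>{?N}. coeff (numerator k) j * poly (binomial_poly ((k + 1)\<^sup>2) j) (of_nat ?N))"
  proof (rule sum.mono_neutral_right)
    show "{?N} \<subseteq> {k..k * k}" using low_degree_bounds[of k] by simp
    show "\<forall>j\<in>{k..k * k} - {?N}. coeff (numerator k) j * poly (binomial_poly ((k + 1)\<^sup>2) j) (of_nat ?N) = 0"
    proof
      fix j assume j: "j \<in> {k..k * k} - {?N}"
      show "coeff (numerator k) j * poly (binomial_poly ((k + 1)\<^sup>2) j) (of_nat ?N) = 0"
      proof (cases "j < ?N")
        case True
        thus ?thesis by (simp add: coeff_numerator_low)
      next
        case False
        have "k * k \<le> (k + 1)\<^sup>2" by (simp add: power2_eq_square)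
        hence "j \<le> (k + 1)\<^sup>2" "?N < j" using j False by auto
        hence "int j \<le> int ((k + 1)\<^sup>2)" "int ?N < int j"
          by (simp_all only: of_nat_le_iff of_nat_less_iff)
        hence "poly (binomial_poly ((k + 1)\<^sup>2) j) (of_int (int ?N)) = 0"
          by (intro poly_binomial_poly_zero) linarith+
        thus ?thesis by simp
      qed
    qed
  qed simp
  also have "\<dots> = coeff (numerator k) ?N"
    using poly_binomial_poly_nat[of "(k + 1)\<^sup>2" ?N 0] by simp
  finally show ?thesis .
qed

lemma prod_linear_dvd:
  fixes p :: "'a::idom poly"
  assumes "finite A" "\<And>a. a \<in> A \<Longrightarrow> poly p (f a) = 0" "inj_on f A"
  shows "(\<Prod>a\<in>A. [:- f a, 1:]) dvd p"
  using assms
proof (induction A)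
  case (insert a A)
  then obtain q where q: "p = (\<Prod>a\<in>A. [:- f a, 1:]) * q" by (auto elim: dvdE)
  have "poly (\<Prod>b\<in>A. [:- f b, 1:]) (f a) \<noteq> 0"
    using insert.hyps insert.prems(2) by (auto simp: poly_prod prod_zero_iff)
  hence "poly q (f a) = 0" using insert.prems(1)[of a] by (simp add: q)
  then obtain q' where q': "q = [:- f a, 1:] * q'" by (auto simp: poly_eq_0_iff_dvd elim: dvdE)
  hence "p = (\<Prod>b\<in>insert a A. [:- f b, 1:]) * q'"
    unfolding q q' prod.insert[OF insert.hyps] by (simp only: mult_ac)
  thus ?case by (rule dvdI)
qed simp

theorem theorem1p3:
  fixes n N :: nat
  assumes "n \<ge> 2"
  defines "N \<equiv> (n - 1) ^ 2 div 4"
  shows "\<exists>p :: rat poly.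
    (\<forall>t :: nat. poly p (of_nat t) = h n t) \<and>
    degree p = (n - 1) ^ 2 \<and>
    lead_coeff p = 1 / fact ((n - 1) ^ 2) * CT (M (n - 1) 1 1 2) \<and>
    p = (- 1) ^ (n - 1) * pcompose p [:- of_nat n, - 1:] \<and>
    (\<exists>P :: rat poly.
       p = P * (\<Prod>i = - int N - int n + 1..int N - 1. [:- of_int i, 1:]) \<and>
       int (degree P) = (int n - 1) * (int n - 2) - 2 * int N) \<and>
    poly p (of_nat N) = (CT (M ((n - 1) div 2) (2 + of_bool (even n)) 1 2)) ^ 2"
proof -
  obtain k where n: "n = k + 2" using assms(1) by (metis add.commute le_Suc_ex)
  have n1: "n - 1 = k + 1" using n by simp
  have N: "N = low_degree k" by (simp only: N_def low_degree_def n1)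
  let ?p = "ehrhart_poly k"
  let ?I = "{- int N - int n + 1..int N - 1}"
  let ?L = "\<Prod>i\<in>?I. [:- of_int i, 1 :: rat:]"
  have rec: "?p = (- 1) ^ (n - 1) * pcompose ?p [:- of_nat n, - 1:]"
  proof (rule poly_eq_poly_eq_iff[THEN iffD1], rule ext)
    fix x
    have "poly ((- 1) ^ (n - 1) * pcompose ?p [:- of_nat n, - 1:]) x
        = (- 1) ^ (k + 1) * poly ?p (- of_nat (k + 2) - x)"
      unfolding n1 by (simp add: poly_pcompose n)
    also have "\<dots> = poly ?p x"
      unfolding ehrhart_poly_reciprocity by (simp flip: mult.assoc power_add)
    finally show "poly ?p x = poly ((- 1) ^ (n - 1) * pcompose ?p [:- of_nat n, - 1:]) x" ..
  qed
  have "?L dvd ?p"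
    by (rule prod_linear_dvd) (auto simp: inj_on_def N n intro!: ehrhart_poly_root)
  then obtain P where P: "?p = P * ?L" by (metis dvd_def mult.commute)
  have "?p \<noteq> 0" using degree_ehrhart_poly[of k] by auto
  hence "P \<noteq> 0" using P by auto
  moreover have "?L \<noteq> 0" using \<open>?p \<noteq> 0\<close> P by auto
  ultimately have "degree ?p = degree P + degree ?L"
    unfolding P by (rule degree_mult_eq)
  \<comment> \<open>The interval has 2N + n - 1 elements, and n - 1 = k + 1.\<close>
  moreover have "degree ?L = 2 * N + (k + 1)"
    by (simp add: degree_prod_eq_sum_degree n)
  ultimately have "int (degree P) = int ((k + 1)\<^sup>2) - (2 * int N + int k + 1)"
    by (simp add: degree_ehrhart_poly)
  also have "\<dots> = (int n - 1) * (int n - 2) - 2 * int N"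
    by (simp add: n power2_eq_square algebra_simps)
  finally have degP: "int (degree P) = (int n - 1) * (int n - 2) - 2 * int N" .
  show ?thesis
  proof (rule exI[of _ ?p], intro conjI)
    show "\<forall>t. poly ?p (of_nat t) = h n t" by (simp add: ehrhart_poly_eval n)
    show "degree ?p = (n - 1)\<^sup>2" by (simp only: degree_ehrhart_poly n1)
    show "lead_coeff ?p = 1 / fact ((n - 1)\<^sup>2) * CT (M (n - 1) 1 1 2)"
      by (simp only: degree_ehrhart_poly n1 coeff_ehrhart_poly_lead)
    show "\<exists>P. ?p = P * ?L \<and> int (degree P) = (int n - 1) * (int n - 2) - 2 * int N"
      using P degP by blast
    show "poly ?p (of_nat N) = (CT (M ((n - 1) div 2) (2 + of_bool (even n)) 1 2))\<^sup>2"
      unfolding N ehrhart_poly_low_degree coeff_numerator_low_degree n1 by (simp add: n)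
  qed (rule rec)
qed

end
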